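(* Let $d_1,d_2$ be positive integers, let $F=(f,g)\in\Omega_2(d_1,d_2)$ be proper, and assume that $\{a,b\}$ is a generalized node of $F$ with $F(a)=F(b)=c$. Then $\{a,b\}$ is a node of $F$ if and only if $\nu(a,b)=1$.
   Context: $\Omega_2(d_1,d_2)$ is the set of polynomial mappings $(f,g):\mathbb{C}^2\to\mathbb{C}^2$ with $\deg f\le d_1$, $\deg g\le d_2$. $J(F)=f_xg_y-f_yg_x$, $C(F)=\{J(F)=0\}$. For proper $F$, a generalized node is an unordered pair $a,b\in C(F)$ with $F(a)=F(b)$ such that $(a,b)$ is an isolated zero of $C(F)\times C(F)\ni(x,y)\mapsto F(x)-F(y)\in\mathbb{C}^2$; $\nu(a,b)=\dim_{\mathbb{C}}\mathcal{O}_{(a,b)}/(J(F)(x),J(F)(y),f(x)-f(y),g(x)-g(y))$. A node is an unordered pair $\{a,b\}$ of distinct points with $F(a)=F(b)$ such that the bi-germ of $F$ at $\{a,b\}$ is biholomorphically equivalent to the bi-germ of two transversal folds $(x_1,y_1)\mapsto(x_1^2,y_1)$, $(x_2,y_2)\mapsto(x_2,y_2^2)$. *)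

theory Defs
  imports "HOL-Analysis.Analysis"
begin

type_synonym c2 = "complex \<times> complex"
type_synonym c4 = "c2 \<times> c2"

definition poly2 :: "nat \<Rightarrow> (c2 \<Rightarrow> complex) \<Rightarrow> bool" where
  "poly2 d h \<longleftrightarrow> (\<exists>c :: nat \<Rightarrow> nat \<Rightarrow> complex.
      \<forall>x y. h (x, y) = (\<Sum>i\<le>d. \<Sum>j\<le>d - i. c i j * x ^ i * y ^ j))"

definition Omega2 :: "nat \<Rightarrow> nat \<Rightarrow> ((c2 \<Rightarrow> complex) \<times> (c2 \<Rightarrow> complex)) set" where
  "Omega2 d1 d2 = {(f, g). poly2 d1 f \<and> poly2 d2 g}"

definition pmap :: "(c2 \<Rightarrow> complex) \<Rightarrow> (c2 \<Rightarrow> complex) \<Rightarrow> c2 \<Rightarrow> c2" where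
  "pmap f g z = (f z, g z)"

definition proper_map :: "(c2 \<Rightarrow> c2) \<Rightarrow> bool" where
  "proper_map F \<longleftrightarrow> (\<forall>K. compact K \<longrightarrow> compact (F -` K))"

definition pdx :: "(c2 \<Rightarrow> complex) \<Rightarrow> c2 \<Rightarrow> complex" where
  "pdx h z = deriv (\<lambda>t. h (t, snd z)) (fst z)"

definition pdy :: "(c2 \<Rightarrow> complex) \<Rightarrow> c2 \<Rightarrow> complex" where
  "pdy h z = deriv (\<lambda>t. h (fst z, t)) (snd z)"

definition jac :: "(c2 \<Rightarrow> complex) \<Rightarrow> (c2 \<Rightarrow> complex) \<Rightarrow> c2 \<Rightarrow> complex" where
  "jac f g z = pdx f z * pdy g z - pdy f z * pdx g z"

definition crit :: "(c2 \<Rightarrow> complex) \<Rightarrow> (c2 \<Rightarrow> complex) \<Rightarrow> c2 set" where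
  "crit f g = {z. jac f g z = 0}"

definition gen_node :: "(c2 \<Rightarrow> complex) \<Rightarrow> (c2 \<Rightarrow> complex) \<Rightarrow> c2 \<Rightarrow> c2 \<Rightarrow> bool" where
  "gen_node f g a b \<longleftrightarrow> a \<in> crit f g \<and> b \<in> crit f g \<and> pmap f g a = pmap f g b \<and>
     (\<exists>e>0. \<forall>x y. x \<in> crit f g \<longrightarrow> y \<in> crit f g \<longrightarrow> pmap f g x = pmap f g y \<longrightarrow>
        dist (x, y) (a, b) < e \<longrightarrow> x = a \<and> y = b)"

definition hol2 :: "c2 set \<Rightarrow> (c2 \<Rightarrow> complex) \<Rightarrow> bool" where
  "hol2 U h \<longleftrightarrow> open U \<and> (\<forall>z\<in>U. \<exists>A B.
      (h has_derivative (\<lambda>(u, v). A * u + B * v)) (at z))"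

definition hol2map :: "c2 set \<Rightarrow> (c2 \<Rightarrow> c2) \<Rightarrow> bool" where
  "hol2map U \<phi> \<longleftrightarrow> hol2 U (\<lambda>z. fst (\<phi> z)) \<and> hol2 U (\<lambda>z. snd (\<phi> z))"

definition hol4 :: "c4 set \<Rightarrow> (c4 \<Rightarrow> complex) \<Rightarrow> bool" where
  "hol4 U h \<longleftrightarrow> open U \<and> (\<forall>w\<in>U. \<exists>A1 A2 B1 B2.
      (h has_derivative (\<lambda>((u1, u2), (v1, v2)). A1 * u1 + A2 * u2 + B1 * v1 + B2 * v2)) (at w))"

definition hol4_at :: "c4 \<Rightarrow> (c4 \<Rightarrow> complex) \<Rightarrow> bool" where
  "hol4_at p h \<longleftrightarrow> (\<exists>U. p \<in> U \<and> hol4 U h)"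

definition in_ideal :: "c4 \<Rightarrow> (c4 \<Rightarrow> complex) list \<Rightarrow> (c4 \<Rightarrow> complex) \<Rightarrow> bool" where
  "in_ideal p gs h \<longleftrightarrow> (\<exists>U hs. p \<in> U \<and> open U \<and> length hs = length gs \<and>
      (\<forall>k<length gs. hol4 U (hs ! k)) \<and>
      (\<forall>w\<in>U. h w = (\<Sum>k<length gs. (hs ! k) w * (gs ! k) w)))"

text \<open>dim_C O_p / (gs): the least number of germs spanning the quotient.\<close>
definition local_dim :: "c4 \<Rightarrow> (c4 \<Rightarrow> complex) list \<Rightarrow> nat" where
  "local_dim p gs = (LEAST n. \<exists>\<phi>s. length \<phi>s = n \<and> (\<forall>k<n. hol4_at p (\<phi>s ! k)) \<and>
      (\<forall>h. hol4_at p h \<longrightarrow> (\<exists>cs :: nat \<Rightarrow> complex.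
          in_ideal p gs (\<lambda>w. h w - (\<Sum>k<n. cs k * (\<phi>s ! k) w)))))"

definition nu :: "(c2 \<Rightarrow> complex) \<Rightarrow> (c2 \<Rightarrow> complex) \<Rightarrow> c2 \<Rightarrow> c2 \<Rightarrow> nat" where
  "nu f g a b = local_dim (a, b)
     [\<lambda>(x, y). jac f g x, \<lambda>(x, y). jac f g y, \<lambda>(x, y). f x - f y, \<lambda>(x, y). g x - g y]"

definition biholo_germ :: "(c2 \<Rightarrow> c2) \<Rightarrow> c2 \<Rightarrow> c2 \<Rightarrow> bool" where
  "biholo_germ \<phi> p q \<longleftrightarrow> \<phi> p = q \<and> (\<exists>U V \<psi>. p \<in> U \<and> open U \<and> open V \<and>
      bij_betw \<phi> U V \<and> hol2map U \<phi> \<and> hol2map V \<psi> \<and> (\<forall>x\<in>U. \<psi> (\<phi> x) = x))"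

definition fold1 :: "c2 \<Rightarrow> c2" where "fold1 z = (fst z ^ 2, snd z)"
definition fold2 :: "c2 \<Rightarrow> c2" where "fold2 z = (fst z, snd z ^ 2)"

definition bigerm_folds :: "(c2 \<Rightarrow> c2) \<Rightarrow> c2 \<Rightarrow> c2 \<Rightarrow> bool" where
  "bigerm_folds F a b \<longleftrightarrow> (\<exists>\<phi>a \<phi>b \<psi>. biholo_germ \<phi>a a 0 \<and> biholo_germ \<phi>b b 0 \<and>
      biholo_germ \<psi> (F a) 0 \<and>
      (\<forall>\<^sub>F x in nhds a. \<psi> (F x) = fold1 (\<phi>a x)) \<and>
      (\<forall>\<^sub>F x in nhds b. \<psi> (F x) = fold2 (\<phi>b x)))"

definition is_node :: "(c2 \<Rightarrow> complex) \<Rightarrow> (c2 \<Rightarrow> complex) \<Rightarrow> c2 \<Rightarrow> c2 \<Rightarrow> bool" where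
  "is_node f g a b \<longleftrightarrow> a \<noteq> b \<and> pmap f g a = pmap f g b \<and>
     (bigerm_folds (pmap f g) a b \<or> bigerm_folds (pmap f g) b a)"

end

theory Submission
  imports Defs "HOL-Complex_Analysis.Complex_Analysis" "HOL-Library.Function_Algebras"
    "Jordan_Normal_Form.Char_Poly"
begin

text \<open>
  Write J for the Jacobian of F. The vector (- J_y, J_x) at a is tangent to the critical curve; let
  e_a be its image under dF(a), and e_b the corresponding vector at b. Both conditions are equivalent
  to det (e_a, e_b) being nonzero. This determinant is, up to sign, the Jacobian of the four
  generators at (a, b), so it does not vanish iff the generators are local coordinates, that is, iff
  the local algebra is spanned by 1. If it does not vanish, take the pair consisting of J and a linear form in F
  as coordinates near a: this writes a second linear form as a function of the first one plus
  the square of J times a unit, and the two relations obtained at a and at b assemble to the normal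
  form of two transversal folds. The converse is the chain rule.

  The dimension is the least size of a spanning family, so the local algebra must also be shown to be
  finite-dimensional whenever (a, b) is isolated. Properness forces J to be nonzero and makes the
  polynomial ring in four variables modulo the generators finite over some C[u]. If (a, b)
  were not cut out by a power of u - u(a, b) and a unit, then for u near u(a, b) Nakayama's lemma and the
  weak Nullstellensatz would produce further common zeros of the generators arbitrarily close to (a, b).
\<close>

hide_const (open) Determinants.det Finite_Cartesian_Product.mat Finite_Cartesian_Product.vec
  Module.smult

section \<open>Ideals in rings of polynomial functions\<close>

text \<open>The obstacle is finiteness: \<open>local_dim\<close> is a \<open>LEAST\<close>, so it
  carries information only once some finite spanning family exists, whereas isolation of (a, b) is a
  purely topological hypothesis. The passage from one to the other is made globally, in the
  polynomial ring, where finiteness is certified by determinants. Properness acts through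
  compactness of preimages of finite sets: a linear form is bounded there, so it misses a value, and
  a missed value is exactly what Nakayama's lemma turns into an algebraic relation.

  On the analytic side, holomorphy in several variables is complex linearity of the real derivative.
  Cauchy's formula on complex lines makes derivatives holomorphic again, the real inverse function
  theorem supplies coordinates, and integrating along segments takes the place of power series.

  The two linear forms in F are those that annihilate e_a and e_b. With this choice the curves left
  over in the two normal forms are tangent to the axes, so the target change of coordinates that
  straightens both of them at once is invertible.\<close>

definition subring_set :: "'a::comm_ring_1 set \<Rightarrow> bool" where
  "subring_set R \<longleftrightarrow> 1 \<in> R \<and> (\<forall>x\<in>R. \<forall>y\<in>R. x - y \<in> R \<and> x * y \<in> R)"

text \<open>Rings are carried as subsets of an ambient ring type, in the applications the pointwise
  ring of all complex functions on a space. In this encoding an ideal is an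
  \<open>R\<close>-submodule of the ambient ring; inclusion in \<open>R\<close> is stated apart, as
  \<open>I \<subseteq> R\<close>.\<close>

definition ideal_of :: "'a::comm_ring_1 set \<Rightarrow> 'a set \<Rightarrow> bool" where
  "ideal_of R L \<longleftrightarrow> 0 \<in> L \<and> (\<forall>x\<in>L. \<forall>y\<in>L. x + y \<in> L) \<and> (\<forall>r\<in>R. \<forall>x\<in>L. r * x \<in> L)"

lemma subring_setD:
  assumes "subring_set R"
  shows "1 \<in> R" "0 \<in> R" "x \<in> R \<Longrightarrow> y \<in> R \<Longrightarrow> x - y \<in> R" "x \<in> R \<Longrightarrow> y \<in> R \<Longrightarrow> x * y \<in> R"
    "x \<in> R \<Longrightarrow> - x \<in> R" "x \<in> R \<Longrightarrow> y \<in> R \<Longrightarrow> x + y \<in> R"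
proof -
  show 1: "1 \<in> R" and d: "\<And>x y. x \<in> R \<Longrightarrow> y \<in> R \<Longrightarrow> x - y \<in> R"
    and "x \<in> R \<Longrightarrow> y \<in> R \<Longrightarrow> x * y \<in> R"
    using assms by (auto simp: subring_set_def)
  show 0: "0 \<in> R" using d[OF 1 1] by simp
  show n: "\<And>x. x \<in> R \<Longrightarrow> - x \<in> R" using d[OF 0] by simp
  show "x \<in> R \<Longrightarrow> y \<in> R \<Longrightarrow> x + y \<in> R" using d[OF _ n, of x y] by simp
qed

lemma subring_set_power: "subring_set R \<Longrightarrow> x \<in> R \<Longrightarrow> x ^ n \<in> R"
  by (induction n) (auto intro: subring_setD)

lemma subring_set_sum: "subring_set R \<Longrightarrow> (\<And>i. i \<in> A \<Longrightarrow> x i \<in> R) \<Longrightarrow> sum x A \<in> R"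
  by (induction A rule: infinite_finite_induct) (auto intro: subring_setD)

lemma subring_set_prod: "subring_set R \<Longrightarrow> (\<And>i. i \<in> A \<Longrightarrow> x i \<in> R) \<Longrightarrow> prod x A \<in> R"
  by (induction A rule: infinite_finite_induct) (auto intro: subring_setD)

lemma ideal_ofD:
  assumes "ideal_of R L"
  shows "0 \<in> L" "x \<in> L \<Longrightarrow> y \<in> L \<Longrightarrow> x + y \<in> L" "r \<in> R \<Longrightarrow> x \<in> L \<Longrightarrow> r * x \<in> L"
    "r \<in> R \<Longrightarrow> x \<in> L \<Longrightarrow> x * r \<in> L"
  using assms by (auto simp: ideal_of_def mult.commute)

lemma ideal_of_minus:
  assumes "subring_set R" "ideal_of R L"
  shows "x \<in> L \<Longrightarrow> - x \<in> L" "x \<in> L \<Longrightarrow> y \<in> L \<Longrightarrow> x - y \<in> L"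
proof -
  show *: "- x \<in> L" if "x \<in> L" for x
    using ideal_ofD(3)[OF assms(2) subring_setD(5)[OF assms(1) subring_setD(1)[OF assms(1)]] that]
    by simp
  show "x \<in> L \<Longrightarrow> y \<in> L \<Longrightarrow> x - y \<in> L"
    using ideal_ofD(2)[OF assms(2) _ *, of x y] by simp
qed

lemma ideal_of_sum: "ideal_of R L \<Longrightarrow> (\<And>i. i \<in> A \<Longrightarrow> x i \<in> L) \<Longrightarrow> sum x A \<in> L"
  by (induction A rule: infinite_finite_induct) (auto intro: ideal_ofD)

definition ideal_adjoin :: "'a::comm_ring_1 set \<Rightarrow> 'a set \<Rightarrow> 'a \<Rightarrow> 'a set" where
  "ideal_adjoin R L s = {x + k * s | x k. x \<in> L \<and> k \<in> R}"

lemma ideal_adjoin: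
  assumes R: "subring_set R" and L: "ideal_of R L"
  shows "ideal_of R (ideal_adjoin R L s)" "L \<subseteq> ideal_adjoin R L s" "s \<in> ideal_adjoin R L s"
proof -
  show sub: "L \<subseteq> ideal_adjoin R L s"
    unfolding ideal_adjoin_def using subring_setD(2)[OF R] by force
  show "s \<in> ideal_adjoin R L s"
    unfolding ideal_adjoin_def using subring_setD(1)[OF R] ideal_ofD(1)[OF L] by force
  show "ideal_of R (ideal_adjoin R L s)"
    unfolding ideal_of_def
  proof (intro conjI ballI)
    show "0 \<in> ideal_adjoin R L s" using sub ideal_ofD(1)[OF L] by auto
  next
    fix x y assume "x \<in> ideal_adjoin R L s" "y \<in> ideal_adjoin R L s"
    then obtain a k b l where ab: "x = a + k * s" "y = b + l * s" "a \<in> L" "b \<in> L" "k \<in> R" "l \<in> R"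
      unfolding ideal_adjoin_def by blast
    then have "x + y = (a + b) + (k + l) * s" by (simp add: algebra_simps)
    then show "x + y \<in> ideal_adjoin R L s"
      unfolding ideal_adjoin_def using ab ideal_ofD(2)[OF L] subring_setD(6)[OF R] by blast
  next
    fix r x assume r: "r \<in> R" and "x \<in> ideal_adjoin R L s"
    then obtain a k where ab: "x = a + k * s" "a \<in> L" "k \<in> R"
      unfolding ideal_adjoin_def by blast
    then have "r * x = r * a + (r * k) * s" by (simp add: algebra_simps)
    then show "r * x \<in> ideal_adjoin R L s"
      unfolding ideal_adjoin_def using ab r ideal_ofD(3)[OF L] subring_setD(4)[OF R] by blast
  qed
qed

text \<open>Multiplying the system M m = 0 (mod \<open>L\<close>) by the adjugate of M leaves det M
  times each m_k. For a characteristic matrix this is Cayley-Hamilton; for a matrix that becomes the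
  identity at a point it is Nakayama's lemma. \<open>ev\<close> lets the matrix live over an
  abstract polynomial ring that acts on functions.\<close>

lemma det_annihilates:
  fixes ev :: "'r::comm_ring_1 \<Rightarrow> 'a::comm_ring_1" and m :: "nat \<Rightarrow> 'a"
  assumes hom: "comm_ring_hom ev" and L: "ideal_of R L" and evR: "\<And>x. ev x \<in> R"
    and M: "M \<in> carrier_mat n n"
    and rows: "\<And>i. i < n \<Longrightarrow> (\<Sum>j<n. ev (M $$ (i, j)) * m j) \<in> L" and k: "k < n"
  shows "ev (det M) * m k \<in> L"
proof -
  interpret comm_ring_hom ev by (rule hom)
  note adj = adj_mat[OF M]
  have e: "(\<Sum>i<n. adj_mat M $$ (k, i) * M $$ (i, j)) = (if k = j then det M else 0)" if "j < n" for j
  proof -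
    have "(adj_mat M * M) $$ (k, j) = (\<Sum>i<n. adj_mat M $$ (k, i) * M $$ (i, j))"
      using that k adj(1) M by (auto simp: times_mat_def scalar_prod_def lessThan_atLeast0 intro!: sum.cong)
    then show ?thesis using that k by (cases "k = j") (simp_all add: adj(3))
  qed
  have "ev (det M) * m k = (\<Sum>j<n. ev (if k = j then det M else 0) * m j)"
    using k by (simp add: if_distrib[of ev] if_distrib[of "\<lambda>x. x * _"] cong: if_cong)
  also have "\<dots> = (\<Sum>j<n. ev (\<Sum>i<n. adj_mat M $$ (k, i) * M $$ (i, j)) * m j)"
    by (intro sum.cong refl) (simp add: e)
  also have "\<dots> = (\<Sum>j<n. \<Sum>i<n. ev (adj_mat M $$ (k, i)) * (ev (M $$ (i, j)) * m j))"
    by (simp add: hom_sum hom_mult sum_distrib_right mult.assoc)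
  also have "\<dots> = (\<Sum>i<n. ev (adj_mat M $$ (k, i)) * (\<Sum>j<n. ev (M $$ (i, j)) * m j))"
    by (subst sum.swap) (simp add: sum_distrib_left)
  also have "\<dots> \<in> L"
    by (rule ideal_of_sum[OF L]) (auto intro!: ideal_ofD(3)[OF L] evR rows)
  finally show ?thesis .
qed

section \<open>Evaluation of polynomials at functions\<close>

definition peval :: "complex poly \<Rightarrow> ('w \<Rightarrow> complex) \<Rightarrow> 'w \<Rightarrow> complex" where
  "peval q t = (\<lambda>w. poly q (t w))"

text \<open>The outer variable of \<open>\<Phi>\<close> is t, and its coefficients are polynomials
  in s. Hence \<open>degree\<close> and \<open>lead_coeff\<close> always refer to t, and a monic
  \<open>\<Phi>\<close> expresses integrality over the polynomials in s.\<close>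

definition ev2 :: "complex poly poly \<Rightarrow> complex \<Rightarrow> complex \<Rightarrow> complex" where
  "ev2 \<Phi> s t = poly (poly \<Phi> [:t:]) s"

definition peval2 :: "complex poly poly \<Rightarrow> ('w \<Rightarrow> complex) \<Rightarrow> ('w \<Rightarrow> complex) \<Rightarrow> 'w \<Rightarrow> complex" where
  "peval2 \<Phi> u v = (\<lambda>w. ev2 \<Phi> (u w) (v w))"

lemma ev2_simps [simp]:
  "ev2 0 s t = 0" "ev2 1 s t = 1" "ev2 (\<Phi> + \<Psi>) s t = ev2 \<Phi> s t + ev2 \<Psi> s t"
  "ev2 (\<Phi> - \<Psi>) s t = ev2 \<Phi> s t - ev2 \<Psi> s t" "ev2 (- \<Phi>) s t = - ev2 \<Phi> s t"
  "ev2 (\<Phi> * \<Psi>) s t = ev2 \<Phi> s t * ev2 \<Psi> s t" "ev2 (\<Phi> ^ n) s t = ev2 \<Phi> s t ^ n"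
  "ev2 (pCons q \<Phi>) s t = poly q s + t * ev2 \<Phi> s t" "ev2 (smult q \<Phi>) s t = poly q s * ev2 \<Phi> s t"
  by (simp_all add: ev2_def)

lemma ev2_sum: "ev2 (sum \<Phi> A) s t = (\<Sum>i\<in>A. ev2 (\<Phi> i) s t)"
  by (induction A rule: infinite_finite_induct) auto

lemma sum_fun_apply: "(sum f A :: 'w \<Rightarrow> 'b::comm_monoid_add) w = (\<Sum>i\<in>A. f i w)"
  by (induction A rule: infinite_finite_induct) auto

lemma power_fun_apply: "((f :: 'w \<Rightarrow> 'b::comm_semiring_1) ^ n) w = f w ^ n"
  by (induction n) auto

lemma prod_fun_apply: "(prod f A :: 'w \<Rightarrow> 'b::comm_monoid_mult) w = (\<Prod>i\<in>A. f i w)"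
  by (induction A rule: infinite_finite_induct) auto

lemma comm_ring_hom_peval: "comm_ring_hom (\<lambda>q. peval q t)"
  by unfold_locales (auto simp: peval_def fun_eq_iff)

lemma comm_ring_hom_peval2: "comm_ring_hom (\<lambda>\<Phi>. peval2 \<Phi> u v)"
  by unfold_locales (auto simp: peval2_def fun_eq_iff)

lemma comm_ring_hom_ev2: "comm_ring_hom (\<lambda>\<Phi>. ev2 \<Phi> s t)"
  by unfold_locales auto

definition Cst :: "'b \<Rightarrow> 'w \<Rightarrow> 'b" where
  "Cst c = (\<lambda>_. c)"

lemma Cst_apply [simp]: "Cst c w = c"
  by (simp add: Cst_def)

lemma Cst_0: "Cst 0 = 0" and Cst_1: "Cst 1 = 1"
  by (auto simp: fun_eq_iff)

lemma Cst_mult: "Cst (c * d) = Cst c * (Cst d :: 'w \<Rightarrow> complex)"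
  by (simp add: fun_eq_iff)

text \<open>Polynomial functions are generated rather than represented by coefficients: a fact about
  all of them is one induction with four cases, and the number of variables stays open.\<close>

inductive_set poly_ring :: "('w \<Rightarrow> complex) set \<Rightarrow> ('w \<Rightarrow> complex) set" for C where
  const: "Cst c \<in> poly_ring C"
| coord: "t \<in> C \<Longrightarrow> t \<in> poly_ring C"
| add: "g \<in> poly_ring C \<Longrightarrow> h \<in> poly_ring C \<Longrightarrow> g + h \<in> poly_ring C"
| mult: "g \<in> poly_ring C \<Longrightarrow> h \<in> poly_ring C \<Longrightarrow> g * h \<in> poly_ring C"

lemma subring_poly_ring: "subring_set (poly_ring C)"
proof -
  have 1: "1 \<in> poly_ring C" using poly_ring.const[of 1] by (simp only: Cst_1)
  have "x - y \<in> poly_ring C" if "x \<in> poly_ring C" "y \<in> poly_ring C" for x y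
  proof -
    have "x - y = x + Cst (-1) * y" by (simp add: fun_eq_iff)
    then show ?thesis using that by (simp only: poly_ring.intros)
  qed
  with 1 show ?thesis by (auto simp: subring_set_def intro: poly_ring.mult)
qed

lemmas poly_ring_closed = subring_setD[OF subring_poly_ring]

lemma peval_in_poly_ring: "t \<in> poly_ring C \<Longrightarrow> peval q t \<in> poly_ring C"
proof (induction q)
  case 0
  have "peval 0 t = 0" by (simp add: peval_def fun_eq_iff)
  then show ?case using poly_ring.const[of 0 C] by (simp only: Cst_0)
next
  case (pCons a q)
  have "peval (pCons a q) t = Cst a + t * peval q t" by (simp add: peval_def fun_eq_iff)
  then show ?case using pCons by (simp only: poly_ring.intros)
qed

lemma peval2_in_poly_ring:
  "u \<in> poly_ring C \<Longrightarrow> v \<in> poly_ring C \<Longrightarrow> peval2 \<Phi> u v \<in> poly_ring C"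
proof (induction \<Phi>)
  case 0
  have "peval2 0 u v = 0" by (simp add: peval2_def fun_eq_iff)
  then show ?case using poly_ring.const[of 0 C] by (simp only: Cst_0)
next
  case (pCons a q)
  have "peval2 (pCons a q) u v = peval a u + v * peval2 q u v"
    by (simp add: peval_def peval2_def fun_eq_iff)
  then show ?case using pCons by (simp only: poly_ring.intros peval_in_poly_ring)
qed

section \<open>Weak Nullstellensatz for algebraic ideals\<close>

lemma ideal_const_imp_one:
  assumes L: "ideal_of (poly_ring C) L" and "Cst c \<in> L" "c \<noteq> 0"
  shows "1 \<in> L"
proof -
  have "Cst (inverse c) * Cst c \<in> L"
    using ideal_ofD(3)[OF L poly_ring.const assms(2)] .
  then show ?thesis using \<open>c \<noteq> 0\<close> by (simp add: Cst_mult[symmetric] Cst_1)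
qed

text \<open>If adjoining t - r gave the unit ideal for every r, a linear factor could be cancelled
  from q without leaving \<open>L\<close>; repeating this would end with a nonzero constant in
  \<open>L\<close>.\<close>

lemma ideal_adjoin_root:
  assumes L: "ideal_of (poly_ring C) L" and nontriv: "1 \<notin> L" and t: "t \<in> poly_ring C"
    and "q \<noteq> 0" "peval q t \<in> L"
  shows "\<exists>r. 1 \<notin> ideal_adjoin (poly_ring C) L (t - Cst r)"
  using assms(4,5)
proof (induction "degree q" arbitrary: q rule: less_induct)
  case less
  show ?case
  proof (cases "degree q = 0")
    case True
    then obtain c where c: "q = [:c:]" by (rule degree_eq_zeroE)
    moreover have "peval [:c:] t = Cst c" by (simp add: peval_def fun_eq_iff)
    ultimately have "Cst c \<in> L" "c \<noteq> 0" using less.prems by auto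
    then show ?thesis using ideal_const_imp_one[OF L] nontriv by blast
  next
    case False
    then obtain r where r: "poly q r = 0"
      using fundamental_theorem_of_algebra[of q] by (auto simp: constant_degree)
    then obtain q' where q': "q = [:- r, 1:] * q'" by (meson dvdE poly_eq_0_iff_dvd)
    have "q' \<noteq> 0" using q' less.prems by auto
    then have deg: "degree q' < degree q" using q' by (subst q', subst degree_mult_eq) auto
    show ?thesis
    proof (rule ccontr)
      assume neg: "\<not> ?thesis"
      then obtain h k where hk: "1 = h + k * (t - Cst r)" "h \<in> L" "k \<in> poly_ring C"
        unfolding ideal_adjoin_def by blast
      \<comment> \<open>The relation 1 = h + k (t - r) is multiplied by q'(t); the product q'(t) (t
        - r) is q(t), which lies in \<open>L\<close>.\<close>
      have "peval q' t = peval q' t * (h + k * (t - Cst r))" using hk(1) by simp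
      also have "\<dots> = peval q' t * h + k * peval q t"
        by (simp add: q' peval_def fun_eq_iff algebra_simps)
      also have "\<dots> \<in> L"
        using hk less.prems by (intro ideal_ofD[OF L] peval_in_poly_ring t)
      finally show False using less.hyps[OF deg \<open>q' \<noteq> 0\<close>] neg by blast
    qed
  qed
qed

text \<open>Adjoining t - r for one generator t after another keeps the ideal proper and makes every
  h congruent to the constant h(w), where w is the point with coordinates r. An h in
  \<open>L\<close> therefore puts the constant h(w) into a proper ideal, so h(w) = 0. The hypothesis
  \<open>pts\<close> provides the point w.\<close>

lemma algebraic_ideal_has_zero:
  assumes C: "finite C" and L: "ideal_of (poly_ring C) L" and nontriv: "1 \<notin> L"
    and alg: "\<And>t. t \<in> C \<Longrightarrow> \<exists>q. q \<noteq> 0 \<and> peval q t \<in> L"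
    and pts: "\<And>r. \<exists>w. \<forall>t\<in>C. t w = r t"
  shows "\<exists>w. \<forall>h \<in> poly_ring C. h \<in> L \<longrightarrow> h w = 0"
proof -
  have "\<exists>L'. ideal_of (poly_ring C) L' \<and> L \<subseteq> L' \<and> 1 \<notin> L' \<and> (\<forall>t\<in>D. \<exists>r. t - Cst r \<in> L')"
    if "finite D" "D \<subseteq> C" for D
    using that
  proof (induction D rule: finite_induct)
    case empty
    then show ?case using L nontriv by blast
  next
    case (insert t D)
    then obtain L' where L': "ideal_of (poly_ring C) L'" "L \<subseteq> L'" "1 \<notin> L'"
        "\<And>t. t \<in> D \<Longrightarrow> \<exists>r. t - Cst r \<in> L'"
      by blast
    have "t \<in> C" using insert.prems by blast
    then obtain q where q: "q \<noteq> 0" "peval q t \<in> L'" using alg L'(2) by blast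
    from ideal_adjoin_root[OF L'(1,3) poly_ring.coord[OF \<open>t \<in> C\<close>] q] obtain r where
      r: "1 \<notin> ideal_adjoin (poly_ring C) L' (t - Cst r)" by blast
    note ad = ideal_adjoin[OF subring_poly_ring L'(1), of "t - Cst r"]
    show ?case
      using ad r L' by (intro exI[of _ "ideal_adjoin (poly_ring C) L' (t - Cst r)"]) blast
  qed
  from this[OF C subset_refl] obtain L' where L': "ideal_of (poly_ring C) L'" "L \<subseteq> L'" "1 \<notin> L'"
    "\<forall>t\<in>C. \<exists>r. t - Cst r \<in> L'" by blast
  then obtain r where r: "\<And>t. t \<in> C \<Longrightarrow> t - Cst (r t) \<in> L'" by metis
  obtain w where w: "\<And>t. t \<in> C \<Longrightarrow> t w = r t" using pts by blast
  have key: "h - Cst (h w) \<in> L'" if "h \<in> poly_ring C" for h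
    using that
  proof (induction rule: poly_ring.induct)
    case (const c)
    have "Cst c - Cst (Cst c w) = (0 :: 'a \<Rightarrow> complex)" by (simp add: fun_eq_iff)
    then show ?case using ideal_ofD(1)[OF L'(1)] by (simp only:)
  next
    case (coord t)
    show ?case using r[OF coord] by (simp only: w[OF coord])
  next
    case (add g h)
    have "g + h - Cst ((g + h) w) = (g - Cst (g w)) + (h - Cst (h w))" by (simp add: fun_eq_iff)
    then show ?case using ideal_ofD(2)[OF L'(1) add.IH] by (simp only:)
  next
    case (mult g h)
    have "g * h - Cst ((g * h) w) = g * (h - Cst (h w)) + Cst (h w) * (g - Cst (g w))"
      by (simp add: fun_eq_iff algebra_simps)
    then show ?case
      using ideal_ofD(2)[OF L'(1) ideal_ofD(3)[OF L'(1) mult.hyps(1) mult.IH(2)]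
        ideal_ofD(3)[OF L'(1) poly_ring.const mult.IH(1)]] by (simp only:)
  qed
  show ?thesis
  proof (intro exI ballI impI)
    fix h assume h: "h \<in> poly_ring C" "h \<in> L"
    have "h - (h - Cst (h w)) \<in> L'"
      using h L' key ideal_of_minus(2)[OF subring_poly_ring L'(1)] by blast
    then have "Cst (h w) \<in> L'" by simp
    then show "h w = 0" using ideal_const_imp_one[OF L'(1)] L'(3) by blast
  qed
qed

section \<open>Finitely generated quotients\<close>


text \<open>R / I is a finite module over the image of \<open>ev\<close>. The coefficients are taken
  before evaluation, so that they can serve as entries of matrices with a determinant.\<close>

definition fin_gen :: "'a::comm_ring_1 set \<Rightarrow> 'a set \<Rightarrow> ('r \<Rightarrow> 'a) \<Rightarrow> bool" where
  "fin_gen R I ev \<longleftrightarrow> (\<exists>n m. (\<forall>i<n. m i \<in> R) \<and>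
     (\<forall>h\<in>R. \<exists>c. h - (\<Sum>i<(n::nat). ev (c i) * m i) \<in> I))"

section \<open>The determinant trick: integrality and Nakayama's lemma\<close>

lemma annihilates_generators:
  assumes R: "subring_set R" and L: "ideal_of R L" and IL: "I \<subseteq> L" and evR: "\<And>x. ev x \<in> R"
    and gen: "\<forall>h\<in>R. \<exists>c. h - (\<Sum>i<(n::nat). ev (c i) * m i) \<in> I"
    and r: "r \<in> R" and ann: "\<And>k. k < n \<Longrightarrow> r * m k \<in> L"
  shows "r \<in> L"
proof -
  \<comment> \<open>Killing the generators kills the whole quotient, because 1 is a combination of
    them modulo \<open>I\<close>.\<close>
  obtain c where c: "1 - (\<Sum>i<n. ev (c i) * m i) \<in> I" using gen subring_setD(1)[OF R] by blast
  have "r = r * (1 - (\<Sum>i<n. ev (c i) * m i)) + (\<Sum>i<n. ev (c i) * (r * m i))"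
    by (simp add: algebra_simps sum_distrib_left)
  also have "\<dots> \<in> L"
    using c IL by (intro ideal_ofD(2)[OF L] ideal_of_sum[OF L] ideal_ofD(3)[OF L] evR r ann) auto
  finally show ?thesis .
qed

text \<open>Cayley-Hamilton: on the module generators, multiplication by t is a matrix over the
  polynomials in u, and its characteristic polynomial is monic and annihilates the quotient at
  t.\<close>

lemma fin_gen_imp_integral:
  assumes R: "R = poly_ring C" and I: "ideal_of R I" and u: "u \<in> R" and t: "t \<in> R"
    and fg: "fin_gen R I (\<lambda>q. peval q u)"
  shows "\<exists>\<Phi>. lead_coeff \<Phi> = 1 \<and> peval2 \<Phi> u t \<in> I"
proof -
  have Rs: "subring_set R" unfolding R by (rule subring_poly_ring)
  obtain n m where m: "\<forall>i<n. m i \<in> R"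
    and gen: "\<forall>h\<in>R. \<exists>c. h - (\<Sum>i<(n::nat). peval (c i) u * m i) \<in> I"
    using fg unfolding fin_gen_def by blast
  have "\<forall>i. \<exists>c. i < n \<longrightarrow> t * m i - (\<Sum>j<n. peval (c j) u * m j) \<in> I"
    using gen m t subring_setD(4)[OF Rs] by blast
  then obtain c where c: "\<And>i. i < n \<Longrightarrow> t * m i - (\<Sum>j<n. peval (c i j) u * m j) \<in> I" by metis
  define A where "A = mat n n (\<lambda>(i, j). c i j)"
  have A: "A \<in> carrier_mat n n" by (simp add: A_def)
  \<comment> \<open>The indeterminate of the characteristic polynomial is the outer variable and
    becomes t; the entries of A are evaluated at u.\<close>
  have e: "peval2 (char_poly_matrix A $$ (i, j)) u t = (if i = j then t else 0) - peval (c i j) u"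
    if "i < n" "j < n" for i j
    using that by (auto simp: char_poly_matrix_def A_def peval2_def peval_def fun_eq_iff)
  have evR: "peval2 \<Phi> u t \<in> R" for \<Phi>
    using u t unfolding R by (rule peval2_in_poly_ring)
  have "peval2 (det (char_poly_matrix A)) u t * m k \<in> I" if "k < n" for k
  proof (rule det_annihilates[OF comm_ring_hom_peval2 I evR char_poly_matrix_closed[OF A] _ that])
    fix i assume i: "i < n"
    have "(\<Sum>j<n. peval2 (char_poly_matrix A $$ (i, j)) u t * m j)
        = (\<Sum>j<n. (if i = j then t * m j else 0) - peval (c i j) u * m j)"
      by (intro sum.cong refl) (simp only: e[OF i] lessThan_iff, simp add: fun_eq_iff algebra_simps)
    also have "\<dots> = t * m i - (\<Sum>j<n. peval (c i j) u * m j)"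
      using i by (simp add: sum_subtractf)
    finally show "(\<Sum>j<n. peval2 (char_poly_matrix A $$ (i, j)) u t * m j) \<in> I"
      using c[OF i] by simp
  qed
  then have "peval2 (char_poly A) u t \<in> I"
    unfolding char_poly_def[symmetric]
    by (intro annihilates_generators[OF Rs I subset_refl _ gen evR])
       (use u in \<open>auto simp: R intro: peval_in_poly_ring\<close>)
  moreover have "lead_coeff (char_poly A) = 1" using degree_monic_char_poly[OF A] by auto
  ultimately show ?thesis by blast
qed

lemma peval_cong_ideal:
  assumes L: "ideal_of (poly_ring C) L" and u: "u \<in> poly_ring C" and us: "u - Cst s \<in> L"
  shows "peval q u - Cst (poly q s) \<in> L"
proof (induction q)
  case 0
  have "peval 0 u - Cst (poly 0 s) = 0" by (simp add: peval_def fun_eq_iff)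
  then show ?case using ideal_ofD(1)[OF L] by (simp only:)
next
  case (pCons a q)
  have "peval (pCons a q) u - Cst (poly (pCons a q) s)
      = u * (peval q u - Cst (poly q s)) + Cst (poly q s) * (u - Cst s)"
    by (simp add: peval_def fun_eq_iff algebra_simps)
  also have "\<dots> \<in> L"
    by (intro ideal_ofD(2,3)[OF L] u us poly_ring.const pCons.IH)
  finally show ?case .
qed

lemma peval2_cong_ideal:
  assumes L: "ideal_of (poly_ring C) L" and u: "u \<in> poly_ring C" and us: "u - Cst s \<in> L"
    and v: "v \<in> poly_ring C" and vt: "v - Cst t \<in> L"
  shows "peval2 q u v - Cst (ev2 q s t) \<in> L"
proof (induction q)
  case 0
  have "peval2 0 u v - Cst (ev2 0 s t) = 0" by (simp add: peval2_def fun_eq_iff)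
  then show ?case using ideal_ofD(1)[OF L] by (simp only:)
next
  case (pCons a q)
  have "peval2 (pCons a q) u v - Cst (ev2 (pCons a q) s t)
      = (peval a u - Cst (poly a s)) + (v * (peval2 q u v - Cst (ev2 q s t)) + Cst (ev2 q s t) * (v - Cst t))"
    by (simp add: peval_def peval2_def fun_eq_iff algebra_simps)
  also have "\<dots> \<in> L"
    by (intro ideal_ofD(2,3)[OF L] v vt poly_ring.const peval_cong_ideal[OF L u us] pCons.IH)
  finally show ?case .
qed

text \<open>Over a point (s, t) missed by (u, v) on the zero set, the fibre algebra R / (I + (u - s,
  v - t)) is finite-dimensional and has no point, so it is zero by the weak Nullstellensatz.
  Nakayama's lemma then produces an element of C[u, v] that kills R / I and does not vanish at (s,
  t).\<close>

lemma nakayama_empty_fibre: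
  assumes R: "R = poly_ring C" and C: "finite C" and pts: "\<And>r. \<exists>w. \<forall>t\<in>C. t w = r t"
    and I: "ideal_of R I" and IR: "I \<subseteq> R" and u: "u \<in> R" and v: "v \<in> R"
    and fg: "fin_gen R I (\<lambda>\<Phi>. peval2 \<Phi> u v)"
    and nopt: "\<And>w. (\<And>h. h \<in> I \<Longrightarrow> h w = 0) \<Longrightarrow> u w = s \<Longrightarrow> v w = t \<Longrightarrow> False"
  shows "\<exists>\<Phi>. ev2 \<Phi> s t \<noteq> 0 \<and> peval2 \<Phi> u v \<in> I"
proof -
  have Rs: "subring_set R" unfolding R by (rule subring_poly_ring)
  have cR: "Cst c \<in> R" for c unfolding R by (rule poly_ring.const)
  have evR: "peval2 \<Phi> u v \<in> R" for \<Phi>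
    using u v unfolding R by (rule peval2_in_poly_ring)
  obtain n m where m: "\<forall>i<n. m i \<in> R"
    and gen: "\<forall>h\<in>R. \<exists>c. h - (\<Sum>i<(n::nat). peval2 (c i) u v * m i) \<in> I"
    using fg unfolding fin_gen_def by blast
  have mult_gen: "\<exists>c. \<forall>i<n. h * m i - (\<Sum>j<n. peval2 (c i j) u v * m j) \<in> I" if "h \<in> R" for h
  proof -
    have "\<forall>i. \<exists>c. i < n \<longrightarrow> h * m i - (\<Sum>j<n. peval2 (c j) u v * m j) \<in> I"
      using gen m that subring_setD(4)[OF Rs] by blast
    then show ?thesis by metis
  qed
  define L1 where "L1 = ideal_adjoin R I (u - Cst s)"
  define L where "L = ideal_adjoin R L1 (v - Cst t)"
  note L1 = ideal_adjoin[OF Rs I, of "u - Cst s", folded L1_def]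
  note L = ideal_adjoin[OF Rs L1(1), of "v - Cst t", folded L_def]
  have IL: "I \<subseteq> L" and uL: "u - Cst s \<in> L" and vL: "v - Cst t \<in> L" using L1 L by auto
  have "1 \<in> L"
  proof (rule ccontr)
    assume nontriv: "1 \<notin> L"
    have "\<exists>q. q \<noteq> 0 \<and> peval q x \<in> L" if "x \<in> C" for x
    proof -
      have x: "x \<in> R" unfolding R by (rule poly_ring.coord[OF that])
      obtain c where c: "\<And>i. i < n \<Longrightarrow> x * m i - (\<Sum>j<n. peval2 (c i j) u v * m j) \<in> I"
        using mult_gen[OF x] by blast
      \<comment> \<open>Modulo \<open>L\<close> the coefficients become their values at (s, t), so x
        acts on the generators by a complex matrix and is a root of its characteristic
        polynomial.\<close>
      define A where "A = mat n n (\<lambda>(i, j). ev2 (c i j) s t)"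
      have A: "A \<in> carrier_mat n n" by (simp add: A_def)
      have e: "peval (char_poly_matrix A $$ (i, j)) x = (if i = j then x else 0) - Cst (ev2 (c i j) s t)"
        if "i < n" "j < n" for i j
        using that by (auto simp: char_poly_matrix_def A_def peval_def fun_eq_iff)
      have pR: "peval q x \<in> R" for q using x unfolding R by (rule peval_in_poly_ring)
      have "peval (det (char_poly_matrix A)) x * m k \<in> L" if "k < n" for k
      proof (rule det_annihilates[OF comm_ring_hom_peval L(1) pR char_poly_matrix_closed[OF A] _ that])
        fix i assume i: "i < n"
        have "(\<Sum>j<n. peval (char_poly_matrix A $$ (i, j)) x * m j)
            = (\<Sum>j<n. (if i = j then x * m j else 0) - Cst (ev2 (c i j) s t) * m j)"
          by (intro sum.cong refl) (simp only: e[OF i] lessThan_iff, simp add: fun_eq_iff algebra_simps)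
        also have "\<dots> = x * m i - (\<Sum>j<n. Cst (ev2 (c i j) s t) * m j)"
          using i by (simp add: sum_subtractf)
        also have "\<dots> = (x * m i - (\<Sum>j<n. peval2 (c i j) u v * m j))
            + (\<Sum>j<n. m j * (peval2 (c i j) u v - Cst (ev2 (c i j) s t)))"
          by (simp only: sum_subtractf right_diff_distrib mult.commute[of "m _"]) simp
        also have "\<dots> \<in> L"
          using c[OF i] IL m L(1) u uL v vL 
          by (intro ideal_ofD(2)[OF L(1)] ideal_of_sum[OF L(1)] ideal_ofD(3)[OF L(1)] peval2_cong_ideal[of C])
             (auto simp: R)
        finally show "(\<Sum>j<n. peval (char_poly_matrix A $$ (i, j)) x * m j) \<in> L" .
      qed
      then have "peval (char_poly A) x \<in> L"
        unfolding char_poly_def[symmetric]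
        by (intro annihilates_generators[OF Rs L(1) IL evR gen pR])
      moreover have "char_poly A \<noteq> 0" using degree_monic_char_poly[OF A] by auto
      ultimately show ?thesis by blast
    qed
    from algebraic_ideal_has_zero[OF C L(1)[unfolded R] nontriv this pts]
    obtain w where w: "\<And>h. h \<in> R \<Longrightarrow> h \<in> L \<Longrightarrow> h w = 0" unfolding R by blast
    have "(u - Cst s) w = 0" "(v - Cst t) w = 0"
      by (rule w; use subring_setD(3)[OF Rs] u v cR uL vL in blast)+
    then show False using nopt[of w] w IR IL by auto
  qed
  then obtain i A B where iAB: "1 = (i + A * (u - Cst s)) + B * (v - Cst t)" "i \<in> I" "A \<in> R" "B \<in> R"
    unfolding L_def L1_def ideal_adjoin_def by blast
  obtain a where a: "\<And>i. i < n \<Longrightarrow> A * m i - (\<Sum>j<n. peval2 (a i j) u v * m j) \<in> I"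
    using mult_gen[OF iAB(3)] by blast
  obtain b where b: "\<And>i. i < n \<Longrightarrow> B * m i - (\<Sum>j<n. peval2 (b i j) u v * m j) \<in> I"
    using mult_gen[OF iAB(4)] by blast
  \<comment> \<open>M encodes 1 - (u - s) A - (v - t) B acting on the generators. This operator is
    multiplication by i, hence zero modulo \<open>I\<close>, while at (s, t) the entries of M are
    those of the identity; so det M is the polynomial sought.\<close>
  define M where "M = mat n n (\<lambda>(i, j). (if i = j then 1 else 0) - ([:[:- s, 1:]:] * a i j + [:[:- t:], 1:] * b i j))"
  have M: "M \<in> carrier_mat n n" by (simp add: M_def)
  define U where "U = u - Cst s"
  define V where "V = v - Cst t"
  have UV: "U \<in> R" "V \<in> R" unfolding U_def V_def using u v cR subring_setD(3)[OF Rs] by blast+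
  have e: "peval2 (M $$ (i, j)) u v = (if i = j then 1 else 0) - (U * peval2 (a i j) u v + V * peval2 (b i j) u v)"
    if "i < n" "j < n" for i j
    using that by (auto simp: M_def peval2_def U_def V_def fun_eq_iff left_diff_distrib)
  have "peval2 (det M) u v * m k \<in> I" if "k < n" for k
  proof (rule det_annihilates[OF comm_ring_hom_peval2 I evR M _ that])
    fix l assume l: "l < n"
    have "(\<Sum>j<n. peval2 (M $$ (l, j)) u v * m j)
        = (\<Sum>j<n. (if l = j then m j else 0) - (U * (peval2 (a l j) u v * m j) + V * (peval2 (b l j) u v * m j)))"
      by (intro sum.cong refl) (simp only: e[OF l] lessThan_iff, simp add: fun_eq_iff algebra_simps)
    also have "\<dots> = m l - (U * (\<Sum>j<n. peval2 (a l j) u v * m j) + V * (\<Sum>j<n. peval2 (b l j) u v * m j))"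
      using l by (simp add: sum_subtractf sum.distrib sum_distrib_left)
    also have "\<dots> = m l * (1 - A * U - B * V)
        + (U * (A * m l - (\<Sum>j<n. peval2 (a l j) u v * m j)) + V * (B * m l - (\<Sum>j<n. peval2 (b l j) u v * m j)))"
      by (simp only: algebra_simps mult_1)
    also have "1 - A * U - B * V = i"
      using iAB(1)[folded U_def V_def] by (simp add: fun_eq_iff diff_diff_eq diff_eq_eq add.assoc)
    also have "m l * i + (U * (A * m l - (\<Sum>j<n. peval2 (a l j) u v * m j)) + V * (B * m l - (\<Sum>j<n. peval2 (b l j) u v * m j))) \<in> I"
      using m l UV a[OF l] b[OF l] iAB(2) by (intro ideal_ofD(2,3)[OF I]) auto
    finally show "(\<Sum>j<n. peval2 (M $$ (l, j)) u v * m j) \<in> I" .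
  qed
  then have "peval2 (det M) u v \<in> I"
    by (intro annihilates_generators[OF Rs I subset_refl evR gen evR])
  moreover have "ev2 (det M) s t = 1"
  proof -
    interpret e: comm_ring_hom "\<lambda>\<Phi>. ev2 \<Phi> s t" by (rule comm_ring_hom_ev2)
    have "map_mat (\<lambda>\<Phi>. ev2 \<Phi> s t) M = 1\<^sub>m n"
      by (rule eq_matI) (auto simp: M_def)
    then show ?thesis using e.hom_det[of M] by simp
  qed
  ultimately show ?thesis by (metis zero_neq_one)
qed

section \<open>Finite generation along towers of integral elements\<close>

inductive_set mod_span :: "'a::comm_ring_1 set \<Rightarrow> 'a set \<Rightarrow> 'a set \<Rightarrow> 'a set" for A G I where
  ideal: "x \<in> I \<Longrightarrow> x \<in> mod_span A G I"
| gen: "a \<in> A \<Longrightarrow> g \<in> G \<Longrightarrow> a * g \<in> mod_span A G I"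
| add: "x \<in> mod_span A G I \<Longrightarrow> y \<in> mod_span A G I \<Longrightarrow> x + y \<in> mod_span A G I"

lemma mod_span_sum:
  assumes "ideal_of R I" "\<And>i. i \<in> B \<Longrightarrow> x i \<in> mod_span A G I"
  shows "sum x B \<in> mod_span A G I"
  using assms(2)
proof (induction B rule: infinite_finite_induct)
  case (insert b B)
  then show ?case by (simp add: mod_span.add)
qed (simp_all add: mod_span.ideal ideal_ofD(1)[OF assms(1)])

text \<open>The multipliers that preserve a submodule are closed under sums and products. Once they
  include the constants and the coordinates they are all of R, and a submodule containing 1 then
  contains R.\<close>

definition stabilizer :: "'a::comm_ring_1 set \<Rightarrow> 'a set \<Rightarrow> 'a set" where
  "stabilizer R M = {s \<in> R. \<forall>x\<in>M. s * x \<in> M}"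

text \<open>The powers t^i with i < k are adjoined to the generators. Multiplication by t shifts
  them, only the last one leaves the list, and the monic relation brings it back. The coefficients
  of the relation are asked to stabilize the old span instead of lying in \<open>A\<close>, so that
  t may be integral over elements adjoined earlier in a tower.\<close>

lemma mod_span_adjoin_integral:
  assumes Rs: "subring_set R" and I: "ideal_of R I" and AR: "A \<subseteq> R" and GR: "G \<subseteq> R"
    and t: "t \<in> R" and one: "1 \<in> mod_span A G I"
    and rel: "t ^ k - (\<Sum>i<k. c i * t ^ i) \<in> I" and c: "\<And>i. i < k \<Longrightarrow> c i \<in> stabilizer R (mod_span A G I)"
  defines "G' \<equiv> {g * t ^ i | g i. g \<in> G \<and> i < k}"
  shows "G' \<subseteq> R" "1 \<in> mod_span A G' I"
    "insert t (stabilizer R (mod_span A G I)) \<subseteq> stabilizer R (mod_span A G' I)"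
proof -
  define S where "S = stabilizer R (mod_span A G I)"
  have SR: "S \<subseteq> R" and stab: "\<And>s x. s \<in> S \<Longrightarrow> x \<in> mod_span A G I \<Longrightarrow> s * x \<in> mod_span A G I"
    and c: "\<And>i. i < k \<Longrightarrow> c i \<in> S"
    using c by (auto simp: S_def stabilizer_def)
  note closed = subring_setD[OF Rs] subring_set_power[OF Rs]
  show "G' \<subseteq> R" using GR t by (auto simp: G'_def intro!: closed(4,7))
  have lift: "x * t ^ i \<in> mod_span A G' I" if "x \<in> mod_span A G I" "i < k" for x i
    using that(1)
  proof (induction rule: mod_span.induct)
    case (ideal x)
    then show ?case using ideal_ofD(4)[OF I closed(7)[OF t]] by (intro mod_span.ideal)
  next
    case (gen a g)
    then have "a * (g * t ^ i) \<in> mod_span A G' I"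
      using that(2) by (intro mod_span.gen) (auto simp: G'_def)
    then show ?case by (simp add: mult.assoc)
  next
    case (add x y)
    then show ?case by (simp add: distrib_right mod_span.add)
  qed
  show "1 \<in> mod_span A G' I"
  \<comment> \<open>For k = 0 there are no new generators, but the relation itself then says that 1
    lies in \<open>I\<close>.\<close>
  proof (cases "k = 0")
    case True
    then show ?thesis using rel by (auto intro: mod_span.ideal)
  next
    case False
    then show ?thesis using lift[OF one, of 0] by simp
  qed
  have "s * x \<in> mod_span A G' I" if s: "s \<in> insert t S" and x: "x \<in> mod_span A G' I" for s x
    using x
  proof (induction rule: mod_span.induct)
    case (ideal x)
    then show ?case using s SR t ideal_ofD(3)[OF I] by (intro mod_span.ideal) auto
  next
    case (gen a g')
    then obtain g i where g: "g' = g * t ^ i" "g \<in> G" "i < k" unfolding G'_def by blast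
    have ag: "a * g \<in> mod_span A G I" using gen g by (intro mod_span.gen)
    show ?case
    proof (cases "s \<in> S")
      case True
      have "(s * (a * g)) * t ^ i \<in> mod_span A G' I" by (rule lift[OF stab[OF True ag] g(3)])
      then show ?thesis by (simp add: g mult.assoc)
    next
      case False
      then have st: "s = t" using s by auto
      show ?thesis
      proof (cases "Suc i < k")
        case True
        then show ?thesis using lift[OF ag True] by (simp add: st g algebra_simps)
      next
        case False
        then have k: "k = Suc i" using g by simp
        have "s * (a * g') = (a * g) * t ^ k" by (simp add: st g k algebra_simps)
        \<comment> \<open>The boundary case i = k - 1: the relation trades t^k for lower powers,
          whose coefficients act on the old span before \<open>lift\<close> is applied.\<close>
        also have "\<dots> = (a * g) * (t ^ k - (\<Sum>i<k. c i * t ^ i)) + (\<Sum>i<k. (c i * (a * g)) * t ^ i)"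
          by (simp add: algebra_simps sum_distrib_left)
        also have "\<dots> \<in> mod_span A G' I"
          using gen(1) g(2) AR GR
          by (intro mod_span.add mod_span_sum[OF I] lift stab c ag mod_span.ideal ideal_ofD(3)[OF I] rel closed(4))
             auto
        finally show ?thesis .
      qed
    qed
  next
    case (add x y)
    then show ?case by (simp add: distrib_left mod_span.add)
  qed
  then show "insert t (stabilizer R (mod_span A G I)) \<subseteq> stabilizer R (mod_span A G' I)"
    using t SR unfolding S_def[symmetric] by (auto simp: stabilizer_def[of R "mod_span A G' I"])
qed

lemma stabilizer_closed:
  assumes Rs: "subring_set R" and I: "ideal_of R I" and s: "s \<in> stabilizer R (mod_span A G I)"
    and t: "t \<in> stabilizer R (mod_span A G I)"
  shows "s + t \<in> stabilizer R (mod_span A G I)" "s * t \<in> stabilizer R (mod_span A G I)"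
  using s t subring_setD(4,6)[OF Rs]
  by (auto simp: stabilizer_def distrib_right mult.assoc intro!: mod_span.add)

lemma stabilizer_coeffs:
  assumes hom: "comm_ring_hom ev" and I: "ideal_of R I" and evR: "\<And>x. ev x \<in> R"
  shows "ev x \<in> stabilizer R (mod_span (range ev) G I)"
proof -
  interpret comm_ring_hom ev by (rule hom)
  have "ev x * y \<in> mod_span (range ev) G I" if "y \<in> mod_span (range ev) G I" for y
    using that
  proof (induction rule: mod_span.induct)
    case (ideal y)
    then show ?case by (intro mod_span.ideal ideal_ofD(3)[OF I] evR)
  next
    case (gen a g)
    then obtain q where "a = ev q" by blast
    then have "ev x * (a * g) = ev (x * q) * g" by (simp only: hom_mult mult.assoc)
    then show ?case using mod_span.gen[of "ev (x * q)" "range ev" g G I] gen(2) by (metis rangeI)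
  next
    case (add y z)
    then show ?case by (simp only: distrib_left mod_span.add)
  qed
  then show ?thesis using evR by (simp add: stabilizer_def)
qed

lemma stabilizer_peval:
  assumes R: "R = poly_ring C" and I: "ideal_of R I" and t: "t \<in> stabilizer R (mod_span A G I)"
    and const: "\<And>c. Cst c \<in> stabilizer R (mod_span A G I)"
  shows "peval q t \<in> stabilizer R (mod_span A G I)"
proof (induction q)
  case 0
  have "peval 0 t = Cst 0" by (simp add: peval_def fun_eq_iff)
  then show ?case using const[of 0] by (simp only:)
next
  case (pCons a q)
  have Rs: "subring_set R" unfolding R by (rule subring_poly_ring)
  have "peval (pCons a q) t = Cst a + t * peval q t" by (simp add: peval_def fun_eq_iff)
  then show ?case
    using stabilizer_closed(1)[OF Rs I const stabilizer_closed(2)[OF Rs I t pCons.IH]] by (simp only:)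
qed

lemma fin_gen_of_mod_span:
  assumes R: "R = poly_ring C" and I: "ideal_of R I" and G: "finite G" "G \<subseteq> R"
    and hom: "comm_ring_hom ev" and A: "A = range ev"
    and one: "1 \<in> mod_span A G I"
    and stab: "C \<subseteq> stabilizer R (mod_span A G I)"
    and cst: "\<And>c. Cst c \<in> stabilizer R (mod_span A G I)"
  shows "fin_gen R I ev"
proof -
  interpret comm_ring_hom ev by (rule hom)
  have Rs: "subring_set R" unfolding R by (rule subring_poly_ring)
  have "h \<in> stabilizer R (mod_span A G I)" if "h \<in> R" for h
    using that unfolding R
  proof (induction rule: poly_ring.induct)
    case (add g h)
    then show ?case using stabilizer_closed(1)[OF Rs I] R by (simp only:)
  next
    case (mult g h)
    then show ?case using stabilizer_closed(2)[OF Rs I] R by (simp only:)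
  next
    case (const c)
    show ?case by (rule cst[unfolded R])
  next
    case (coord t)
    then show ?case using stab unfolding R by blast
  qed
  then have stab': "h * x \<in> mod_span A G I" if "h \<in> R" "x \<in> mod_span A G I" for h x
    using that by (auto simp: stabilizer_def)
  have rep: "\<exists>c. x - (\<Sum>g\<in>G. ev (c g) * g) \<in> I" if "x \<in> mod_span A G I" for x
    using that
  proof (induction rule: mod_span.induct)
    case (ideal x)
    then show ?case by (intro exI[of _ "\<lambda>_. 0"]) simp
  next
    case (gen a g)
    obtain p where p: "a = ev p" using gen(1) unfolding A by blast
    have "(\<Sum>h\<in>G. ev (if h = g then p else 0) * h) = (\<Sum>h\<in>G. if h = g then a * g else 0)"
      by (intro sum.cong) (auto simp: p)
    also have "\<dots> = a * g" using gen(2) G(1) by simp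
    finally have "a * g - (\<Sum>h\<in>G. ev (if h = g then p else 0) * h) = 0" by (simp only: diff_self)
    then show ?case
      using ideal_ofD(1)[OF I] by (intro exI[of _ "\<lambda>h. if h = g then p else 0"]) (simp only:)
  next
    case (add x y)
    then obtain c d where "x - (\<Sum>g\<in>G. ev (c g) * g) \<in> I" "y - (\<Sum>g\<in>G. ev (d g) * g) \<in> I" by blast
    then have "(x - (\<Sum>g\<in>G. ev (c g) * g)) + (y - (\<Sum>g\<in>G. ev (d g) * g)) \<in> I"
      by (rule ideal_ofD(2)[OF I])
    also have "(x - (\<Sum>g\<in>G. ev (c g) * g)) + (y - (\<Sum>g\<in>G. ev (d g) * g))
        = x + y - (\<Sum>g\<in>G. ev (c g + d g) * g)"
      by (simp only: hom_add distrib_right sum.distrib) simp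
    finally show ?case by (rule exI[of _ "\<lambda>g. c g + d g"])
  qed
  obtain m where m: "bij_betw m {..<card G} G"
    using ex_bij_betw_nat_finite[OF G(1)] by (auto simp: lessThan_atLeast0)
  show ?thesis
    unfolding fin_gen_def
  proof (intro exI[of _ "card G"] exI[of _ m] conjI ballI allI impI)
    fix i assume "i < card G"
    then show "m i \<in> R" using m G(2) by (auto dest: bij_betwE)
  next
    fix h assume "h \<in> R"
    then have "h * 1 \<in> mod_span A G I" using one by (rule stab')
    then obtain c where c: "h - (\<Sum>g\<in>G. ev (c g) * g) \<in> I" using rep by (metis mult_1_right)
    have "(\<Sum>g\<in>G. ev (c g) * g) = (\<Sum>i<card G. ev (c (m i)) * m i)"
      using sum.reindex_bij_betw[OF m, of "\<lambda>g. ev (c g) * g"] by simp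
    then show "\<exists>c. h - (\<Sum>i<card G. ev (c i) * m i) \<in> I"
      using c by (intro exI[of _ "\<lambda>i. c (m i)"]) (simp only:)
  qed
qed

section \<open>Polynomials in two variables\<close>


lemma ev2_altdef: "ev2 \<Phi> s t = (\<Sum>j\<le>degree \<Phi>. poly (coeff \<Phi> j) s * t ^ j)"
  by (simp add: ev2_def poly_altdef[of \<Phi>] poly_sum poly_power)

lemma ev2_at: "ev2 \<Phi> s t = poly (map_poly (\<lambda>q. poly q s) \<Phi>) t"
  by (induction \<Phi>) (auto simp: map_poly_pCons)

lemma ev2_const_coeffs [simp]: "ev2 (map_poly (\<lambda>c. [:c:]) q) s t = poly q t"
  by (induction q) (auto simp: map_poly_pCons)

lemma ev2_monic:
  assumes "lead_coeff \<Phi> = 1"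
  shows "ev2 \<Phi> s t = t ^ degree \<Phi> - (\<Sum>j<degree \<Phi>. poly (- coeff \<Phi> j) s * t ^ j)"
  using assms by (simp add: ev2_altdef lessThan_Suc_atMost[symmetric] sum_negf)

text \<open>The leading coefficient 1 survives every specialization of the inner variable. This is
  what keeps fibres finite.\<close>

lemma map_poly_at_nonzero_if_monic: "lead_coeff \<Phi> = 1 \<Longrightarrow> map_poly (\<lambda>q. poly q (s::complex)) \<Phi> \<noteq> 0"
  by (metis coeff_0 coeff_map_poly poly_0 poly_1 zero_neq_one)

text \<open>Noether normalization in the plane. Let d be the total degree. After s is replaced by s
  + \<tau> t, the coefficient of t^d is the top homogeneous form at (\<tau>, 1); any \<tau> off the
  zeros of this form makes it a nonzero constant \<kappa>.\<close>

lemma shear_monic: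
  assumes "\<Phi> \<noteq> 0"
  shows "\<exists>\<tau> \<kappa> \<Psi>. \<kappa> \<noteq> 0 \<and> lead_coeff \<Psi> = 1 \<and> (\<forall>s t. ev2 \<Phi> (s + \<tau> * t) t = \<kappa> * ev2 \<Psi> s t)"
proof -
  define S where "S = {(i, j). coeff (coeff \<Phi> j) i \<noteq> 0}"
  have "S \<subseteq> (\<Union>j\<le>degree \<Phi>. {..degree (coeff \<Phi> j)} \<times> {j})"
    unfolding S_def by (auto intro!: le_degree)
  then have finS: "finite S" by (rule finite_subset) auto
  have "(degree (lead_coeff \<Phi>), degree \<Phi>) \<in> S" using assms by (simp add: S_def)
  then have neS: "S \<noteq> {}" by blast
  define d where "d = Max ((\<lambda>(i, j). i + j) ` S)"
  have dmax: "i + j \<le> d" if "(i, j) \<in> S" for i j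
    unfolding d_def using that finS by (auto intro!: Max_ge)
  have "d \<in> (\<lambda>(i, j). i + j) ` S"
    unfolding d_def using finS neS by (intro Max_in) auto
  then obtain i0 j0 where ij0: "(i0, j0) \<in> S" "i0 + j0 = d" by auto
  \<comment> \<open>The top homogeneous form, with the outer variable set to 1.\<close>
  define q where "q = (\<Sum>i\<le>d. monom (coeff (coeff \<Phi> (d - i)) i) i)"
  have "coeff q i0 = coeff (coeff \<Phi> j0) i0"
    unfolding q_def coeff_sum using ij0(2) by (subst sum.remove[of _ i0]) auto
  then have "q \<noteq> 0" using ij0(1) by (auto simp: S_def)
  \<comment> \<open>The extra factor x excludes \<tau> = 0. Then \<open>a\<close>, which is s +
    \<tau> t as a polynomial in t, has degree exactly 1, and its powers have the expected
    degrees.\<close>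
  then have "finite {x. poly (q * [:0, 1:]) x = 0}" by (intro poly_roots_finite) simp
  then obtain \<tau> where "poly (q * [:0, 1:]) \<tau> \<noteq> 0"
    using infinite_UNIV_char_0[where 'a = complex] by (metis (mono_tags) UNIV_eq_I mem_Collect_eq)
  then have \<tau>: "\<tau> \<noteq> 0" "poly q \<tau> \<noteq> 0" by auto
  define a :: "complex poly poly" where "a = [:[:0, 1:], [:\<tau>:]:]"
  have a: "degree a = 1" "lead_coeff a = [:\<tau>:]" using \<tau> by (auto simp: a_def)
  define T where "T = (\<lambda>(i, j). smult [:coeff (coeff \<Phi> j) i:] (a ^ i * monom 1 j))"
  have "a \<noteq> 0" using \<tau> by (auto simp: a_def)
  then have degai: "degree (a ^ i) = i" for i using a by (simp add: degree_power_eq)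
  have cT: "coeff (a ^ i * monom 1 j) d = (if i + j = d then [:\<tau> ^ i:] else 0)" if "i + j \<le> d" for i j
  proof -
    have "coeff (a ^ i * monom 1 j) d = coeff (a ^ i) (d - j)"
      using that by (simp add: mult.commute[of "a ^ i"] coeff_monom_mult)
    moreover have "coeff (a ^ i) i = [:\<tau>:] ^ i" using lead_coeff_power[of a i] a degai[of i] by simp
    moreover have "[:\<tau>:] ^ i = [:\<tau> ^ i:]" by (induction i) auto
    ultimately show ?thesis
      using that degai[of i] by (auto simp: coeff_eq_0)
  qed
  define \<Psi> where "\<Psi> = sum T S"
  have degT: "degree (T (i, j)) \<le> i + j" for i j
    unfolding T_def using degree_mult_le[of "a ^ i" "monom 1 j"] degai[of i]
    by (auto simp: degree_monom_eq intro: order.trans[OF degree_smult_le])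
  have "degree \<Psi> \<le> d"
    unfolding \<Psi>_def using dmax by (intro degree_sum_le finS) (auto intro: order.trans[OF degT])
  have "coeff \<Psi> d = (\<Sum>(i, j)\<in>S. if i + j = d then [:coeff (coeff \<Phi> j) i * \<tau> ^ i:] else 0)"
    unfolding \<Psi>_def coeff_sum using dmax by (intro sum.cong) (auto simp: T_def cT split: if_splits)
  also have "\<dots> = (\<Sum>(i, j)\<in>{(i, j). (i, j) \<in> S \<and> i + j = d}. [:coeff (coeff \<Phi> j) i * \<tau> ^ i:])"
    by (rule sum.mono_neutral_cong_right) (use finS in auto)
  also have "\<dots> = (\<Sum>i\<le>d. [:coeff (coeff \<Phi> (d - i)) i * \<tau> ^ i:])"
    by (rule sum.reindex_bij_witness_not_neutral[where S' = "{}"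
          and T' = "{i. i \<le> d \<and> coeff (coeff \<Phi> (d - i)) i = 0}" and i = "\<lambda>i. (i, d - i)" and j = fst])
       (use finS in \<open>auto simp: S_def intro: finite_subset[of _ S]\<close>)
  also have "\<dots> = [:poly q \<tau>:]"
  proof -
    have "(\<Sum>i\<in>A. [:x i:]) = [:sum x A:]" for x :: "nat \<Rightarrow> complex" and A
      by (induction A rule: infinite_finite_induct) auto
    then show ?thesis by (simp add: q_def poly_sum poly_monom)
  qed
  finally have c: "coeff \<Psi> d = [:poly q \<tau>:]" .
  then have deg: "degree \<Psi> = d" using \<open>degree \<Psi> \<le> d\<close> \<tau>(2) by (intro antisym le_degree) auto
  have ev: "ev2 \<Psi> s t = ev2 \<Phi> (s + \<tau> * t) t" for s t
  proof -
    let ?B = "SIGMA j:{..degree \<Phi>}. {..degree (coeff \<Phi> j)}"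
    have "ev2 \<Phi> (s + \<tau> * t) t
        = (\<Sum>(j, i)\<in>?B. coeff (coeff \<Phi> j) i * (s + \<tau> * t) ^ i * t ^ j)"
      by (simp add: ev2_altdef poly_altdef sum_distrib_right sum.Sigma)
    also have "\<dots> = (\<Sum>(i, j)\<in>S. coeff (coeff \<Phi> j) i * (s + \<tau> * t) ^ i * t ^ j)"
      by (rule sum.reindex_bij_witness_not_neutral[where S' = "{(j, i) \<in> ?B. coeff (coeff \<Phi> j) i = 0}"
            and T' = "{}" and i = prod.swap and j = prod.swap])
         (use finS in \<open>auto simp: S_def intro!: le_degree intro: finite_subset[of _ ?B]\<close>)
    also have "\<dots> = ev2 \<Psi> s t"
      unfolding \<Psi>_def ev2_sum
      by (intro sum.cong) (auto simp: T_def a_def monom_altdef algebra_simps)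
    finally show ?thesis by simp
  qed
  show ?thesis
  proof (intro exI conjI allI)
    show "poly q \<tau> \<noteq> 0" by fact
    show "lead_coeff (smult [:inverse (poly q \<tau>):] \<Psi>) = 1" using c deg \<tau>(2) by (simp add: one_pCons)
    show "ev2 \<Phi> (s + \<tau> * t) t = poly q \<tau> * ev2 (smult [:inverse (poly q \<tau>):] \<Psi>) s t" for s t
      using \<tau>(2) by (simp add: ev)
  qed
qed

section \<open>Roots of polynomials depending on a parameter\<close>

lemma monic_roots_bounded:
  assumes "lead_coeff \<Phi> = 1"
  shows "\<exists>B. \<forall>s t. cmod (s - c) \<le> 1 \<longrightarrow> ev2 \<Phi> s t = 0 \<longrightarrow> cmod t \<le> B"
proof -
  have "\<exists>M. \<forall>s\<in>cball c 1. cmod (poly (coeff \<Phi> j) s) \<le> M" for j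
  proof -
    have "compact ((\<lambda>s. poly (coeff \<Phi> j) s) ` cball c 1)"
      by (intro compact_continuous_image continuous_intros compact_cball)
    then show ?thesis by (auto dest!: compact_imp_bounded simp: bounded_iff)
  qed
  then obtain M where M: "\<And>j s. s \<in> cball c 1 \<Longrightarrow> cmod (poly (coeff \<Phi> j) s) \<le> M j" by metis
  \<comment> \<open>Cauchy's bound for the roots of a monic polynomial, with the coefficients
    replaced by bounds valid on the unit disc about c. The 1 in the maximum makes a larger root
    exceed 1 in modulus, so that lower powers of t are dominated by the power
    \<open>degree \<Phi> - 1\<close>.\<close>
  define B where "B = max 1 (\<Sum>j<degree \<Phi>. \<bar>M j\<bar>)"
  have "cmod t \<le> B" if s: "cmod (s - c) \<le> 1" and z: "ev2 \<Phi> s t = 0" for s t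
  proof (rule ccontr)
    assume nB: "\<not> cmod t \<le> B"
    then have t1: "cmod t > 1" by (auto simp: B_def)
    have sc: "s \<in> cball c 1" using s by (simp add: dist_norm norm_minus_commute)
    have k: "degree \<Phi> > 0"
    proof (rule ccontr)
      assume "\<not> degree \<Phi> > 0"
      then show False using z ev2_monic[OF assms, of s t] by simp
    qed
    have "t ^ degree \<Phi> = (\<Sum>j<degree \<Phi>. poly (- coeff \<Phi> j) s * t ^ j)"
      using z ev2_monic[OF assms, of s t] by simp
    then have "cmod t ^ degree \<Phi> \<le> (\<Sum>j<degree \<Phi>. cmod (poly (- coeff \<Phi> j) s * t ^ j))"
      by (metis norm_power norm_sum)
    also have "\<dots> \<le> (\<Sum>j<degree \<Phi>. \<bar>M j\<bar> * cmod t ^ (degree \<Phi> - 1))"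
    proof (rule sum_mono)
      fix j assume "j \<in> {..<degree \<Phi>}"
      then have "cmod t ^ j \<le> cmod t ^ (degree \<Phi> - 1)"
        using t1 by (intro power_increasing) auto
      moreover have "cmod (poly (- coeff \<Phi> j) s) \<le> \<bar>M j\<bar>" using M[OF sc, of j] by simp
      ultimately show "cmod (poly (- coeff \<Phi> j) s * t ^ j) \<le> \<bar>M j\<bar> * cmod t ^ (degree \<Phi> - 1)"
        by (simp only: norm_mult norm_power) (intro mult_mono, auto)
    qed
    also have "\<dots> \<le> B * cmod t ^ (degree \<Phi> - 1)"
      by (simp add: sum_distrib_right[symmetric] B_def mult_right_mono)
    also have "\<dots> < cmod t * cmod t ^ (degree \<Phi> - 1)"
      using nB t1 by (intro mult_strict_right_mono zero_less_power) auto
    also have "\<dots> = cmod t ^ degree \<Phi>" using k by (simp add: power_eq_if)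
    finally show False by simp
  qed
  then show ?thesis by blast
qed

text \<open>As long as all coefficients vanish at c, the factor s - c divides each of them; every
  division lowers the degree of the leading coefficient, so the process ends.\<close>

lemma factor_out_root_power:
  fixes D :: "complex poly poly"
  assumes "D \<noteq> 0"
  shows "\<exists>N D'. D = smult ([:- c, 1:] ^ N) D' \<and> map_poly (\<lambda>q. poly q c) D' \<noteq> 0"
  using assms
proof (induction "degree (lead_coeff D)" arbitrary: D rule: less_induct)
  case less
  show ?case
  proof (cases "map_poly (\<lambda>q. poly q c) D = 0")
    case False
    then show ?thesis by (intro exI[of _ 0] exI[of _ D]) simp
  next
    case True
    then have "poly (coeff D j) c = 0" for j by (metis coeff_0 coeff_map_poly poly_0)
    then have "[:- c, 1:] dvd coeff D j" for j by (simp add: poly_eq_0_iff_dvd)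
    then have "[:[:- c, 1:]:] dvd D" by (simp add: const_poly_dvd_iff)
    then obtain D1 where D1: "D = smult [:- c, 1:] D1" by (auto elim!: dvdE)
    have "D1 \<noteq> 0" using D1 less.prems by auto
    then have ld: "lead_coeff D = [:- c, 1:] * lead_coeff D1" and "lead_coeff D1 \<noteq> 0" using D1 by auto
    then have "degree (lead_coeff D1) < degree (lead_coeff D)"
      by (simp only: ld) (subst degree_mult_eq, auto)
    then obtain N D' where "D1 = smult ([:- c, 1:] ^ N) D'" "map_poly (\<lambda>q. poly q c) D' \<noteq> 0"
      using less.hyps[OF _ \<open>D1 \<noteq> 0\<close>] by blast
    then show ?thesis using D1 by (intro exI[of _ "Suc N"] exI[of _ D']) simp
  qed
qed

lemma continuous_on_ev2:
  assumes "continuous_on S f" "continuous_on S g"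
  shows "continuous_on S (\<lambda>w. ev2 \<Phi> (f w) (g w))"
  unfolding ev2_altdef by (intro continuous_intros assms)

text \<open>Continuity of roots through the maximum modulus principle: if \<open>ev2 D s\<close> had
  no zero in the disc of radius \<rho>, its reciprocal would be at most 3/(2 \<mu>) on the circle
  but more than 3/\<mu> at the centre.\<close>

lemma root_near:
  assumes nz: "map_poly (\<lambda>q. poly q c) D \<noteq> 0" and z: "ev2 D c 0 = 0" and "\<epsilon> > 0"
  shows "\<exists>\<delta>>0. \<forall>s. cmod (s - c) < \<delta> \<longrightarrow> (\<exists>t. cmod t < \<epsilon> \<and> ev2 D s t = 0)"
proof -
  define p where "p = map_poly (\<lambda>q. poly q c) D"
  have ev: "ev2 D c t = poly p t" for t by (simp add: ev2_at p_def)
  have "finite {t. poly p t = 0}" using nz by (intro poly_roots_finite) (simp add: p_def)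
  then have "finite (cmod ` {t. poly p t = 0})" by simp
  moreover have "infinite {0<..<\<epsilon>}" using \<open>\<epsilon> > 0\<close> by simp
  \<comment> \<open>Only finitely many radii carry a root of p, so some circle inside the disc of
    radius \<epsilon> avoids them all, and the modulus of p has a positive minimum \<mu> on
    it.\<close>
  ultimately obtain \<rho> where \<rho>: "0 < \<rho>" "\<rho> < \<epsilon>" "\<rho> \<notin> cmod ` {t. poly p t = 0}"
    by (metis (no_types, lifting) finite_subset greaterThanLessThan_iff subsetI)
  have cont: "continuous_on (sphere 0 \<rho>) (\<lambda>t. cmod (poly p t))" by (intro continuous_intros)
  have "sphere (0::complex) \<rho> \<noteq> {}" using \<rho> by (simp add: sphere_eq_empty)
  then obtain t0 where t0: "t0 \<in> sphere 0 \<rho>" "\<And>t. t \<in> sphere 0 \<rho> \<Longrightarrow> cmod (poly p t0) \<le> cmod (poly p t)"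
    using continuous_attains_inf[OF compact_sphere _ cont] by blast
  define \<mu> where "\<mu> = cmod (poly p t0)"
  have \<mu>: "\<mu> > 0" using t0(1) \<rho>(3) by (auto simp: \<mu>_def)
  have "compact (cball c 1 \<times> cball (0::complex) \<rho>)" by (intro compact_Times compact_cball)
  then have uc: "uniformly_continuous_on (cball c 1 \<times> cball 0 \<rho>) (\<lambda>w. ev2 D (fst w) (snd w))"
    by (intro compact_uniformly_continuous continuous_on_ev2 continuous_intros)
  have "\<mu> / 3 > 0" using \<mu> by simp
  from uc[unfolded uniformly_continuous_on_def, rule_format, OF this] obtain d where d: "d > 0"
    "\<And>w w'. w \<in> cball c 1 \<times> cball 0 \<rho> \<Longrightarrow> w' \<in> cball c 1 \<times> cball 0 \<rho> \<Longrightarrow> dist w' w < d \<Longrightarrow>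
      dist (ev2 D (fst w') (snd w')) (ev2 D (fst w) (snd w)) < \<mu> / 3"
    by blast
  show ?thesis
  proof (intro exI[of _ "min d 1"] conjI allI impI)
    show "min d 1 > 0" using d(1) by simp
    fix s assume s: "cmod (s - c) < min d 1"
    have close: "cmod (ev2 D s t - poly p t) < \<mu> / 3" if "cmod t \<le> \<rho>" for t
      using d(2)[of "(c, t)" "(s, t)"] s that
      by (simp add: dist_norm norm_minus_commute ev dist_Pair_Pair)
    show "\<exists>t. cmod t < \<epsilon> \<and> ev2 D s t = 0"
    proof (rule ccontr)
      assume no: "\<not> ?thesis"
      define h where "h = (\<lambda>t. inverse (ev2 D s t))"
      have nzD: "ev2 D s t \<noteq> 0" if "t \<in> cball 0 \<rho>" for t using no that \<rho>(2) by auto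
      have hol: "h holomorphic_on cball 0 \<rho>"
        unfolding h_def ev2_at by (intro holomorphic_intros) (use nzD in \<open>auto simp: ev2_at\<close>)
      have "cmod (h 0) \<le> 3 / (2 * \<mu>)"
      proof (rule maximum_modulus_frontier[of h "cball 0 \<rho>"])
        show "h holomorphic_on interior (cball 0 \<rho>)" using hol by (rule holomorphic_on_subset) auto
        show "continuous_on (closure (cball 0 \<rho>)) h"
          using hol by (simp add: holomorphic_on_imp_continuous_on)
        show "bounded (cball (0::complex) \<rho>)" by simp
        show "0 \<in> cball (0::complex) \<rho>" using \<rho> by simp
        fix z :: complex assume "z \<in> frontier (cball 0 \<rho>)"
        then have z: "z \<in> sphere 0 \<rho>" using \<rho> by simp
        have "\<mu> \<le> cmod (poly p z)" using t0(2)[OF z] by (simp add: \<mu>_def)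
        then have "cmod (ev2 D s z) \<ge> 2 * \<mu> / 3"
          using close[of z] z norm_triangle_ineq2[of "poly p z" "poly p z - ev2 D s z"]
          by (simp add: norm_minus_commute)
        then have "inverse (cmod (ev2 D s z)) \<le> inverse (2 * \<mu> / 3)"
          using \<mu> by (intro le_imp_inverse_le) auto
        then show "cmod (h z) \<le> 3 / (2 * \<mu>)" by (simp add: h_def norm_inverse)
      qed
      moreover have "cmod (ev2 D s 0) < \<mu> / 3" using close[of 0] \<rho> z ev[of 0] by simp
      moreover have "ev2 D s 0 \<noteq> 0" using nzD[of 0] \<rho> by simp
      ultimately have "inverse (\<mu> / 3) < 3 / (2 * \<mu>)"
        using less_imp_inverse_less[of "cmod (ev2 D s 0)" "\<mu> / 3"] by (auto simp: h_def norm_inverse)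
      then show False using \<mu> by (simp add: field_simps)
    qed
  qed
qed

section \<open>Isolated zeros\<close>


definition coords4 :: "(c4 \<Rightarrow> complex) set" where
  "coords4 = {\<lambda>w. fst (fst w), \<lambda>w. snd (fst w), \<lambda>w. fst (snd w), \<lambda>w. snd (snd w)}"

lemma finite_coords4: "finite coords4"
  by (simp add: coords4_def)

lemma coords4_points: "\<exists>w. \<forall>t\<in>coords4. t w = r t"
  by (intro exI[of _ "((r (\<lambda>w. fst (fst w)), r (\<lambda>w. snd (fst w))), (r (\<lambda>w. fst (snd w)), r (\<lambda>w. snd (snd w))))"])
     (simp add: coords4_def)

lemma coords4_separate: "v \<noteq> w \<Longrightarrow> \<exists>t\<in>coords4. t v \<noteq> t w"
  by (auto simp: coords4_def prod_eq_iff)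

lemma continuous_on_poly_ring:
  assumes "h \<in> poly_ring C" "\<And>t. t \<in> C \<Longrightarrow> continuous_on S t"
  shows "continuous_on S h"
  using assms(1)
proof (induction rule: poly_ring.induct)
  case (const c)
  then show ?case by (simp add: Cst_def)
next
  case (coord t)
  then show ?case using assms(2) by simp
next
  case (add g h)
  then show ?case by (simp add: plus_fun_def continuous_on_add)
next
  case (mult g h)
  then show ?case by (simp add: times_fun_def continuous_on_mult)
qed

lemma norm_c4_le: "norm (w :: c4) \<le> cmod (fst (fst w)) + cmod (snd (fst w)) + cmod (fst (snd w)) + cmod (snd (snd w))"
proof -
  have "norm w \<le> norm (fst w) + norm (snd w)" by (metis norm_Pair_le prod.collapse)
  moreover have "norm (fst w) \<le> cmod (fst (fst w)) + cmod (snd (fst w))" by (metis norm_Pair_le prod.collapse)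
  moreover have "norm (snd w) \<le> cmod (fst (snd w)) + cmod (snd (snd w))" by (metis norm_Pair_le prod.collapse)
  ultimately show ?thesis by linarith
qed

lemma ideal_power_cong:
  assumes Rs: "subring_set R" and I: "ideal_of R I" and i: "i \<in> I" and x: "x \<in> R" and ix: "i + x \<in> R"
  shows "(i + x) ^ N - x ^ N \<in> I"
proof (induction N)
  case 0
  then show ?case using ideal_ofD(1)[OF I] by simp
next
  case (Suc N)
  have "(i + x) ^ Suc N - x ^ Suc N = (i + x) ^ N * i + x * ((i + x) ^ N - x ^ N)"
    by (simp add: algebra_simps)
  then show ?case
    using Suc i x ix subring_set_power[OF Rs] by (auto intro!: ideal_ofD(2,3)[OF I])
qed

text \<open>Some (u - u(p))^N H with H(p) nonzero lies in \<open>I\<close>, and this passes to each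
  coordinate because coordinates are integral over u. To find H, an element e isolates p in its
  fibre of u, and D is a relation between u and e of least degree in e. Let D' be what remains of D
  after all factors u - u(p) are removed. If D' vanished at (u(p), 0), its roots nearby would lift,
  by Nakayama's lemma, to zeros of \<open>I\<close> close to p with another value of u. So H = D'(u,
  e) serves.\<close>

lemma isolated_zero_nilpotent_coords:
  assumes R: "R = poly_ring coords4" and I: "ideal_of R I" and IR: "I \<subseteq> R" and u: "u \<in> R"
    and fg: "fin_gen R I (\<lambda>q. peval q u)"
    and p: "\<And>h. h \<in> I \<Longrightarrow> h p = 0" and \<epsilon>: "\<epsilon> > 0"
    and iso: "\<And>w. (\<And>h. h \<in> I \<Longrightarrow> h w = 0) \<Longrightarrow> dist w p < \<epsilon> \<Longrightarrow> w = p"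
    and tc: "t \<in> coords4"
  shows "\<exists>N H. H \<in> R \<and> H p \<noteq> 0 \<and> (t - Cst (t p)) ^ N * H \<in> I"
proof -
  have Rs: "subring_set R" unfolding R by (rule subring_poly_ring)
  note closed = subring_setD[OF Rs]
  have cR: "Cst c \<in> R" for c unfolding R by (rule poly_ring.const)
  have coR: "t \<in> R" if "t \<in> coords4" for t unfolding R by (rule poly_ring.coord[OF that])
  have contR: "continuous_on S h" if "h \<in> R" for h S
    using that unfolding R
    by (rule continuous_on_poly_ring) (auto simp: coords4_def intro!: continuous_intros)
  define \<upsilon> where "\<upsilon> = u p"
  define V where "V = {w. \<forall>h\<in>I. h w = 0}"
  have pV: "p \<in> V" using p by (simp add: V_def)
  have "V = (\<Inter>h\<in>I. {w. h w = 0})" by (auto simp: V_def)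
  moreover have "closed {w. h w = 0}" if "h \<in> I" for h
    using contR[of h UNIV] IR that by (intro closed_Collect_eq continuous_intros) auto
  ultimately have closedV: "closed V" by auto
  have int: "\<exists>\<Phi>. lead_coeff \<Phi> = 1 \<and> peval2 \<Phi> u t \<in> I" if "t \<in> R" for t
    using fin_gen_imp_integral[OF R I u that fg] .
  then obtain \<Gamma> where \<Gamma>: "\<And>t. t \<in> R \<Longrightarrow> lead_coeff (\<Gamma> t) = 1" "\<And>t. t \<in> R \<Longrightarrow> peval2 (\<Gamma> t) u t \<in> I"
    by metis
  have \<Gamma>V: "ev2 (\<Gamma> t) (u w) (t w) = 0" if "t \<in> R" "w \<in> V" for t w
    using \<Gamma>(2)[OF that(1)] that(2) by (auto simp: V_def peval2_def)
  define Z where "Z = {w \<in> V. u w = \<upsilon>}"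
  \<comment> \<open>Each coordinate is integral over u, so on the fibre of u it takes only values
    among the roots of one nonzero polynomial.\<close>
  have finZ: "finite Z"
  proof -
    define B where "B = (\<lambda>t. {x. poly (map_poly (\<lambda>q. poly q \<upsilon>) (\<Gamma> t)) x = 0})"
    have finB: "finite (B t)" if "t \<in> coords4" for t
      unfolding B_def by (intro poly_roots_finite map_poly_at_nonzero_if_monic \<Gamma> coR that)
    have inB: "t w \<in> B t" if "w \<in> Z" "t \<in> coords4" for t w
      using \<Gamma>V[of t w] coR[OF that(2)] that(1) by (auto simp: B_def Z_def ev2_at)
    have "Z \<subseteq> (B (\<lambda>w. fst (fst w)) \<times> B (\<lambda>w. snd (fst w))) \<times> (B (\<lambda>w. fst (snd w)) \<times> B (\<lambda>w. snd (snd w)))"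
    proof
      fix w assume "w \<in> Z"
      from inB[OF this] show "w \<in> (B (\<lambda>w. fst (fst w)) \<times> B (\<lambda>w. snd (fst w))) \<times> (B (\<lambda>w. fst (snd w)) \<times> B (\<lambda>w. snd (snd w)))"
        by (cases w) (force simp: coords4_def)
    qed
    moreover have "finite \<dots>" by (intro finite_cartesian_product finB) (auto simp: coords4_def)
    ultimately show ?thesis by (rule finite_subset)
  qed
  obtain e where e: "e \<in> R" "e p = 0" "\<And>w. w \<in> Z \<Longrightarrow> e w = 0 \<Longrightarrow> w = p"
  proof -
    have "\<exists>l. l \<in> R \<and> l p = 1 \<and> l q = 0" if qp: "q \<noteq> p" for q
    proof -
      obtain t where t: "t \<in> coords4" "t q \<noteq> t p" using coords4_separate[OF qp] by blast
      have "Cst (1 / (t p - t q)) * (t - Cst (t q)) \<in> R" by (intro closed(3,4) cR coR t(1))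
      then show ?thesis using t(2) by (intro exI[of _ "Cst (1 / (t p - t q)) * (t - Cst (t q))"]) auto
    qed
    then obtain l where l: "\<And>q. q \<noteq> p \<Longrightarrow> l q \<in> R \<and> l q p = 1 \<and> l q q = 0" by metis
    \<comment> \<open>Interpolation: the product of the \<open>l q\<close> is 1 at p and 0 at every
      other point of the fibre, so e is 0 at p and 1 elsewhere on it.\<close>
    define e where "e = 1 - (\<Prod>q\<in>Z - {p}. l q)"
    have "e \<in> R" unfolding e_def using l by (intro closed(1,3) subring_set_prod[OF Rs]) auto
    moreover have "e p = 0" unfolding e_def using l by (simp add: prod_fun_apply)
    moreover have "w = p" if "w \<in> Z" "e w = 0" for w
    proof (rule ccontr)
      assume "w \<noteq> p"
      then have "(\<Prod>q\<in>Z - {p}. l q w) = 0" using \<open>w \<noteq> p\<close> l[of w] that(1) finZ by (intro prod_zero bexI[of _ w]) auto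
      then show False using that(2) by (simp add: e_def prod_fun_apply)
    qed
    ultimately show ?thesis using that by blast
  qed
  define K where "K = {\<Phi>. peval2 \<Phi> u e \<in> I}"
  have Kdiff: "\<Phi> - \<Psi> \<in> K" if "\<Phi> \<in> K" "\<Psi> \<in> K" for \<Phi> \<Psi>
  proof -
    have "peval2 (\<Phi> - \<Psi>) u e = peval2 \<Phi> u e - peval2 \<Psi> u e" by (simp add: peval2_def fun_eq_iff)
    then show ?thesis using that ideal_of_minus(2)[OF Rs I] by (simp add: K_def)
  qed
  have Kmult: "\<Psi> * \<Phi> \<in> K" if "\<Phi> \<in> K" for \<Phi> \<Psi>
  proof -
    have "peval2 (\<Psi> * \<Phi>) u e = peval2 \<Psi> u e * peval2 \<Phi> u e" by (simp add: peval2_def fun_eq_iff)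
    moreover have "peval2 \<Psi> u e \<in> R" using u e(1) unfolding R by (rule peval2_in_poly_ring)
    ultimately show ?thesis using that ideal_ofD(3)[OF I] by (simp add: K_def)
  qed
  have "\<Gamma> e \<in> K" "\<Gamma> e \<noteq> 0" using \<Gamma>[OF e(1)] by (auto simp: K_def)
  \<comment> \<open>The ideal \<open>K\<close> of relations may fail to be principal, but a relation
    of least degree controls it wherever its leading coefficient is nonzero, that is, away from
    finitely many s.\<close>
  then obtain D where D: "D \<in> K" "D \<noteq> 0" "\<And>\<Phi>. \<Phi> \<in> K \<Longrightarrow> \<Phi> \<noteq> 0 \<Longrightarrow> degree D \<le> degree \<Phi>"
    using ex_has_least_nat[of "\<lambda>\<Phi>. \<Phi> \<in> K \<and> \<Phi> \<noteq> 0" "\<Gamma> e" degree] by blast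
  \<comment> \<open>Pseudo-division by D leaves a remainder that is in \<open>K\<close> and of
    smaller degree, hence 0. Where the leading coefficient does not vanish, a zero of D is therefore
    a zero of every relation.\<close>
  have Dzero: "ev2 \<Phi> s x = 0" if "\<Phi> \<in> K" "ev2 D s x = 0" "poly (lead_coeff D) s \<noteq> 0" for \<Phi> s x
  proof -
    obtain Q r where qr: "pseudo_divmod \<Phi> D = (Q, r)" by (cases "pseudo_divmod \<Phi> D")
    define k where "k = lead_coeff D ^ (Suc (degree \<Phi>) - degree D)"
    have eq: "smult k \<Phi> = D * Q + r" and rd: "r = 0 \<or> degree r < degree D"
      using pseudo_divmod[OF D(2) qr] by (auto simp: k_def)
    have "r = [:k:] * \<Phi> - Q * D" using eq by (simp add: algebra_simps)
    then have "r \<in> K" using Kdiff Kmult that(1) D(1) by metis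
    then have "r = 0" using rd D(3)[of r] by (metis leD)
    then have "poly k s * ev2 \<Phi> s x = 0" using arg_cong[OF eq, of "\<lambda>P. ev2 P s x"] that(2) by simp
    then show ?thesis using that(3) by (simp add: k_def)
  qed
  obtain N D' where D': "D = smult ([:- \<upsilon>, 1:] ^ N) D'" "map_poly (\<lambda>q. poly q \<upsilon>) D' \<noteq> 0"
    using factor_out_root_power[OF D(2)] by blast
  have D'0: "ev2 D' \<upsilon> 0 \<noteq> 0"
  proof
    assume z: "ev2 D' \<upsilon> 0 = 0"
    \<comment> \<open>The part of the zero set on which u is within 1 of u(p). It is compact, since
      its coordinates are roots of monic polynomials with bounded coefficients.\<close>
    define S where "S = {w \<in> V. cmod (u w - \<upsilon>) \<le> 1}"
    have "bounded S"
    proof -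
      obtain B where B: "\<And>t s x. t \<in> coords4 \<Longrightarrow> cmod (s - \<upsilon>) \<le> 1 \<Longrightarrow> ev2 (\<Gamma> t) s x = 0 \<Longrightarrow> cmod x \<le> B t"
        using monic_roots_bounded[OF \<Gamma>(1)[OF coR], of _ \<upsilon>] by metis
      have bd: "cmod (t w) \<le> B t" if "w \<in> S" "t \<in> coords4" for w t
        using B[of t "u w" "t w"] \<Gamma>V[of t w] that coR by (auto simp: S_def)
      have "norm w \<le> B (\<lambda>w. fst (fst w)) + B (\<lambda>w. snd (fst w)) + B (\<lambda>w. fst (snd w)) + B (\<lambda>w. snd (snd w))"
        if "w \<in> S" for w
        using norm_c4_le[of w] bd[OF that, of "\<lambda>w. fst (fst w)"] bd[OF that, of "\<lambda>w. snd (fst w)"]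
          bd[OF that, of "\<lambda>w. fst (snd w)"] bd[OF that, of "\<lambda>w. snd (snd w)"]
        by (simp add: coords4_def)
      then show ?thesis unfolding bounded_iff by blast
    qed
    moreover have "closed S"
    proof -
      have "closed {w. cmod (u w - \<upsilon>) \<le> 1}"
        by (intro closed_Collect_le continuous_intros contR u)
      then show ?thesis unfolding S_def using closedV by (simp add: Collect_conj_eq closed_Int)
    qed
    ultimately have "compact (S - ball p \<epsilon>)" by (intro compact_diff) (auto simp: compact_eq_bounded_closed)
    moreover have "continuous_on (S - ball p \<epsilon>) (\<lambda>w. cmod (u w - \<upsilon>) + cmod (e w))"
      by (intro continuous_intros contR u e(1))
    \<comment> \<open>Outside the ball, u - u(p) and e have no common zero on S, so compactness
      gives a lower bound \<delta>. A point of S at which both are smaller than \<delta>/2 must then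
      lie in the ball.\<close>
    moreover have "cmod (u w - \<upsilon>) + cmod (e w) > 0" if "w \<in> S - ball p \<epsilon>" for w
    proof (rule ccontr)
      assume "\<not> ?thesis"
      then have "u w = \<upsilon>" "e w = 0"
        by (smt (verit) norm_ge_zero norm_le_zero_iff right_minus_eq)+
      then have "w = p" using that e(3)[of w] by (auto simp: Z_def S_def)
      then show False using that \<epsilon> by simp
    qed
    ultimately have "\<exists>\<delta>>0. \<forall>w\<in>S - ball p \<epsilon>. \<delta> \<le> cmod (u w - \<upsilon>) + cmod (e w)"
    proof (cases "S - ball p \<epsilon> = {}")
      case False
      assume "compact (S - ball p \<epsilon>)" "continuous_on (S - ball p \<epsilon>) (\<lambda>w. cmod (u w - \<upsilon>) + cmod (e w))"
        and pos: "\<And>w. w \<in> S - ball p \<epsilon> \<Longrightarrow> cmod (u w - \<upsilon>) + cmod (e w) > 0"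
      from continuous_attains_inf[OF this(1) False this(2)] pos show ?thesis by blast
    qed (auto intro: exI[of _ 1])
    then obtain \<delta> where \<delta>: "\<delta> > 0" "\<And>w. w \<in> S - ball p \<epsilon> \<Longrightarrow> \<delta> \<le> cmod (u w - \<upsilon>) + cmod (e w)" by blast
    obtain \<eta> where \<eta>: "\<eta> > 0" "\<And>s. cmod (s - \<upsilon>) < \<eta> \<Longrightarrow> \<exists>x. cmod x < \<delta> / 2 \<and> ev2 D' s x = 0"
      using root_near[OF D'(2) z, of "\<delta> / 2"] \<delta>(1) by auto
    define \<theta> where "\<theta> = min (min \<eta> (\<delta> / 2)) 1"
    have \<theta>: "\<theta> > 0" using \<eta> \<delta> by (simp add: \<theta>_def)
    have "finite ({s. poly (lead_coeff D) s = 0} \<union> {\<upsilon>})" using D(2) by (auto intro: poly_roots_finite)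
    moreover have "infinite (ball \<upsilon> \<theta>)" using \<theta> by (simp add: uncountable_infinite uncountable_ball)
    ultimately have "infinite (ball \<upsilon> \<theta> - ({s. poly (lead_coeff D) s = 0} \<union> {\<upsilon>}))"
      by (intro Diff_infinite_finite)
    from infinite_imp_nonempty[OF this]
    obtain s where s: "s \<in> ball \<upsilon> \<theta>" "poly (lead_coeff D) s \<noteq> 0" "s \<noteq> \<upsilon>"
      by blast
    have s': "cmod (s - \<upsilon>) < \<eta>" "cmod (s - \<upsilon>) < \<delta> / 2" "cmod (s - \<upsilon>) \<le> 1"
      using s(1) by (auto simp: \<theta>_def dist_norm norm_minus_commute)
    obtain x where x: "cmod x < \<delta> / 2" "ev2 D' s x = 0" using \<eta>(2)[OF s'(1)] by blast
    have "ev2 D s x = 0" using x(2) by (simp add: D'(1))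
    then have "\<not> (\<exists>\<Phi>. ev2 \<Phi> s x \<noteq> 0 \<and> peval2 \<Phi> u e \<in> I)"
      using Dzero[of _ s x] s(2) by (auto simp: K_def)
    moreover have "fin_gen R I (\<lambda>\<Phi>. peval2 \<Phi> u e)"
    proof -
      obtain n m where m: "\<forall>i<n. m i \<in> R"
        and gen: "\<forall>h\<in>R. \<exists>c. h - (\<Sum>i<(n::nat). peval (c i) u * m i) \<in> I"
        using fg unfolding fin_gen_def by blast
      have "\<exists>c. h - (\<Sum>i<n. peval2 (c i) u e * m i) \<in> I" if h: "h \<in> R" for h
      proof -
        obtain c where c: "h - (\<Sum>i<n. peval (c i) u * m i) \<in> I" using gen h by blast
        have "peval2 [:q:] u e = peval q u" for q by (simp add: peval2_def peval_def fun_eq_iff)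
        then show ?thesis using c by (intro exI[of _ "\<lambda>i. [:c i:]"]) (simp only:)
      qed
      then show ?thesis unfolding fin_gen_def using m by blast
    qed
    ultimately obtain w where w: "\<And>h. h \<in> I \<Longrightarrow> h w = 0" "u w = s" "e w = x"
      using nakayama_empty_fibre[OF R finite_coords4 coords4_points I IR u e(1), of s x] by blast
    have "w \<in> S" using w s'(3) by (simp add: S_def V_def)
    moreover have "cmod (u w - \<upsilon>) + cmod (e w) < \<delta>" using w s'(2) x(1) by simp
    ultimately have "w \<in> ball p \<epsilon>" using \<delta>(2)[of w] by fastforce
    then have "w = p" using iso[OF w(1)] by (simp add: dist_commute)
    then show False using w(2) s(3) by (simp add: \<upsilon>_def)
  qed
  define H where "H = peval2 D' u e"
  have HR: "H \<in> R" unfolding H_def using u e(1) unfolding R by (rule peval2_in_poly_ring)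
  have Hp: "H p \<noteq> 0" using D'0 e(2) by (simp add: H_def peval2_def \<upsilon>_def)
  define U where "U = u - Cst \<upsilon>"
  have UR: "U \<in> R" unfolding U_def by (intro closed(3) u cR)
  have "peval2 D u e = U ^ N * H"
    by (simp add: D'(1) peval2_def H_def U_def fun_eq_iff power_fun_apply)
  then have UH: "U ^ N * H \<in> I" using D(1) by (simp add: K_def)
  define s where "s = t - Cst (t p)"
  have sR: "s \<in> R" unfolding s_def by (intro closed(3) coR tc cR)
  define L where "L = ideal_adjoin R I U"
  note L = ideal_adjoin[OF Rs I, of U, folded L_def]
  \<comment> \<open>Modulo u - u(p), the integral equation of s over u becomes a polynomial in s
    alone, called P below.\<close>
  have congL: "peval2 \<Phi> u s - peval (map_poly (\<lambda>q. poly q \<upsilon>) \<Phi>) s \<in> L" for \<Phi>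
  proof (induction \<Phi>)
    case 0
    have "peval2 0 u s - peval (map_poly (\<lambda>q. poly q \<upsilon>) 0) s = 0"
      by (simp add: peval2_def peval_def fun_eq_iff)
    then show ?case using ideal_ofD(1)[OF L(1)] by (simp only:)
  next
    case (pCons q \<Phi>)
    have "peval2 (pCons q \<Phi>) u s - peval (map_poly (\<lambda>q. poly q \<upsilon>) (pCons q \<Phi>)) s
        = (peval q u - Cst (poly q \<upsilon>)) + s * (peval2 \<Phi> u s - peval (map_poly (\<lambda>q. poly q \<upsilon>) \<Phi>) s)"
      by (simp add: peval2_def peval_def fun_eq_iff ev2_at[symmetric] algebra_simps)
    also have "\<dots> \<in> L"
      using peval_cong_ideal[of coords4 L u \<upsilon> q] L u unfolding R[symmetric] U_def
      by (intro ideal_ofD(2,3)[OF L(1)] sR pCons.IH)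
    finally show ?case .
  qed
  define P where "P = map_poly (\<lambda>q. poly q \<upsilon>) (\<Gamma> s)"
  have "P \<noteq> 0" unfolding P_def by (intro map_poly_at_nonzero_if_monic \<Gamma> sR)
  \<comment> \<open>P is a power of the indeterminate times a factor r with r(0) nonzero. As s
    vanishes at p, r(s) does not vanish there and can join the denominator H.\<close>
  then obtain r where r: "P = [:0, 1:] ^ order 0 P * r" "\<not> [:0, 1:] dvd r"
    using order_decomp[of P 0] by auto
  have "peval P s \<in> L"
  proof -
    have "peval2 (\<Gamma> s) u s - (peval2 (\<Gamma> s) u s - peval P s) \<in> L"
      using congL[of "\<Gamma> s", folded P_def] \<Gamma>(2)[OF sR] L(2) ideal_of_minus(2)[OF Rs L(1)] by blast
    then show ?thesis by simp
  qed
  then obtain i k where ik: "peval P s = i + k * U" "i \<in> I" "k \<in> R"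
    unfolding L_def ideal_adjoin_def by blast
  define x where "x = k * U"
  have xR: "x \<in> R" unfolding x_def by (intro closed(4) ik(3) UR)
  have PR: "peval P s \<in> R" using sR unfolding R by (rule peval_in_poly_ring)
  \<comment> \<open>P(s) is congruent to k U modulo \<open>I\<close>, so P(s)^N H is congruent to
    k^N U^N H, which lies in \<open>I\<close>.\<close>
  have "peval P s ^ N - x ^ N \<in> I"
    using ideal_power_cong[OF Rs I ik(2) xR, of N] PR ik(1) unfolding x_def by simp
  then have "(peval P s ^ N - x ^ N) * H + k ^ N * (U ^ N * H) \<in> I"
    by (rule ideal_ofD(2)[OF I ideal_ofD(4)[OF I HR] ideal_ofD(3)[OF I subring_set_power[OF Rs ik(3)] UH]])
  also have "(peval P s ^ N - x ^ N) * H + k ^ N * (U ^ N * H) = peval P s ^ N * H"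
    by (simp add: x_def power_mult_distrib algebra_simps)
  also have "\<dots> = s ^ (order 0 P * N) * (peval r s ^ N * H)"
    by (subst r(1)) (simp add: peval_def fun_eq_iff power_fun_apply power_mult_distrib power_mult)
  finally have "s ^ (order 0 P * N) * (peval r s ^ N * H) \<in> I" .
  moreover have "peval r s ^ N * H \<in> R"
    using peval_in_poly_ring[OF sR[unfolded R]] by (intro closed(4) subring_set_power[OF Rs] HR) (simp only: R)
  moreover have "(peval r s ^ N * H) p \<noteq> 0"
  proof -
    have "poly r 0 \<noteq> 0" using r(2) by (simp add: poly_eq_0_iff_dvd)
    then show ?thesis using Hp by (simp add: power_fun_apply peval_def s_def)
  qed
  ultimately show ?thesis unfolding s_def by blast
qed

section \<open>The ideal of pairs of critical points with equal image\<close>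


text \<open>Written through \<open>ev2\<close> so that the second coordinate is the outer variable,
  to which \<open>shear_monic\<close> applies, and so that partial derivatives act on
  coefficients.\<close>

definition polyfun2 :: "(c2 \<Rightarrow> complex) \<Rightarrow> bool" where
  "polyfun2 h \<longleftrightarrow> (\<exists>\<Phi>. \<forall>z. h z = ev2 \<Phi> (fst z) (snd z))"

lemma poly2_imp_polyfun2:
  assumes "poly2 d h"
  shows "polyfun2 h"
proof -
  obtain c where c: "\<And>x y. h (x, y) = (\<Sum>i\<le>d. \<Sum>j\<le>d - i. c i j * x ^ i * y ^ j)"
    using assms unfolding poly2_def by blast
  have "h z = ev2 (\<Sum>i\<le>d. \<Sum>j\<le>d - i. [:[:c i j:]:] * [:[:0, 1:]:] ^ i * [:0, 1:] ^ j) (fst z) (snd z)" for z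
    using c[of "fst z" "snd z"] by (simp add: ev2_sum mult.assoc)
  then show ?thesis unfolding polyfun2_def by blast
qed

lemma ev2_deriv_snd: "((\<lambda>t. ev2 \<Phi> s t) has_field_derivative ev2 (pderiv \<Phi>) s t) (at t)"
proof (induction \<Phi>)
  case (pCons a \<Phi>)
  show ?case by (auto intro!: derivative_eq_intros pCons.IH simp: pderiv_pCons)
qed simp

lemma ev2_deriv_fst: "((\<lambda>s. ev2 \<Phi> s t) has_field_derivative ev2 (map_poly pderiv \<Phi>) s t) (at s)"
proof (induction \<Phi>)
  case (pCons a \<Phi>)
  have "map_poly pderiv (pCons a \<Phi>) = pCons (pderiv a) (map_poly pderiv \<Phi>)"
    by (rule poly_eqI) (simp add: coeff_map_poly coeff_pCons split: nat.split)
  then show ?case by (auto intro!: derivative_eq_intros pCons.IH)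
qed simp

lemma polyfun2_closed:
  shows "polyfun2 (\<lambda>_. c)" "polyfun2 fst" "polyfun2 snd"
    "polyfun2 h \<Longrightarrow> polyfun2 k \<Longrightarrow> polyfun2 (\<lambda>z. h z + k z)"
    "polyfun2 h \<Longrightarrow> polyfun2 k \<Longrightarrow> polyfun2 (\<lambda>z. h z - k z)"
    "polyfun2 h \<Longrightarrow> polyfun2 k \<Longrightarrow> polyfun2 (\<lambda>z. h z * k z)"
    "polyfun2 h \<Longrightarrow> polyfun2 (pdx h)" "polyfun2 h \<Longrightarrow> polyfun2 (pdy h)"
proof -
  show "polyfun2 (\<lambda>_. c)" unfolding polyfun2_def by (intro exI[of _ "[:[:c:]:]"]) simp
  show "polyfun2 fst" unfolding polyfun2_def by (intro exI[of _ "[:[:0, 1:]:]"]) simp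
  show "polyfun2 snd" unfolding polyfun2_def by (intro exI[of _ "[:0, 1:]"]) simp
  show "polyfun2 h \<Longrightarrow> polyfun2 k \<Longrightarrow> polyfun2 (\<lambda>z. h z + k z)"
    unfolding polyfun2_def by (metis ev2_simps(3))
  show "polyfun2 h \<Longrightarrow> polyfun2 k \<Longrightarrow> polyfun2 (\<lambda>z. h z - k z)"
    unfolding polyfun2_def by (metis ev2_simps(4))
  show "polyfun2 h \<Longrightarrow> polyfun2 k \<Longrightarrow> polyfun2 (\<lambda>z. h z * k z)"
    unfolding polyfun2_def by (metis ev2_simps(6))
  show "polyfun2 (pdx h)" if h: "polyfun2 h"
  proof -
    obtain \<Phi> where "\<And>z. h z = ev2 \<Phi> (fst z) (snd z)" using h unfolding polyfun2_def by blast
    then have "pdx h z = ev2 (map_poly pderiv \<Phi>) (fst z) (snd z)" for z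
      unfolding pdx_def by (simp add: DERIV_imp_deriv[OF ev2_deriv_fst])
    then show ?thesis unfolding polyfun2_def by blast
  qed
  show "polyfun2 (pdy h)" if h: "polyfun2 h"
  proof -
    obtain \<Phi> where "\<And>z. h z = ev2 \<Phi> (fst z) (snd z)" using h unfolding polyfun2_def by blast
    then have "pdy h z = ev2 (pderiv \<Phi>) (fst z) (snd z)" for z
      unfolding pdy_def by (simp add: DERIV_imp_deriv[OF ev2_deriv_snd])
    then show ?thesis unfolding polyfun2_def by blast
  qed
qed

lemma polyfun2_jac: "polyfun2 f \<Longrightarrow> polyfun2 g \<Longrightarrow> polyfun2 (jac f g)"
  unfolding jac_def[abs_def] by (intro polyfun2_closed)

definition gen_ideal :: "'a::comm_ring_1 set \<Rightarrow> 'a list \<Rightarrow> 'a set" where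
  "gen_ideal R gs = {\<Sum>k<length gs. hs k * gs ! k | hs. \<forall>k. hs k \<in> R}"

lemma gen_ideal:
  assumes Rs: "subring_set R" and gs: "set gs \<subseteq> R"
  shows "ideal_of R (gen_ideal R gs)" "gen_ideal R gs \<subseteq> R" "set gs \<subseteq> gen_ideal R gs"
proof -
  note closed = subring_setD[OF Rs]
  show "ideal_of R (gen_ideal R gs)"
    unfolding ideal_of_def
  proof (intro conjI ballI)
    show "0 \<in> gen_ideal R gs"
      unfolding gen_ideal_def using closed(2) by (auto intro!: exI[of _ "\<lambda>_. 0"])
  next
    fix x y assume "x \<in> gen_ideal R gs" "y \<in> gen_ideal R gs"
    then obtain h k where "x = (\<Sum>i<length gs. h i * gs ! i)" "y = (\<Sum>i<length gs. k i * gs ! i)"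
      "\<forall>i. h i \<in> R" "\<forall>i. k i \<in> R" unfolding gen_ideal_def by auto
    then show "x + y \<in> gen_ideal R gs"
      unfolding gen_ideal_def using closed(6)
      by (auto intro!: exI[of _ "\<lambda>i. h i + k i"] simp: sum.distrib distrib_right)
  next
    fix r x assume r: "r \<in> R" and "x \<in> gen_ideal R gs"
    then obtain h where "x = (\<Sum>i<length gs. h i * gs ! i)" "\<forall>i. h i \<in> R"
      unfolding gen_ideal_def by auto
    then show "r * x \<in> gen_ideal R gs"
      unfolding gen_ideal_def using closed(4)[OF r]
      by (auto intro!: exI[of _ "\<lambda>i. r * h i"] simp: sum_distrib_left mult.assoc)
  qed
  show "gen_ideal R gs \<subseteq> R"
    using gs by (auto simp: gen_ideal_def intro!: subring_set_sum[OF Rs] closed(4))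
  show "set gs \<subseteq> gen_ideal R gs"
  proof
    fix x assume "x \<in> set gs"
    then obtain k where k: "k < length gs" "x = gs ! k" by (metis in_set_conv_nth)
    have "(\<Sum>i<length gs. (if i = k then 1 else 0) * gs ! i) = (\<Sum>i<length gs. if i = k then gs ! i else 0)"
      by (intro sum.cong) auto
    also have "\<dots> = x" using k by simp
    finally show "x \<in> gen_ideal R gs"
      unfolding gen_ideal_def using closed(1,2)
      by (intro CollectI exI[of _ "\<lambda>i. if i = k then 1 else 0"]) auto
  qed
qed

lemma gen_ideal_zero_iff:
  assumes "subring_set R" "set gs \<subseteq> R"
  shows "(\<forall>h\<in>gen_ideal R gs. h w = 0) \<longleftrightarrow> (\<forall>h\<in>set gs. h w = (0::complex))"
proof
  assume "\<forall>h\<in>gen_ideal R gs. h w = 0"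
  then show "\<forall>h\<in>set gs. h w = 0" using gen_ideal(3)[OF assms] by blast
next
  assume *: "\<forall>h\<in>set gs. h w = 0"
  show "\<forall>h\<in>gen_ideal R gs. h w = 0"
    using * by (auto simp: gen_ideal_def sum_fun_apply intro!: sum.neutral)
qed

lemma monic_relation:
  assumes "lead_coeff \<Psi> = 1" "peval2 \<Psi> u t \<in> I"
  shows "t ^ degree \<Psi> - (\<Sum>i<degree \<Psi>. peval (- coeff \<Psi> i) u * t ^ i) \<in> I"
proof -
  have "peval2 \<Psi> u t = t ^ degree \<Psi> - (\<Sum>i<degree \<Psi>. peval (- coeff \<Psi> i) u * t ^ i)"
    by (rule ext) (simp add: peval2_def ev2_monic[OF assms(1)] power_fun_apply sum_fun_apply peval_def)
  then show ?thesis using assms(2) by (simp only:)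
qed

lemma mod_span_one:
  assumes "comm_ring_hom ev" "ideal_of R I"
  shows "1 \<in> mod_span (range ev) {1} I"
proof -
  interpret comm_ring_hom ev by (rule assms(1))
  have "ev 1 * 1 \<in> mod_span (range ev) {1} I" by (rule mod_span.gen[OF rangeI singletonI])
  then show ?thesis by simp
qed

lemma finite_mult_powers: "finite G \<Longrightarrow> finite {g * t ^ i | g i. g \<in> G \<and> i < (k::nat)}"
  by (rule finite_subset[of _ "(\<lambda>(g, i). g * t ^ i) ` (G \<times> {..<k})"]) auto

text \<open>The list inside \<open>nu\<close>, with J as a parameter, so that finiteness can be
  shown for any nonzero polynomial J.\<close>

definition pair_gens :: "(c2 \<Rightarrow> complex) \<Rightarrow> (c2 \<Rightarrow> complex) \<Rightarrow> (c2 \<Rightarrow> complex) \<Rightarrow> (c4 \<Rightarrow> complex) list" where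
  "pair_gens J f g = [\<lambda>(x, y). J x, \<lambda>(x, y). J y, \<lambda>(x, y). f x - f y, \<lambda>(x, y). g x - g y]"

lemma pair_gens_in_poly_ring:
  assumes "polyfun2 J" "polyfun2 f" "polyfun2 g"
  shows "set (pair_gens J f g) \<subseteq> poly_ring coords4"
proof -
  have x: "(\<lambda>w. h (fst w)) \<in> poly_ring coords4" and y: "(\<lambda>w. h (snd w)) \<in> poly_ring coords4"
    if h: "polyfun2 h" for h
  proof -
    obtain \<Phi> where \<Phi>: "\<And>z. h z = ev2 \<Phi> (fst z) (snd z)" using h unfolding polyfun2_def by blast
    have "peval2 \<Phi> (\<lambda>w. fst (fst w)) (\<lambda>w. snd (fst w)) \<in> poly_ring coords4"
      "peval2 \<Phi> (\<lambda>w. fst (snd w)) (\<lambda>w. snd (snd w)) \<in> poly_ring coords4"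
      by (intro peval2_in_poly_ring poly_ring.coord; simp add: coords4_def)+
    then show "(\<lambda>w. h (fst w)) \<in> poly_ring coords4" "(\<lambda>w. h (snd w)) \<in> poly_ring coords4"
      by (simp_all add: peval2_def \<Phi>)
  qed
  have "(\<lambda>w. f (fst w)) - (\<lambda>w. f (snd w)) \<in> poly_ring coords4"
    "(\<lambda>w. g (fst w)) - (\<lambda>w. g (snd w)) \<in> poly_ring coords4"
    by (intro poly_ring_closed(3) x y assms)+
  then show ?thesis
    using x[OF assms(1)] y[OF assms(1)] by (simp add: pair_gens_def case_prod_unfold fun_diff_def)
qed

lemma pair_gens_zero_iff:
  "(\<forall>h\<in>set (pair_gens J f g). h w = 0) \<longleftrightarrow>
     J (fst w) = 0 \<and> J (snd w) = 0 \<and> f (fst w) = f (snd w) \<and> g (fst w) = g (snd w)"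
  by (auto simp: pair_gens_def case_prod_unfold)

text \<open>The preimage is compact and h is bounded on it, so a real number above the bound is
  omitted. The omitted value feeds \<open>nakayama_empty_fibre\<close>.\<close>

lemma proper_preimage_bounded:
  assumes "proper_map F" "finite S" "continuous_on UNIV (h :: c2 \<Rightarrow> complex)"
  shows "\<exists>\<beta>. \<forall>z. F z \<in> S \<longrightarrow> h z \<noteq> \<beta>"
proof -
  have "compact (F -` S)" using assms(1,2) finite_imp_compact unfolding proper_map_def by blast
  then have "compact (h ` (F -` S))"
    using assms(3) by (intro compact_continuous_image) (auto intro: continuous_on_subset)
  then have "bounded (h ` (F -` S))" by (rule compact_imp_bounded)
  then obtain B where B: "\<And>z. F z \<in> S \<Longrightarrow> cmod (h z) \<le> B"
    unfolding bounded_iff by blast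
  have "h z \<noteq> of_real (\<bar>B\<bar> + 1)" if "F z \<in> S" for z
  proof
    assume "h z = of_real (\<bar>B\<bar> + 1)"
    then have "cmod (h z) = \<bar>B\<bar> + 1" by (simp only: norm_of_real)
    then show False using B[OF that] by linarith
  qed
  then show ?thesis by blast
qed

text \<open>A shear makes J monic in the second coordinate over a linear form, called X in the first
  plane and Y in the second, so the quotient is finite over C[X, Y]. Properness supplies a point (0,
  \<beta>) that (X, Y) misses, hence a nonzero relation between X and Y; a second shear makes Y
  integral over u = X - \<sigma> Y.\<close>

lemma pair_ideal_fin_gen:
  assumes R: "R = poly_ring coords4"
    and J: "polyfun2 J" and f: "polyfun2 f" and g: "polyfun2 g" and J0: "\<exists>z. J z \<noteq> 0"
    and proper: "proper_map (pmap f g)"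
  shows "\<exists>u\<in>R. fin_gen R (gen_ideal R (pair_gens J f g)) (\<lambda>q. peval q u)"
proof -
  have Rs: "subring_set R" unfolding R by (rule subring_poly_ring)
  note closed = subring_setD[OF Rs]
  have gsR: "set (pair_gens J f g) \<subseteq> R" unfolding R by (rule pair_gens_in_poly_ring[OF J f g])
  define I where "I = gen_ideal R (pair_gens J f g)"
  note I = gen_ideal[OF Rs gsR, folded I_def]
  have V: "(\<forall>h\<in>I. h w = 0) \<longleftrightarrow>
     J (fst w) = 0 \<and> J (snd w) = 0 \<and> f (fst w) = f (snd w) \<and> g (fst w) = g (snd w)" for w
    unfolding I_def gen_ideal_zero_iff[OF Rs gsR] pair_gens_zero_iff ..
  have cR: "Cst c \<in> R" for c unfolding R by (rule poly_ring.const)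
  obtain \<Phi>J where \<Phi>J: "\<And>z. J z = ev2 \<Phi>J (fst z) (snd z)" using J unfolding polyfun2_def by blast
  have "\<Phi>J \<noteq> 0" using J0 \<Phi>J by auto
  then obtain \<tau> \<kappa> \<Psi> where sh: "\<kappa> \<noteq> 0" "lead_coeff \<Psi> = 1"
    "\<And>s t. ev2 \<Phi>J (s + \<tau> * t) t = \<kappa> * ev2 \<Psi> s t" using shear_monic[of \<Phi>J] by blast
  have JPsi: "J z = \<kappa> * ev2 \<Psi> (fst z - \<tau> * snd z) (snd z)" for z
    using sh(3)[of "fst z - \<tau> * snd z" "snd z"] \<Phi>J[of z] by simp
  define x1 :: "c4 \<Rightarrow> complex" where "x1 = (\<lambda>w. fst (fst w))"
  define x2 :: "c4 \<Rightarrow> complex" where "x2 = (\<lambda>w. snd (fst w))"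
  define y1 :: "c4 \<Rightarrow> complex" where "y1 = (\<lambda>w. fst (snd w))"
  define y2 :: "c4 \<Rightarrow> complex" where "y2 = (\<lambda>w. snd (snd w))"
  have coords: "coords4 = {x1, x2, y1, y2}" by (auto simp: coords4_def x1_def x2_def y1_def y2_def)
  have xyR: "x1 \<in> R" "x2 \<in> R" "y1 \<in> R" "y2 \<in> R"
    unfolding R coords by (auto intro: poly_ring.coord)
  define X where "X = x1 - Cst \<tau> * x2"
  define Y where "Y = y1 - Cst \<tau> * y2"
  have XYR: "X \<in> R" "Y \<in> R" unfolding X_def Y_def by (intro closed(3,4) xyR cR)+
  have relx: "peval2 \<Psi> X x2 \<in> I" and rely: "peval2 \<Psi> Y y2 \<in> I"
  proof -
    have "peval2 \<Psi> X x2 = Cst (1 / \<kappa>) * (\<lambda>(x, y). J x)"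
      using sh(1) by (simp add: fun_eq_iff peval2_def JPsi X_def x1_def x2_def)
    moreover have "peval2 \<Psi> Y y2 = Cst (1 / \<kappa>) * (\<lambda>(x, y). J y)"
      using sh(1) by (simp add: fun_eq_iff peval2_def JPsi Y_def y1_def y2_def)
    moreover have "(\<lambda>(x, y). J x) \<in> I" "(\<lambda>(x, y). J y) \<in> I"
      using I(3) by (auto simp: pair_gens_def)
    ultimately show "peval2 \<Psi> X x2 \<in> I" "peval2 \<Psi> Y y2 \<in> I"
      using ideal_ofD(3)[OF I(1) cR] by (simp_all only:)
  qed
  have "fin_gen R I (\<lambda>\<Phi>. peval2 \<Phi> X Y)"
  proof -
    define ev where "ev = (\<lambda>\<Phi>. peval2 \<Phi> X Y)"
    have hom: "comm_ring_hom ev" unfolding ev_def by (rule comm_ring_hom_peval2)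
    have evR: "ev \<Phi> \<in> R" for \<Phi> unfolding ev_def using XYR unfolding R by (intro peval2_in_poly_ring)
    have evX: "peval q X = ev [:q:]" and evY: "peval q Y = ev (map_poly (\<lambda>c. [:c:]) q)" and evC: "Cst c = ev [:[:c:]:]" for q c
      by (simp_all add: ev_def peval_def peval2_def fun_eq_iff)
    have evRs: "range ev \<subseteq> R" using evR by blast
    note one0 = mod_span_one[OF hom I(1)]
    note st0 = stabilizer_coeffs[OF hom I(1) evR]
    have st0X: "peval q X \<in> stabilizer R (mod_span (range ev) G I)"
      and st0Y: "peval q Y \<in> stabilizer R (mod_span (range ev) G I)" for q G
      unfolding evX evY by (rule st0)+
    have G0: "{1} \<subseteq> R" using closed(1) by simp
    \<comment> \<open>After both adjunctions the module generators over C[X, Y] are the products of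
      powers of x2 and y2 with exponents below the degree of \<Psi>.\<close>
    define G1 where "G1 = {g * x2 ^ i | g i. g \<in> {1} \<and> i < degree \<Psi>}"
    note s1 = mod_span_adjoin_integral[OF Rs I(1) evRs G0 xyR(2) one0 monic_relation[OF sh(2) relx] st0X,
        folded G1_def]
    define G2 where "G2 = {g * y2 ^ i | g i. g \<in> G1 \<and> i < degree \<Psi>}"
    note s2 = mod_span_adjoin_integral[OF Rs I(1) evRs s1(1) xyR(4) s1(2) monic_relation[OF sh(2) rely] st0Y,
        folded G2_def]
    have finG: "finite G2" unfolding G2_def G1_def by (intro finite_mult_powers) simp
    define M where "M = stabilizer R (mod_span (range ev) G2 I)"
    have evM: "ev \<Phi> \<in> M" for \<Phi> unfolding M_def by (rule st0)
    note Mcl = stabilizer_closed[OF Rs I(1), of _ "range ev" G2, folded M_def]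
    have x2M: "x2 \<in> M" and y2M: "y2 \<in> M"
      using s1(3) s2(3) unfolding M_def by auto
    have "X \<in> M" "Y \<in> M"
    proof -
      have "X = peval [:0, 1:] X" "Y = peval [:0, 1:] Y" by (simp_all add: peval_def fun_eq_iff)
      then show "X \<in> M" "Y \<in> M" using evM by (simp_all only: evX evY)
    qed
    have cM: "Cst c \<in> M" for c unfolding evC by (rule evM)
    have "x1 = X + Cst \<tau> * x2" "y1 = Y + Cst \<tau> * y2" by (simp_all add: X_def Y_def)
    then have "x1 \<in> M" "y1 \<in> M" using Mcl \<open>X \<in> M\<close> \<open>Y \<in> M\<close> cM x2M y2M by (simp_all only:)
    then have "coords4 \<subseteq> M" using x2M y2M by (simp add: coords)
    then show ?thesis
      using fin_gen_of_mod_span[OF R I(1) finG s2(1) hom refl s2(2)] cM unfolding M_def ev_def by blast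
  qed
  moreover obtain \<beta> where \<beta>: "\<And>w. (\<And>h. h \<in> I \<Longrightarrow> h w = 0) \<Longrightarrow> X w = 0 \<Longrightarrow> Y w \<noteq> \<beta>"
  proof -
    \<comment> \<open>When X = 0, the first point of the pair is one of finitely many zeros of J on
      a line. The second point has the same image under F, so by properness it stays in a compact
      set, where Y misses a value.\<close>
    define A where "A = {z. J z = 0 \<and> fst z - \<tau> * snd z = 0}"
    have "finite {t. poly (map_poly (\<lambda>q. poly q 0) \<Psi>) t = 0}"
      by (intro poly_roots_finite map_poly_at_nonzero_if_monic sh)
    then have "finite ((\<lambda>t. (\<tau> * t, t)) ` {t. poly (map_poly (\<lambda>q. poly q 0) \<Psi>) t = 0})" by simp
    moreover have "A \<subseteq> (\<lambda>t. (\<tau> * t, t)) ` {t. poly (map_poly (\<lambda>q. poly q 0) \<Psi>) t = 0}"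
      using sh(1) by (force simp: A_def JPsi ev2_at)
    ultimately have "finite A" by (rule finite_subset[rotated])
    then have finA: "finite (pmap f g ` A)" by simp
    have cont: "continuous_on UNIV (\<lambda>z::c2. fst z - \<tau> * snd z)" by (intro continuous_intros)
    from proper_preimage_bounded[OF proper finA cont]
    obtain \<beta> where \<beta>: "\<And>z. pmap f g z \<in> pmap f g ` A \<Longrightarrow> fst z - \<tau> * snd z \<noteq> \<beta>"
      by blast
    have "Y w \<noteq> \<beta>" if "\<And>h. h \<in> I \<Longrightarrow> h w = 0" "X w = 0" for w
    proof -
      have "fst w \<in> A" using V[of w] that by (auto simp: A_def X_def x1_def x2_def)
      moreover have "pmap f g (snd w) = pmap f g (fst w)" using V[of w] that(1) by (simp add: pmap_def)
      ultimately show ?thesis using \<beta>[of "snd w"] by (auto simp: Y_def y1_def y2_def)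
    qed
    then show ?thesis using that by blast
  qed
  ultimately obtain \<Phi> where \<Phi>: "ev2 \<Phi> 0 \<beta> \<noteq> 0" "peval2 \<Phi> X Y \<in> I"
    using nakayama_empty_fibre[OF R finite_coords4 coords4_points I(1,2) XYR, of 0 \<beta>] by blast
  then have "\<Phi> \<noteq> 0" by auto
  then obtain \<sigma> \<kappa>' \<Theta> where sh': "\<kappa>' \<noteq> 0" "lead_coeff \<Theta> = 1"
    "\<And>s t. ev2 \<Phi> (s + \<sigma> * t) t = \<kappa>' * ev2 \<Theta> s t" using shear_monic[of \<Phi>] by blast
  define u where "u = X - Cst \<sigma> * Y"
  have uR: "u \<in> R" unfolding u_def by (intro closed(3,4) XYR cR)
  have relY: "peval2 \<Theta> u Y \<in> I"
  proof -
    have "peval2 \<Theta> u Y w = (Cst (1 / \<kappa>') * peval2 \<Phi> X Y) w" for w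
      using sh'(3)[of "u w" "Y w"] sh'(1) by (simp add: peval2_def u_def)
    then have "peval2 \<Theta> u Y = Cst (1 / \<kappa>') * peval2 \<Phi> X Y" by blast
    then show ?thesis using ideal_ofD(3)[OF I(1) cR \<Phi>(2)] by (simp only:)
  qed
  have "fin_gen R I (\<lambda>q. peval q u)"
  proof -
    define ev where "ev = (\<lambda>q. peval q u)"
    have hom: "comm_ring_hom ev" unfolding ev_def by (rule comm_ring_hom_peval)
    have evR: "ev q \<in> R" for q unfolding ev_def using uR unfolding R by (intro peval_in_poly_ring)
    have evu: "peval q u = ev q" and evC: "Cst c = ev [:c:]" for q c
      by (simp_all add: ev_def peval_def fun_eq_iff)
    have evRs: "range ev \<subseteq> R" using evR by blast
    note one0 = mod_span_one[OF hom I(1)]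
    note st0 = stabilizer_coeffs[OF hom I(1) evR]
    have st0u: "peval q u \<in> stabilizer R (mod_span (range ev) G I)" for q G
      unfolding evu by (rule st0)
    have G0: "{1} \<subseteq> R" using closed(1) by simp
    have cst: "Cst c \<in> stabilizer R (mod_span (range ev) G I)" for c G unfolding evC by (rule st0)
    define G1 where "G1 = {g * Y ^ i | g i. g \<in> {1} \<and> i < degree \<Theta>}"
    note s1 = mod_span_adjoin_integral[OF Rs I(1) evRs G0 XYR(2) one0 monic_relation[OF sh'(2) relY] st0u,
        folded G1_def]
    have Y1: "Y \<in> stabilizer R (mod_span (range ev) G1 I)" using s1(3) by blast
    have u1: "u \<in> stabilizer R (mod_span (range ev) G1 I)"
      using st0[of "[:0, 1:]" G1] by (simp add: ev_def peval_def)
    have "X = u + Cst \<sigma> * Y" by (simp add: u_def)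
    then have X1: "X \<in> stabilizer R (mod_span (range ev) G1 I)"
      using stabilizer_closed[OF Rs I(1)] u1 Y1 cst by (simp only:)
    \<comment> \<open>The relation for x2 has its coefficients in C[X] rather than C[u]; they are
      admissible because X already stabilizes the span.\<close>
    define G2 where "G2 = {g * x2 ^ i | g i. g \<in> G1 \<and> i < degree \<Psi>}"
    note s2 = mod_span_adjoin_integral[OF Rs I(1) evRs s1(1) xyR(2) s1(2) monic_relation[OF sh(2) relx]
        stabilizer_peval[OF R I(1) X1 cst], folded G2_def]
    have Y2: "Y \<in> stabilizer R (mod_span (range ev) G2 I)" using s2(3) Y1 by blast
    define G3 where "G3 = {g * y2 ^ i | g i. g \<in> G2 \<and> i < degree \<Psi>}"
    note s3 = mod_span_adjoin_integral[OF Rs I(1) evRs s2(1) xyR(4) s2(2) monic_relation[OF sh(2) rely]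
        stabilizer_peval[OF R I(1) Y2 cst], folded G3_def]
    have finG: "finite G3" unfolding G3_def G2_def G1_def by (intro finite_mult_powers) simp
    define M where "M = stabilizer R (mod_span (range ev) G3 I)"
    note Mcl = stabilizer_closed[OF Rs I(1), of _ "range ev" G3, folded M_def]
    have M: "x2 \<in> M" "y2 \<in> M" "X \<in> M" "Y \<in> M" and cM: "Cst c \<in> M" for c
      using s2(3) s3(3) X1 Y2 cst unfolding M_def by auto
    have "x1 = X + Cst \<tau> * x2" "y1 = Y + Cst \<tau> * y2" by (simp_all add: X_def Y_def)
    then have "x1 \<in> M" "y1 \<in> M" using Mcl M cM by (simp_all only:)
    then have "coords4 \<subseteq> M" using M by (simp add: coords)
    then show ?thesis
      using fin_gen_of_mod_span[OF R I(1) finG s3(1) hom refl s3(2)] cM unfolding M_def ev_def by blast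
  qed
  then show ?thesis using uR unfolding I_def by blast
qed

section \<open>Holomorphic maps in several variables\<close>


text \<open>A complex scaling compatible with the real Euclidean structure. Real calculus then
  applies unchanged to \<open>c2\<close> and \<open>c4\<close>, and holomorphy is complex linearity
  of the real derivative.\<close>

class cspace = euclidean_space +
  fixes scaleC :: "complex \<Rightarrow> 'a \<Rightarrow> 'a" (infixr "*\<^sub>C" 75)
  assumes scaleC_add_right: "c *\<^sub>C (x + y) = c *\<^sub>C x + c *\<^sub>C y"
    and scaleC_add_left: "(c + d) *\<^sub>C x = c *\<^sub>C x + d *\<^sub>C x"
    and scaleC_scaleC: "c *\<^sub>C d *\<^sub>C x = (c * d) *\<^sub>C x"
    and scaleC_of_real: "complex_of_real r *\<^sub>C x = r *\<^sub>R x"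
    and norm_scaleC: "norm (c *\<^sub>C x) = cmod c * norm x"

instantiation complex :: cspace
begin
definition scaleC_complex :: "complex \<Rightarrow> complex \<Rightarrow> complex" where [simp]: "scaleC_complex c x = c * x"
instance by standard (auto simp: algebra_simps norm_mult scaleR_conv_of_real)
end

instantiation prod :: (cspace, cspace) cspace
begin
definition scaleC_prod :: "complex \<Rightarrow> 'a \<times> 'b \<Rightarrow> 'a \<times> 'b" where
  "scaleC_prod c x = (c *\<^sub>C fst x, c *\<^sub>C snd x)"
instance
proof
  fix c :: complex and x :: "'a \<times> 'b"
  show "norm (c *\<^sub>C x) = cmod c * norm x"
    by (simp add: scaleC_prod_def norm_prod_def norm_scaleC power_mult_distrib
        distrib_left[symmetric] real_sqrt_mult)
qed (auto simp: scaleC_prod_def scaleC_add_right scaleC_add_left scaleC_scaleC scaleC_of_real prod_eq_iff)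
end

lemma scaleC_Pair [simp]: "c *\<^sub>C (x, y) = (c *\<^sub>C x, c *\<^sub>C y)"
  by (simp add: scaleC_prod_def)

lemma fst_scaleC [simp]: "fst (c *\<^sub>C x) = c *\<^sub>C fst x" and snd_scaleC [simp]: "snd (c *\<^sub>C x) = c *\<^sub>C snd x"
  by (simp_all add: scaleC_prod_def)

lemma scaleC_0_left [simp]: "0 *\<^sub>C x = 0"
  using scaleC_of_real[of 0 x] by simp

lemma scaleC_scaleR: "c *\<^sub>C (r *\<^sub>R x) = r *\<^sub>R (c *\<^sub>C x)"
  by (simp add: scaleC_of_real[symmetric] scaleC_scaleC mult.commute)

lemma bounded_bilinear_scaleC: "bounded_bilinear (scaleC :: complex \<Rightarrow> 'a::cspace \<Rightarrow> 'a)"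
proof
  show "\<exists>K. \<forall>c (x::'a). norm (c *\<^sub>C x) \<le> norm c * norm x * K"
    by (intro exI[of _ 1]) (simp add: norm_scaleC)
qed (simp_all add: scaleC_add_left scaleC_add_right scaleC_scaleR scaleR_conv_of_real
      scaleC_scaleC[symmetric] scaleC_of_real)

lemmas continuous_on_scaleC [continuous_intros] = bounded_bilinear.continuous_on[OF bounded_bilinear_scaleC]
lemmas scaleC_diff_right = bounded_bilinear.diff_right[OF bounded_bilinear_scaleC]
lemmas scaleC_0_right [simp] = bounded_bilinear.zero_right[OF bounded_bilinear_scaleC]
lemmas has_derivative_scaleC = bounded_bilinear.FDERIV[OF bounded_bilinear_scaleC]

definition cdiff :: "('a::cspace \<Rightarrow> 'b::cspace) \<Rightarrow> 'a \<Rightarrow> bool" where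
  "cdiff f z \<longleftrightarrow> (\<exists>D. (f has_derivative D) (at z) \<and> (\<forall>c x. D (c *\<^sub>C x) = c *\<^sub>C D x))"

definition cder :: "('a::cspace \<Rightarrow> 'b::cspace) \<Rightarrow> 'a \<Rightarrow> 'a \<Rightarrow> 'b" where
  "cder f z = frechet_derivative f (at z)"

section \<open>Rules for complex derivatives\<close>

lemma cder_eq: "(f has_derivative D) (at z) \<Longrightarrow> cder f z = D"
  by (simp add: cder_def frechet_derivative_at[symmetric])

lemma cdiffD:
  assumes "cdiff f z"
  shows "(f has_derivative cder f z) (at z)" "cder f z (c *\<^sub>C x) = c *\<^sub>C cder f z x"
proof -
  obtain D where "(f has_derivative D) (at z)" "\<And>c x. D (c *\<^sub>C x) = c *\<^sub>C D x"
    using assms unfolding cdiff_def by blast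
  then show "(f has_derivative cder f z) (at z)" "cder f z (c *\<^sub>C x) = c *\<^sub>C cder f z x"
    by (simp_all add: cder_eq)
qed

lemma cdiffI: "(f has_derivative D) (at z) \<Longrightarrow> (\<And>c x. D (c *\<^sub>C x) = c *\<^sub>C D x) \<Longrightarrow> cdiff f z"
  unfolding cdiff_def by blast

lemma cdiff_linear: "cdiff f z \<Longrightarrow> linear (cder f z)"
  by (rule has_derivative_linear[OF cdiffD(1)])

lemma cdiff_continuous_on: "(\<And>z. z \<in> S \<Longrightarrow> cdiff f z) \<Longrightarrow> continuous_on S f"
  by (intro continuous_at_imp_continuous_on ballI has_derivative_continuous[OF cdiffD(1)])

lemma cdiff_const [simp]: "cdiff (\<lambda>_. c) z"
  by (rule cdiffI[OF has_derivative_const]) simp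

lemma cdiff_ident [simp]: "cdiff (\<lambda>x. x) z"
  by (rule cdiffI[OF has_derivative_ident]) simp

lemma cdiff_compose:
  assumes "cdiff g z" "cdiff f (g z)"
  shows "cdiff (\<lambda>x. f (g x)) z" "cder (\<lambda>x. f (g x)) z v = cder f (g z) (cder g z v)"
proof -
  have d: "((\<lambda>x. f (g x)) has_derivative (\<lambda>v. cder f (g z) (cder g z v))) (at z)"
    using has_derivative_compose[OF cdiffD(1)[OF assms(1)], of f] cdiffD(1)[OF assms(2)] by blast
  then show "cdiff (\<lambda>x. f (g x)) z" by (rule cdiffI) (simp add: cdiffD(2) assms)
  show "cder (\<lambda>x. f (g x)) z v = cder f (g z) (cder g z v)" using cder_eq[OF d] by simp
qed

lemma cdiff_add:
  assumes "cdiff f z" "cdiff g z"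
  shows "cdiff (\<lambda>x. f x + g x) z" "cder (\<lambda>x. f x + g x) z v = cder f z v + cder g z v"
proof -
  note d = has_derivative_add[OF cdiffD(1)[OF assms(1)] cdiffD(1)[OF assms(2)]]
  show "cdiff (\<lambda>x. f x + g x) z" by (rule cdiffI[OF d]) (simp add: cdiffD(2) assms scaleC_add_right)
  show "cder (\<lambda>x. f x + g x) z v = cder f z v + cder g z v" using cder_eq[OF d] by simp
qed

lemma cdiff_diff:
  assumes "cdiff f z" "cdiff g z"
  shows "cdiff (\<lambda>x. f x - g x) z" "cder (\<lambda>x. f x - g x) z v = cder f z v - cder g z v"
proof -
  note d = has_derivative_diff[OF cdiffD(1)[OF assms(1)] cdiffD(1)[OF assms(2)]]
  show "cdiff (\<lambda>x. f x - g x) z" by (rule cdiffI[OF d]) (simp add: cdiffD(2) assms scaleC_diff_right)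
  show "cder (\<lambda>x. f x - g x) z v = cder f z v - cder g z v" using cder_eq[OF d] by simp
qed

lemma cdiff_mult:
  fixes f g :: "'a::cspace \<Rightarrow> complex"
  assumes "cdiff f z" "cdiff g z"
  shows "cdiff (\<lambda>x. f x * g x) z" "cder (\<lambda>x. f x * g x) z v = f z * cder g z v + cder f z v * g z"
proof -
  note d = has_derivative_mult[OF cdiffD(1)[OF assms(1)] cdiffD(1)[OF assms(2)]]
  show "cdiff (\<lambda>x. f x * g x) z" by (rule cdiffI[OF d]) (simp add: cdiffD(2) assms algebra_simps)
  show "cder (\<lambda>x. f x * g x) z v = f z * cder g z v + cder f z v * g z" using cder_eq[OF d] by simp
qed

lemma cdiff_Pair:
  assumes "cdiff f z" "cdiff g z"
  shows "cdiff (\<lambda>x. (f x, g x)) z" "cder (\<lambda>x. (f x, g x)) z v = (cder f z v, cder g z v)"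
proof -
  note d = has_derivative_Pair[OF cdiffD(1)[OF assms(1)] cdiffD(1)[OF assms(2)]]
  show "cdiff (\<lambda>x. (f x, g x)) z" by (rule cdiffI[OF d]) (simp add: cdiffD(2) assms)
  show "cder (\<lambda>x. (f x, g x)) z v = (cder f z v, cder g z v)" using cder_eq[OF d] by simp
qed

lemma cdiff_fst:
  assumes "cdiff f z"
  shows "cdiff (\<lambda>x. fst (f x)) z" "cder (\<lambda>x. fst (f x)) z v = fst (cder f z v)"
proof -
  note d = has_derivative_fst[OF cdiffD(1)[OF assms]]
  show "cdiff (\<lambda>x. fst (f x)) z" by (rule cdiffI[OF d]) (simp add: cdiffD(2) assms)
  show "cder (\<lambda>x. fst (f x)) z v = fst (cder f z v)" using cder_eq[OF d] by simp
qed

lemma cdiff_snd: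
  assumes "cdiff f z"
  shows "cdiff (\<lambda>x. snd (f x)) z" "cder (\<lambda>x. snd (f x)) z v = snd (cder f z v)"
proof -
  note d = has_derivative_snd[OF cdiffD(1)[OF assms]]
  show "cdiff (\<lambda>x. snd (f x)) z" by (rule cdiffI[OF d]) (simp add: cdiffD(2) assms)
  show "cder (\<lambda>x. snd (f x)) z v = snd (cder f z v)" using cder_eq[OF d] by simp
qed

lemma cdiff_field_derivative:
  assumes "(f has_field_derivative D) (at (z::complex))"
  shows "cdiff f z" "cder f z v = D * v"
proof -
  have d: "(f has_derivative (\<lambda>v. D * v)) (at z)"
    using assms by (simp add: has_field_derivative_def)
  show "cdiff f z" by (rule cdiffI[OF d]) simp
  show "cder f z v = D * v" using cder_eq[OF d] by simp
qed

lemma cdiff_imp_field_derivative: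
  assumes "cdiff f (z::complex)"
  shows "(f has_field_derivative cder f z 1) (at z)"
proof -
  have "cder f z v = cder f z 1 * v" for v using cdiffD(2)[OF assms, of v 1] by (simp add: mult.commute)
  then have eq: "cder f z = (*) (cder f z 1)" by (rule ext)
  show ?thesis using cdiffD(1)[OF assms] unfolding has_field_derivative_def by (subst (asm) eq)
qed

lemma cdiff_transform:
  assumes "cdiff f z" "open S" "z \<in> S" "\<And>x. x \<in> S \<Longrightarrow> f x = g x"
  shows "cdiff g z" "cder g z = cder f z"
proof -
  have d: "(g has_derivative cder f z) (at z)"
    by (rule has_derivative_transform_within_open[OF cdiffD(1)[OF assms(1)] assms(2-4)])
  show "cdiff g z" by (rule cdiffI[OF d]) (simp add: cdiffD(2) assms)
  show "cder g z = cder f z" by (rule cder_eq[OF d])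
qed

lemma cdiff_inverse:
  fixes f :: "'a::cspace \<Rightarrow> complex"
  assumes "cdiff f z" "f z \<noteq> 0"
  shows "cdiff (\<lambda>x. inverse (f x)) z"
proof -
  have "cdiff inverse (f z)" by (rule cdiff_field_derivative(1)[OF DERIV_inverse[OF assms(2)]])
  then show ?thesis by (rule cdiff_compose(1)[OF assms(1)])
qed

lemma cdiff_divide:
  fixes f g :: "'a::cspace \<Rightarrow> complex"
  assumes "cdiff f z" "cdiff g z" "g z \<noteq> 0"
  shows "cdiff (\<lambda>x. f x / g x) z"
  using cdiff_mult(1)[OF assms(1) cdiff_inverse[OF assms(2,3)]] by (simp only: divide_inverse)

lemma cdiff_power:
  fixes f :: "'a::cspace \<Rightarrow> complex"
  assumes "cdiff f z"
  shows "cdiff (\<lambda>x. f x ^ n) z"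
proof (induction n)
  case (Suc n)
  show ?case using cdiff_mult(1)[OF assms Suc.IH] by (simp only: power_Suc)
qed simp

lemma cdiff_sum:
  fixes f :: "'i \<Rightarrow> 'a::cspace \<Rightarrow> complex"
  assumes "\<And>i. i \<in> A \<Longrightarrow> cdiff (f i) z"
  shows "cdiff (\<lambda>x. \<Sum>i\<in>A. f i x) z"
  using assms
proof (induction A rule: infinite_finite_induct)
  case (insert i A)
  show ?case using cdiff_add(1)[of "f i" z "\<lambda>x. \<Sum>i\<in>A. f i x"] insert by simp
qed simp_all

text \<open>Cauchy's formula for the derivative at 0 of the one-variable function t -> f(z + t v),
  on the circle of radius r parametrized by [0, 1]. A directional derivative becomes an integral of
  values of f, from which its continuity and holomorphy are read off.\<close>

lemma cder_Cauchy:
  fixes f :: "'a::cspace \<Rightarrow> complex"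
  assumes f: "\<And>t. cmod t \<le> r \<Longrightarrow> cdiff f (z + t *\<^sub>C v)" and r: "r > 0"
  shows "cder f z v = integral {0..1} (\<lambda>\<theta>. exp (- (2 * of_real pi * \<i> * of_real \<theta>)) / of_real r
           * f (z + (of_real r * exp (2 * of_real pi * \<i> * of_real \<theta>)) *\<^sub>C v))"
proof -
  define \<phi> where "\<phi> = (\<lambda>t. f (z + t *\<^sub>C v))"
  have line: "((\<lambda>t. z + t *\<^sub>C v) has_derivative (\<lambda>s. s *\<^sub>C v)) (at t)" for t
    by (auto intro!: derivative_eq_intros has_derivative_scaleC[OF has_derivative_ident has_derivative_const])
  have \<phi>': "(\<phi> has_field_derivative cder f (z + t *\<^sub>C v) v) (at t)" if "cmod t \<le> r" for t
  proof -
    have "(\<phi> has_derivative (\<lambda>s. cder f (z + t *\<^sub>C v) (s *\<^sub>C v))) (at t)"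
      unfolding \<phi>_def using has_derivative_compose[OF line cdiffD(1)[OF f[OF that]]] .
    moreover have "(\<lambda>s. cder f (z + t *\<^sub>C v) (s *\<^sub>C v)) = (*) (cder f (z + t *\<^sub>C v) v)"
      by (auto simp: cdiffD(2)[OF f[OF that]] mult.commute)
    ultimately show ?thesis by (simp add: has_field_derivative_def)
  qed
  have "\<phi> holomorphic_on cball 0 r"
    unfolding holomorphic_on_def
  proof
    fix t :: complex assume "t \<in> cball 0 r"
    then have "(\<phi> has_field_derivative cder f (z + t *\<^sub>C v) v) (at t)" by (intro \<phi>') simp
    then show "\<phi> field_differentiable (at t within cball 0 r)"
      unfolding field_differentiable_def by (blast intro: has_field_derivative_at_within)
  qed
  then have "contour_integral (circlepath 0 r) (\<lambda>u. \<phi> u / (u - 0)\<^sup>2) = (2 * pi * \<i>) * deriv \<phi> 0"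
    using r by (intro Cauchy_contour_integral_circlepath_2)
      (auto intro: holomorphic_on_imp_continuous_on holomorphic_on_subset)
  also have "deriv \<phi> 0 = cder f z v" using DERIV_imp_deriv[OF \<phi>'[of 0]] r by simp
  finally have "cder f z v = 1 / (2 * pi * \<i>) * contour_integral (circlepath 0 r) (\<lambda>u. \<phi> u / (u - 0)\<^sup>2)"
    by (simp add: field_simps)
  also have "\<dots> = integral {0..1} (\<lambda>\<theta>. 1 / (2 * pi * \<i>) *
      (\<phi> (circlepath 0 r \<theta>) / (circlepath 0 r \<theta> - 0)\<^sup>2 * vector_derivative (circlepath 0 r) (at \<theta>)))"
    unfolding contour_integral_integral by (rule integral_mult_right[symmetric])
  also have "\<dots> = integral {0..1} (\<lambda>\<theta>. exp (- (2 * of_real pi * \<i> * of_real \<theta>)) / of_real r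
           * f (z + (of_real r * exp (2 * of_real pi * \<i> * of_real \<theta>)) *\<^sub>C v))"
    using r unfolding vector_derivative_circlepath
    by (intro Henstock_Kurzweil_Integration.integral_cong)
       (simp add: circlepath \<phi>_def exp_minus field_simps power2_eq_square)
  finally show ?thesis .
qed

lemma scaleC_segment_in_ball:
  assumes "z \<in> ball p (e / 2)" "cmod t * norm v < e / 2"
  shows "z + t *\<^sub>C v \<in> ball p e"
proof -
  have "dist p (z + t *\<^sub>C v) \<le> dist p z + norm (t *\<^sub>C v)"
    by (metis add_diff_cancel_left' dist_norm dist_triangle norm_minus_commute)
  then show ?thesis using assms by (simp add: norm_scaleC)
qed

lemma continuous_on_cder:
  fixes f :: "'a::cspace \<Rightarrow> complex"
  assumes U: "open U" and f: "\<And>z. z \<in> U \<Longrightarrow> cdiff f z"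
  shows "continuous_on U (\<lambda>z. cder f z v)"
proof (rule continuous_at_imp_continuous_on, rule ballI)
  fix p assume "p \<in> U"
  then obtain e where e: "e > 0" "ball p e \<subseteq> U" using U open_contains_ball by blast
  \<comment> \<open>With this radius the disc of all z + t v stays in \<open>ball p e\<close> for
    every z in the half ball; the summand 1 takes care of v = 0.\<close>
  define r where "r = e / (2 * (norm v + 1))"
  have n: "norm v + 1 > 0" by (simp add: add_nonneg_pos)
  have r: "r > 0" using e n by (simp add: r_def)
  have rv: "r * norm v < e / 2" using e n by (simp add: r_def field_simps)
  have inU: "z + t *\<^sub>C v \<in> U" if "z \<in> ball p (e / 2)" "cmod t \<le> r" for z t
  proof -
    have "cmod t * norm v \<le> r * norm v" using that(2) by (intro mult_right_mono) auto
    then show ?thesis using scaleC_segment_in_ball[OF that(1), of t v] rv e(2) by auto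
  qed
  have eq: "cder f z v = integral (cbox 0 1) (\<lambda>\<theta>. exp (- (2 * of_real pi * \<i> * of_real \<theta>)) / of_real r
           * f (z + (of_real r * exp (2 * of_real pi * \<i> * of_real \<theta>)) *\<^sub>C v))"
    if "z \<in> ball p (e / 2)" for z
    unfolding cbox_interval using inU[OF that] r by (intro cder_Cauchy f) auto
  have "continuous_on (ball p (e / 2)) (\<lambda>z. integral (cbox 0 1) (\<lambda>\<theta>. exp (- (2 * of_real pi * \<i> * of_real \<theta>)) / of_real r
           * f (z + (of_real r * exp (2 * of_real pi * \<i> * of_real \<theta>)) *\<^sub>C v)))"
  proof (rule integral_continuous_on_param)
    have "continuous_on (ball p (e / 2) \<times> cbox 0 (1::real))
      (\<lambda>x. f (fst x + (of_real r * exp (2 * of_real pi * \<i> * of_real (snd x))) *\<^sub>C v))"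
      by (rule continuous_on_compose2[OF cdiff_continuous_on[of U f]])
         (use inU r in \<open>auto intro!: continuous_intros f simp: norm_mult\<close>)
    then show "continuous_on (ball p (e / 2) \<times> cbox 0 1) (\<lambda>(z, \<theta>). exp (- (2 * of_real pi * \<i> * of_real \<theta>)) / of_real r
           * f (z + (of_real r * exp (2 * of_real pi * \<i> * of_real \<theta>)) *\<^sub>C v))"
      unfolding case_prod_unfold using r by (intro continuous_intros) auto
  qed
  then have "continuous_on (ball p (e / 2)) (\<lambda>z. cder f z v)"
    by (rule continuous_on_eq) (simp add: eq)
  then show "isCont (\<lambda>z. cder f z v) p" using e(1) by (simp add: continuous_on_eq_continuous_at)
qed

text \<open>The derivative as a bounded operator, the form in which the Leibniz rule and the real
  inverse function theorem take it.\<close>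

definition cderL :: "('a::cspace \<Rightarrow> 'b::cspace) \<Rightarrow> 'a \<Rightarrow> 'a \<Rightarrow>\<^sub>L 'b" where
  "cderL f z = Blinfun (cder f z)"

lemma cderL_apply: "cdiff f z \<Longrightarrow> blinfun_apply (cderL f z) = cder f z"
  unfolding cderL_def by (intro bounded_linear_Blinfun_apply has_derivative_bounded_linear[OF cdiffD(1)])

lemma continuous_on_cderL:
  assumes "\<And>z. z \<in> U \<Longrightarrow> cdiff f z" "\<And>v. continuous_on U (\<lambda>z. cder f z v)"
  shows "continuous_on U (cderL f)"
proof (rule continuous_on_blinfun_componentwise)
  fix i :: 'a
  show "continuous_on U (\<lambda>z. blinfun_apply (cderL f z) i)"
    using assms(2)[of i] by (rule continuous_on_eq) (simp add: cderL_apply assms(1))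
qed

text \<open>Differentiation under the integral sign; the derivative inherits complex linearity from
  k and from each \<open>B \<theta>\<close>. The affine argument serves translations, as in Cauchy's
  formula, and contractions towards a point or a line, as in the mean value integrals.\<close>

lemma cdiff_integral_affine:
  fixes k :: "'a::cspace \<Rightarrow> complex" and B :: "real \<Rightarrow> 'a \<Rightarrow>\<^sub>L 'a"
  assumes U: "open U" and k: "\<And>z. z \<in> U \<Longrightarrow> cdiff k z"
    and W: "open W" "convex W" and inU: "\<And>z \<theta>. z \<in> W \<Longrightarrow> \<theta> \<in> {0..1} \<Longrightarrow> b \<theta> + B \<theta> z \<in> U"
    and b: "continuous_on {0..1} b" and B: "continuous_on {0..1} B"
    and BC: "\<And>\<theta> c x. B \<theta> (c *\<^sub>C x) = c *\<^sub>C B \<theta> x" and \<rho>: "continuous_on {0..1} \<rho>"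
    and p: "p \<in> W"
  shows "cdiff (\<lambda>z. integral {0..1} (\<lambda>\<theta>. \<rho> \<theta> * k (b \<theta> + B \<theta> z))) p"
proof -
  define fx where "fx = (\<lambda>z \<theta>. blinfun_mult_right (\<rho> \<theta>) o\<^sub>L cderL k (b \<theta> + B \<theta> z) o\<^sub>L B \<theta>)"
  have fx_apply: "blinfun_apply (fx z \<theta>) x = \<rho> \<theta> * cder k (b \<theta> + B \<theta> z) (B \<theta> x)"
    if "z \<in> W" "\<theta> \<in> {0..1}" for z \<theta> x
    using that by (simp add: fx_def cderL_apply k inU)
  have c2: "continuous_on (W \<times> {0..1}) (\<lambda>x. h (snd x))" if "continuous_on {0..1} h" for h :: "real \<Rightarrow> 'c::topological_space"
    using that by (rule continuous_on_compose2) (auto intro!: continuous_intros)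
  have cA: "continuous_on (W \<times> {0..1}) (\<lambda>x. b (snd x) + B (snd x) (fst x))"
    by (intro continuous_intros c2[OF b] c2[OF B])
  have cK: "continuous_on (W \<times> {0..1}) (\<lambda>x. cderL k (b (snd x) + B (snd x) (fst x)))"
    by (rule continuous_on_compose2[OF continuous_on_cderL[OF k continuous_on_cder[OF U k]] cA])
       (use inU in auto)
  have ck: "continuous_on (W \<times> {0..1}) (\<lambda>x. k (b (snd x) + B (snd x) (fst x)))"
    by (rule continuous_on_compose2[OF cdiff_continuous_on[OF k] cA]) (use inU in auto)
  have cfx: "continuous_on (W \<times> cbox 0 1) (\<lambda>(z, \<theta>). fx z \<theta>)"
    unfolding fx_def case_prod_unfold cbox_interval
    by (intro continuous_intros c2[OF B] cK bounded_linear.continuous_on[OF bounded_linear_blinfun_mult_right c2[OF \<rho>]])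
  have int: "(\<lambda>\<theta>. \<rho> \<theta> * k (b \<theta> + B \<theta> z)) integrable_on cbox 0 1" if "z \<in> W" for z
  proof (rule integrable_continuous)
    have cp: "continuous_on {0..1} (\<lambda>\<theta>::real. (z, \<theta>))" by (intro continuous_intros)
    from continuous_on_compose2[OF ck cp] that
    have "continuous_on {0..1} (\<lambda>\<theta>. k (b \<theta> + B \<theta> z))" by auto
    then show "continuous_on (cbox 0 1) (\<lambda>\<theta>. \<rho> \<theta> * k (b \<theta> + B \<theta> z))"
      unfolding cbox_interval using \<rho> by (intro continuous_intros)
  qed
  have "((\<lambda>z. integral (cbox 0 1) (\<lambda>\<theta>. \<rho> \<theta> * k (b \<theta> + B \<theta> z))) has_derivative
      integral (cbox 0 1) (fx p)) (at p within W)"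
  proof (rule leibniz_rule[OF _ int cfx p W(2)])
    fix z \<theta> assume z: "z \<in> W" and "\<theta> \<in> cbox 0 (1::real)"
    then have \<theta>: "\<theta> \<in> {0..1}" by simp
    have "((\<lambda>z. b \<theta> + B \<theta> z) has_derivative B \<theta>) (at z)"
      by (auto intro!: derivative_eq_intros bounded_linear_imp_has_derivative blinfun.bounded_linear_right)
    from has_derivative_compose[OF this cdiffD(1)[OF k[OF inU[OF z \<theta>]]]]
    have "((\<lambda>z. \<rho> \<theta> * k (b \<theta> + B \<theta> z)) has_derivative (\<lambda>x. \<rho> \<theta> * cder k (b \<theta> + B \<theta> z) (B \<theta> x))) (at z)"
      by (rule has_derivative_mult_right)
    moreover have "(\<lambda>x. \<rho> \<theta> * cder k (b \<theta> + B \<theta> z) (B \<theta> x)) = blinfun_apply (fx z \<theta>)"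
      by (rule ext) (simp only: fx_apply[OF z \<theta>])
    ultimately show "((\<lambda>z. \<rho> \<theta> * k (b \<theta> + B \<theta> z)) has_derivative blinfun_apply (fx z \<theta>)) (at z within W)"
      by (simp add: has_derivative_at_withinI)
  qed
  then have d: "((\<lambda>z. integral {0..1} (\<lambda>\<theta>. \<rho> \<theta> * k (b \<theta> + B \<theta> z))) has_derivative
      blinfun_apply (integral {0..1} (fx p))) (at p)"
    by (simp only: at_within_open[OF p W(1)] cbox_interval)
  have "fx p integrable_on {0..1}"
  proof -
    have cp: "continuous_on {0..1} (\<lambda>\<theta>::real. (p, \<theta>))" by (intro continuous_intros)
    from continuous_on_compose2[OF cfx cp] p have "continuous_on {0..1} (fx p)" by auto
    then show ?thesis by (rule integrable_continuous_interval)
  qed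
  then have ap: "blinfun_apply (integral {0..1} (fx p)) x = integral {0..1} (\<lambda>\<theta>. \<rho> \<theta> * cder k (b \<theta> + B \<theta> p) (B \<theta> x))" for x
    using p by (auto simp: blinfun_apply_integral fx_apply intro!: Henstock_Kurzweil_Integration.integral_cong)
  show ?thesis
  proof (rule cdiffI[OF d])
    fix c x
    have "integral {0..1} (\<lambda>\<theta>. \<rho> \<theta> * cder k (b \<theta> + B \<theta> p) (B \<theta> (c *\<^sub>C x)))
        = integral {0..1} (\<lambda>\<theta>. c * (\<rho> \<theta> * cder k (b \<theta> + B \<theta> p) (B \<theta> x)))"
      using cdiffD(2)[OF k[OF inU[OF p]]] by (intro Henstock_Kurzweil_Integration.integral_cong) (simp add: BC)
    then show "blinfun_apply (integral {0..1} (fx p)) (c *\<^sub>C x) = c *\<^sub>C blinfun_apply (integral {0..1} (fx p)) x"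
      by (simp add: ap)
  qed
qed

text \<open>Cauchy's formula is an integral of translates of f, and such integrals are holomorphic
  in z.\<close>

lemma cdiff_cder:
  fixes f :: "'a::cspace \<Rightarrow> complex"
  assumes U: "open U" and f: "\<And>z. z \<in> U \<Longrightarrow> cdiff f z" and p: "p \<in> U"
  shows "cdiff (\<lambda>z. cder f z v) p"
proof -
  obtain e where e: "e > 0" "ball p e \<subseteq> U" using U p open_contains_ball by blast
  define r where "r = e / (2 * (norm v + 1))"
  have n: "norm v + 1 > 0" by (simp add: add_nonneg_pos)
  have r: "r > 0" using e n by (simp add: r_def)
  have rv: "r * norm v < e / 2" using e n by (simp add: r_def field_simps)
  have inU: "z + t *\<^sub>C v \<in> U" if "z \<in> ball p (e / 2)" "cmod t \<le> r" for z t
  proof -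
    have "cmod t * norm v \<le> r * norm v" using that(2) by (intro mult_right_mono) auto
    then show ?thesis using scaleC_segment_in_ball[OF that(1), of t v] rv e(2) by auto
  qed
  have "cdiff (\<lambda>z. integral {0..1} (\<lambda>\<theta>. (exp (- (2 * of_real pi * \<i> * of_real \<theta>)) / of_real r)
           * f ((of_real r * exp (2 * of_real pi * \<i> * of_real \<theta>)) *\<^sub>C v + blinfun_apply id_blinfun z))) p"
    by (rule cdiff_integral_affine[OF U f, of "ball p (e / 2)"])
       (use e r in \<open>auto intro!: continuous_intros inU simp: add.commute[of "_ *\<^sub>C v"] norm_mult\<close>)
  then show ?thesis
  proof (rule cdiff_transform(1)[of _ _ "ball p (e / 2)"])
    fix x assume x: "x \<in> ball p (e / 2)"
    show "integral {0..1} (\<lambda>\<theta>. (exp (- (2 * of_real pi * \<i> * of_real \<theta>)) / of_real r)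
           * f ((of_real r * exp (2 * of_real pi * \<i> * of_real \<theta>)) *\<^sub>C v + blinfun_apply id_blinfun x)) = cder f x v"
      using cder_Cauchy[of r f x v] inU[OF x] r f by (simp add: add.commute[of "_ *\<^sub>C v"])
  qed (use e in auto)
qed

text \<open>The hypotheses make f continuously differentiable in the real sense with invertible
  derivative at p. The derivative of the local inverse is the inverse of a complex linear bijection,
  hence complex linear.\<close>

theorem inverse_function_cdiff:
  fixes f :: "'a::cspace \<Rightarrow> 'a"
  assumes U: "open U" "p \<in> U" and f: "\<And>z. z \<in> U \<Longrightarrow> cdiff f z"
    and c1: "\<And>v. continuous_on U (\<lambda>z. cder f z v)" and inj: "\<And>v. cder f p v = 0 \<Longrightarrow> v = 0"
  obtains U' V g where "open U'" "U' \<subseteq> U" "p \<in> U'" "open V" "f p \<in> V" "homeomorphism U' V f g"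
    "\<And>y. y \<in> V \<Longrightarrow> cdiff g y"
proof -
  have lin: "linear (cder f p)" by (rule cdiff_linear[OF f[OF U(2)]])
  then have "inj (cder f p)" using inj by (simp add: linear_injective_0)
  then obtain h where h: "linear h" "h \<circ> cder f p = id" using linear_injective_left_inverse[OF lin] by blast
  have "blinfun_apply (Blinfun h) = h" using h(1) by (simp add: bounded_linear_Blinfun_apply linear_linear)
  then have iv: "Blinfun h o\<^sub>L cderL f p = id_blinfun"
    using h(2) f[OF U(2)] by (intro blinfun_eqI) (simp add: cderL_apply fun_eq_iff)
  have der: "(f has_derivative blinfun_apply (cderL f x)) (at x)" if "x \<in> U" for x
    using f[OF that] by (simp add: cderL_apply cdiffD(1))
  obtain U' V g g' where *: "open U'" "U' \<subseteq> U" "p \<in> U'" "open V" "f p \<in> V" "homeomorphism U' V f g"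
    "\<And>y. y \<in> V \<Longrightarrow> (g has_derivative (g' y)) (at y)"
    "\<And>y. y \<in> V \<Longrightarrow> g' y = inv_into UNIV (blinfun_apply (cderL f (g y)))"
    "\<And>y. y \<in> V \<Longrightarrow> bij (blinfun_apply (cderL f (g y)))"
    by (rule inverse_function_theorem[OF U(1) der continuous_on_cderL[OF f c1] U(2) iv]) blast+
  have gd: "cdiff g y" if y: "y \<in> V" for y
  proof (rule cdiffI[OF *(7)[OF y]])
    fix c x
    have gU: "g y \<in> U" using *(2,6) y by (auto simp: homeomorphism_def)
    have b: "bij (cder f (g y))" and g': "g' y = inv_into UNIV (cder f (g y))"
      using *(8,9)[OF y] f[OF gU] by (simp_all add: cderL_apply)
    have "cder f (g y) (c *\<^sub>C inv_into UNIV (cder f (g y)) x) = c *\<^sub>C x"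
      using b by (simp add: cdiffD(2)[OF f[OF gU]] bij_is_surj surj_f_inv_f)
    then show "g' y (c *\<^sub>C x) = c *\<^sub>C g' y x" unfolding g' by (metis b bij_inv_eq_iff)
  qed
  show ?thesis by (rule that[OF *(1-6) gd])
qed

text \<open>The fundamental theorem of calculus along the segment from p to z. Linearity of k in the
  direction v allows z - p to be split into coordinates, each with a holomorphic cofactor.\<close>

lemma hadamard:
  fixes h :: "'a::cspace \<Rightarrow> complex"
  assumes h: "\<And>z. z \<in> ball p r \<Longrightarrow> cdiff h z"
  defines "k \<equiv> \<lambda>v z. integral {0..1} (\<lambda>\<tau>. cder h (p + \<tau> *\<^sub>R (z - p)) v)"
  shows "\<And>v z. z \<in> ball p r \<Longrightarrow> cdiff (k v) z"
    "\<And>z. z \<in> ball p r \<Longrightarrow> h z - h p = k (z - p) z"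
    "\<And>c v z. z \<in> ball p r \<Longrightarrow> k (c *\<^sub>C v) z = c * k v z"
    "\<And>v w z. z \<in> ball p r \<Longrightarrow> k (v + w) z = k v z + k w z"
proof -
  have inb: "p + \<tau> *\<^sub>R (z - p) \<in> ball p r" if "z \<in> ball p r" "\<tau> \<in> {0..1}" for z \<tau>
  proof -
    have "dist p (p + \<tau> *\<^sub>R (z - p)) = \<tau> * norm (z - p)" using that by (simp add: dist_norm)
    also have "\<dots> \<le> 1 * norm (z - p)" using that by (intro mult_right_mono) auto
    finally show ?thesis using that by (simp add: dist_norm norm_minus_commute)
  qed
  have int: "(\<lambda>\<tau>. cder h (p + \<tau> *\<^sub>R (z - p)) v) integrable_on {0..1}" if "z \<in> ball p r" for z v
    by (intro integrable_continuous_interval continuous_on_compose2[OF continuous_on_cder[OF open_ball h]])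
       (use inb that in \<open>auto intro!: continuous_intros\<close>)
  show "cdiff (k v) z" if "z \<in> ball p r" for v z
  proof -
    have "cdiff (\<lambda>z. integral {0..1} (\<lambda>\<tau>. 1 * cder h ((1 - \<tau>) *\<^sub>R p + blinfun_apply (\<tau> *\<^sub>R id_blinfun) z) v)) z"
      by (rule cdiff_integral_affine[OF open_ball cdiff_cder[OF open_ball h] open_ball convex_ball])
         (use inb that in \<open>auto intro!: continuous_intros simp: blinfun.scaleR_left scaleC_scaleR algebra_simps\<close>)
    then show ?thesis unfolding k_def by (simp add: blinfun.scaleR_left algebra_simps)
  qed
  show "h z - h p = k (z - p) z" if "z \<in> ball p r" for z
  proof -
    have "((\<lambda>\<tau>. h (p + \<tau> *\<^sub>R (z - p))) has_vector_derivative cder h (p + \<tau> *\<^sub>R (z - p)) (z - p)) (at \<tau> within {0..1})"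
      if "\<tau> \<in> {0..1}" for \<tau>
    proof -
      have l: "((\<lambda>\<tau>. p + \<tau> *\<^sub>R (z - p)) has_derivative (\<lambda>s. s *\<^sub>R (z - p))) (at \<tau>)"
        by (auto intro!: derivative_eq_intros)
      have cd: "cdiff h (p + \<tau> *\<^sub>R (z - p))" using inb \<open>z \<in> ball p r\<close> that h by blast
      have "((\<lambda>\<tau>. h (p + \<tau> *\<^sub>R (z - p))) has_derivative (\<lambda>s. cder h (p + \<tau> *\<^sub>R (z - p)) (s *\<^sub>R (z - p)))) (at \<tau>)"
        by (rule has_derivative_compose[OF l cdiffD(1)[OF cd]])
      then show ?thesis
        unfolding has_vector_derivative_def
        by (simp add: linear_cmul[OF cdiff_linear[OF cd]] has_derivative_at_withinI)
    qed
    from fundamental_theorem_of_calculus[OF _ this]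
    show ?thesis unfolding k_def by (auto dest: integral_unique)
  qed
  show "k (c *\<^sub>C v) z = c * k v z" if "z \<in> ball p r" for c v z
  proof -
    have "k (c *\<^sub>C v) z = integral {0..1} (\<lambda>\<tau>. c * cder h (p + \<tau> *\<^sub>R (z - p)) v)"
      unfolding k_def using cdiffD(2)[OF h[OF inb[OF that]]]
      by (intro Henstock_Kurzweil_Integration.integral_cong) simp
    then show ?thesis by (simp add: k_def)
  qed
  show "k (v + w) z = k v z + k w z" if "z \<in> ball p r" for v w z
  proof -
    have "k (v + w) z = integral {0..1} (\<lambda>\<tau>. cder h (p + \<tau> *\<^sub>R (z - p)) v + cder h (p + \<tau> *\<^sub>R (z - p)) w)"
      unfolding k_def using linear_add[OF cdiff_linear[OF h[OF inb[OF that]]]]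
      by (intro Henstock_Kurzweil_Integration.integral_cong) simp
    then show ?thesis using int[OF that] by (simp add: k_def integral_add)
  qed
qed

section \<open>Normal form of a fold\<close>


lemma hol2_iff_cdiff: "hol2 U h \<longleftrightarrow> open U \<and> (\<forall>z\<in>U. cdiff h z)"
proof -
  have "(\<exists>A B. (h has_derivative (\<lambda>(u, v). A * u + B * v)) (at z)) \<longleftrightarrow> cdiff h z" for z
  proof
    assume "\<exists>A B. (h has_derivative (\<lambda>(u, v). A * u + B * v)) (at z)"
    then obtain A B where d: "(h has_derivative (\<lambda>(u, v). A * u + B * v)) (at z)" by blast
    show "cdiff h z" by (rule cdiffI[OF d]) (auto simp: case_prod_unfold algebra_simps)
  next
    assume c: "cdiff h z"
    have *: "cder h z (u, v) = cder h z (1, 0) * u + cder h z (0, 1) * v" for u v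
    proof -
      have "(u, v) = u *\<^sub>C (1, 0) + v *\<^sub>C (0, 1)" by simp
      then show ?thesis
        by (simp only: linear_add[OF cdiff_linear[OF c]] cdiffD(2)[OF c] scaleC_complex_def mult.commute)
    qed
    have eq: "cder h z = (\<lambda>(u, v). cder h z (1, 0) * u + cder h z (0, 1) * v)"
    proof
      fix w :: c2
      show "cder h z w = (case w of (u, v) \<Rightarrow> cder h z (1, 0) * u + cder h z (0, 1) * v)"
        using *[of "fst w" "snd w"] by (simp add: case_prod_unfold)
    qed
    show "\<exists>A B. (h has_derivative (\<lambda>(u, v). A * u + B * v)) (at z)"
      using cdiffD(1)[OF c] by (subst (asm) eq) blast
  qed
  then show ?thesis unfolding hol2_def by blast
qed

lemma cder_const: "cder (\<lambda>_. c) z v = 0"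
  using cder_eq[OF has_derivative_const, of c z] by simp

lemma cder_ident: "cder (\<lambda>x. x) z v = v"
  using cder_eq[OF has_derivative_ident, of z] by simp

lemma cder_c2:
  assumes c: "cdiff (h :: c2 \<Rightarrow> complex) z"
  shows "cder h z v = pdx h z * fst v + pdy h z * snd v"
    "pdx h z = cder h z (1, 0)" "pdy h z = cder h z (0, 1)"
proof -
  have i: "cdiff (\<lambda>t. (t, snd z)) (fst z)" "cdiff (\<lambda>t. (fst z, t)) (snd z)"
    by (intro cdiff_Pair(1) cdiff_ident cdiff_const)+
  have d: "cder (\<lambda>t. (t, snd z)) (fst z) 1 = (1, 0)" "cder (\<lambda>t. (fst z, t)) (snd z) 1 = (0, 1)"
    by (rule cder_eq[THEN fun_cong, THEN trans], rule has_derivative_Pair; (rule has_derivative_ident has_derivative_const)?; simp)+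
  have "cdiff (\<lambda>t. h (t, snd z)) (fst z)" "cder (\<lambda>t. h (t, snd z)) (fst z) 1 = cder h z (1, 0)"
    using cdiff_compose[OF i(1), of h] c d(1) by simp_all
  then show x: "pdx h z = cder h z (1, 0)"
    unfolding pdx_def using DERIV_imp_deriv[OF cdiff_imp_field_derivative] by metis
  have "cdiff (\<lambda>t. h (fst z, t)) (snd z)" "cder (\<lambda>t. h (fst z, t)) (snd z) 1 = cder h z (0, 1)"
    using cdiff_compose[OF i(2), of h] c d(2) by simp_all
  then show y: "pdy h z = cder h z (0, 1)"
    unfolding pdy_def using DERIV_imp_deriv[OF cdiff_imp_field_derivative] by metis
  have "v = fst v *\<^sub>C (1, 0) + snd v *\<^sub>C (0, 1)" by simp
  then have "cder h z v = cder h z (fst v *\<^sub>C (1, 0) + snd v *\<^sub>C (0, 1))" by simp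
  also have "\<dots> = fst v * cder h z (1, 0) + snd v * cder h z (0, 1)"
    by (simp only: linear_add[OF cdiff_linear[OF c]] cdiffD(2)[OF c] scaleC_complex_def)
  finally show "cder h z v = pdx h z * fst v + pdy h z * snd v" by (simp add: x y mult.commute)
qed

lemma jac_cder:
  assumes "cdiff f z" "cdiff g z"
  shows "jac f g z = cder f z (1, 0) * cder g z (0, 1) - cder f z (0, 1) * cder g z (1, 0)"
  by (simp add: jac_def cder_c2(2,3) assms)

lemma jac_swap: "jac g f z = - jac f g z"
  by (simp add: jac_def)

lemma cdiff_jac:
  assumes U: "open U" "z \<in> U" and f: "\<And>z. z \<in> U \<Longrightarrow> cdiff f z" and g: "\<And>z. z \<in> U \<Longrightarrow> cdiff g z"
  shows "cdiff (jac f g) z"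
proof (rule cdiff_transform(1)[OF _ U])
  show "cdiff (\<lambda>z. cder f z (1, 0) * cder g z (0, 1) - cder f z (0, 1) * cder g z (1, 0)) z"
    by (intro cdiff_diff(1) cdiff_mult(1) cdiff_cder[OF U(1)] f g U)
qed (simp add: jac_cder f g)

lemma jac_chain_partials:
  assumes P: "cdiff P (h z, k z)" and h: "cdiff h z" and k: "cdiff k z"
  shows "cdiff (\<lambda>z. P (h z, k z)) z"
    "cder (\<lambda>z. P (h z, k z)) z v = pdx P (h z, k z) * cder h z v + pdy P (h z, k z) * cder k z v"
proof -
  note c = cdiff_compose[OF cdiff_Pair(1)[OF h k] P]
  show "cdiff (\<lambda>z. P (h z, k z)) z" by (rule c(1))
  show "cder (\<lambda>z. P (h z, k z)) z v = pdx P (h z, k z) * cder h z v + pdy P (h z, k z) * cder k z v"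
    using c(2)[of v] by (simp add: cdiff_Pair(2)[OF h k] cder_c2(1)[OF P])
qed

lemma det2_kernel:
  fixes a b c d x y :: complex
  assumes "a * d - b * c \<noteq> 0" "a * x + b * y = 0" "c * x + d * y = 0"
  shows "x = 0" "y = 0"
proof -
  have "(a * d - b * c) * x = d * (a * x + b * y) - b * (c * x + d * y)" by (simp add: algebra_simps)
  then show "x = 0" using assms by simp
  have "(a * d - b * c) * y = a * (c * x + d * y) - c * (a * x + b * y)" by (simp add: algebra_simps)
  then show "y = 0" using assms by simp
qed

lemma inverse_function_c2:
  assumes U: "open U" "p \<in> U" and h: "\<And>z. z \<in> U \<Longrightarrow> cdiff h z" and k: "\<And>z. z \<in> U \<Longrightarrow> cdiff k z"
    and j: "jac h k p \<noteq> 0"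
  obtains U' V g where "open U'" "U' \<subseteq> U" "p \<in> U'" "open V" "(h p, k p) \<in> V"
    "homeomorphism U' V (\<lambda>z. (h z, k z)) g" "\<And>y. y \<in> V \<Longrightarrow> cdiff g y"
proof (rule inverse_function_cdiff[of U p "\<lambda>z. (h z, k z)", OF U])
  show "cdiff (\<lambda>z. (h z, k z)) z" if "z \<in> U" for z by (rule cdiff_Pair(1)[OF h[OF that] k[OF that]])
  show "continuous_on U (\<lambda>z. cder (\<lambda>z. (h z, k z)) z v)" for v
  proof (rule continuous_on_eq)
    show "continuous_on U (\<lambda>z. (cder h z v, cder k z v))"
      by (intro continuous_on_Pair continuous_on_cder U h k)
  qed (simp add: cdiff_Pair(2) h k)
  show "v = 0" if "cder (\<lambda>z. (h z, k z)) p v = 0" for v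
  proof -
    have "pdx h p * fst v + pdy h p * snd v = 0" "pdx k p * fst v + pdy k p * snd v = 0"
      using that by (simp_all add: cdiff_Pair(2) h k U cder_c2(1) zero_prod_def)
    from det2_kernel[OF j[unfolded jac_def] this] show ?thesis by (simp add: prod_eq_iff)
  qed
qed (rule that; assumption)

lemma biholo_germI:
  assumes "open U" "p \<in> U" "\<And>z. z \<in> U \<Longrightarrow> cdiff h z" "\<And>z. z \<in> U \<Longrightarrow> cdiff k z" "jac h k p \<noteq> 0"
  shows "biholo_germ (\<lambda>z. (h z, k z)) p (h p, k p)"
proof -
  obtain U' V g where *: "open U'" "U' \<subseteq> U" "p \<in> U'" "open V" "(h p, k p) \<in> V"
    "homeomorphism U' V (\<lambda>z. (h z, k z)) g" "\<And>y. y \<in> V \<Longrightarrow> cdiff g y"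
    by (rule inverse_function_c2[OF assms]) blast+
  have "bij_betw (\<lambda>z. (h z, k z)) U' V"
    unfolding bij_betw_def using homeomorphism_image1[OF *(6)] homeomorphism_apply1[OF *(6)]
    by (auto intro: inj_on_inverseI[of _ g])
  moreover have "hol2map U' (\<lambda>z. (h z, k z))"
    using * assms(3,4) by (auto simp: hol2map_def hol2_iff_cdiff)
  moreover have "hol2map V g" using *(4,7)
    by (auto simp: hol2map_def hol2_iff_cdiff intro!: cdiff_fst(1) cdiff_snd(1))
  moreover have "\<forall>x\<in>U'. g (h x, k x) = x" using *(6) by (auto simp: homeomorphism_def)
  ultimately show ?thesis unfolding biholo_germ_def using * by blast
qed

text \<open>By the chain rule for the holomorphic left inverse, the derivative at p is injective, so
  its determinant is nonzero.\<close>

lemma biholo_germD: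
  assumes "biholo_germ \<phi> p q"
  obtains U where "open U" "p \<in> U" "\<And>z. z \<in> U \<Longrightarrow> cdiff (\<lambda>z. fst (\<phi> z)) z"
    "\<And>z. z \<in> U \<Longrightarrow> cdiff (\<lambda>z. snd (\<phi> z)) z" "jac (\<lambda>z. fst (\<phi> z)) (\<lambda>z. snd (\<phi> z)) p \<noteq> 0" "\<phi> p = q"
proof -
  obtain U V g where *: "p \<in> U" "open U" "open V" "bij_betw \<phi> U V" "hol2map U \<phi>" "hol2map V g" "\<forall>x\<in>U. g (\<phi> x) = x"
    "\<phi> p = q" using assms unfolding biholo_germ_def by blast
  have f: "\<And>z. z \<in> U \<Longrightarrow> cdiff (\<lambda>z. fst (\<phi> z)) z" and s: "\<And>z. z \<in> U \<Longrightarrow> cdiff (\<lambda>z. snd (\<phi> z)) z"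
    using *(5) by (auto simp: hol2map_def hol2_iff_cdiff)
  have pV: "\<phi> p \<in> V" using *(1,4) by (auto simp: bij_betw_def)
  have \<phi>c: "cdiff \<phi> p" using cdiff_Pair[OF f[OF *(1)] s[OF *(1)]] by simp
  have \<phi>d: "cder \<phi> p v = (cder (\<lambda>z. fst (\<phi> z)) p v, cder (\<lambda>z. snd (\<phi> z)) p v)" for v
    using cdiff_Pair(2)[OF f[OF *(1)] s[OF *(1)], of v] by simp
  have "cdiff (\<lambda>y. (fst (g y), snd (g y))) (\<phi> p)"
    using *(6) pV by (intro cdiff_Pair(1)) (auto simp: hol2map_def hol2_iff_cdiff)
  then have gc: "cdiff g (\<phi> p)" by simp
  have id: "cder g (\<phi> p) (cder \<phi> p v) = v" for v
  proof -
    have "cder (\<lambda>x. g (\<phi> x)) p = cder (\<lambda>x. x) p"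
      using cdiff_transform(2)[OF cdiff_ident *(2,1), of "\<lambda>x. g (\<phi> x)"] *(7) by simp
    moreover have "cder (\<lambda>x. x) p v = v" using cder_eq[OF has_derivative_ident, of p] by simp
    ultimately show ?thesis using cdiff_compose(2)[OF \<phi>c gc, of v] by simp
  qed
  have "jac (\<lambda>z. fst (\<phi> z)) (\<lambda>z. snd (\<phi> z)) p \<noteq> 0"
  proof
    assume z: "jac (\<lambda>z. fst (\<phi> z)) (\<lambda>z. snd (\<phi> z)) p = 0"
    define a b c d where "a = pdx (\<lambda>z. fst (\<phi> z)) p" and "b = pdy (\<lambda>z. fst (\<phi> z)) p"
      and "c = pdx (\<lambda>z. snd (\<phi> z)) p" and "d = pdy (\<lambda>z. snd (\<phi> z)) p"
    have det: "a * d = b * c" using z by (simp add: jac_def a_def b_def c_def d_def)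
    have \<phi>v: "cder \<phi> p (x, y) = (a * x + b * y, c * x + d * y)" for x y
      by (simp add: \<phi>d a_def b_def c_def d_def cder_c2(1)[OF f[OF *(1)]] cder_c2(1)[OF s[OF *(1)]])
    have z0: "cder g (\<phi> p) 0 = 0" by (rule linear_0[OF cdiff_linear[OF gc]])
    have "v = 0" if "cder \<phi> p v = 0" for v using id[of v] that z0 by simp
    then have k: "x = 0 \<and> y = 0" if "a * x + b * y = 0" "c * x + d * y = 0" for x y
    proof -
      have "cder \<phi> p (x, y) = 0" using that \<phi>v[of x y] by (simp add: zero_prod_def)
      then have "(x, y) = 0" by (rule \<open>\<And>v. cder \<phi> p v = 0 \<Longrightarrow> v = 0\<close>)
      then show ?thesis by (simp add: zero_prod_def)
    qed
    \<comment> \<open>A singular matrix kills (-b, a) and (-d, c). Injectivity makes both vectors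
      zero, and the resulting zero matrix would kill (1, 0).\<close>
    have "b = 0 \<and> a = 0" using k[of "- b" a] det by (simp add: algebra_simps)
    moreover have "d = 0 \<and> c = 0" using k[of "- d" c] det by (simp add: algebra_simps)
    ultimately show False using k[of 1 0] by simp
  qed
  then show ?thesis using that *(1,2,8) f s by blast
qed

lemma polyfun2_cdiff:
  assumes "polyfun2 h"
  shows "cdiff h z"
proof -
  obtain \<Phi> where \<Phi>: "\<And>z. h z = ev2 \<Phi> (fst z) (snd z)" using assms unfolding polyfun2_def by blast
  have q: "cdiff (\<lambda>z::c2. poly a (fst z)) z" for a
    by (rule cdiff_compose(1)[OF cdiff_fst(1)[OF cdiff_ident] cdiff_field_derivative(1)[OF poly_DERIV]])
  have "cdiff (\<lambda>z. ev2 \<Phi> (fst z) (snd z)) z"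
  proof (induction \<Phi>)
    case (pCons a \<Phi>)
    have "cdiff (\<lambda>z. poly a (fst z) + snd z * ev2 \<Phi> (fst z) (snd z)) z"
      by (rule cdiff_add(1)[OF q cdiff_mult(1)[OF cdiff_snd(1)[OF cdiff_ident] pCons.IH]])
    then show ?case by (simp only: ev2_simps)
  qed simp
  then show ?thesis by (simp only: \<Phi>[symmetric])
qed

text \<open>In the coordinates (J, F2), F1 becomes a function P(s, t). Since the Jacobian of (F1,
  F2) is \<kappa> J, the partial P_s is s times a unit w, and integrating from s = 0 leaves P(0, t)
  plus s^2 times a unit. The condition \<open>j1\<close> says that P_t vanishes at the origin, so
  \<gamma>(t) = P(0, t) has derivative 0 there.\<close>

lemma fold_normal_form:
  fixes F1 F2 J :: "c2 \<Rightarrow> complex"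
  assumes U: "open U" "a \<in> U" and F1: "\<And>z. z \<in> U \<Longrightarrow> cdiff F1 z" and F2: "\<And>z. z \<in> U \<Longrightarrow> cdiff F2 z"
    and J: "\<And>z. z \<in> U \<Longrightarrow> cdiff J z" and z: "F1 a = 0" "F2 a = 0" "J a = 0"
    and jF: "\<And>z. z \<in> U \<Longrightarrow> jac F1 F2 z = \<kappa> * J z" and \<kappa>: "\<kappa> \<noteq> 0"
    and j2: "jac J F2 a \<noteq> 0" and j1: "jac J F1 a = 0"
  obtains W r \<gamma> q where "open W" "a \<in> W" "W \<subseteq> U" "r > 0" "\<And>t. t \<in> ball 0 r \<Longrightarrow> cdiff \<gamma> t"
    "\<gamma> 0 = 0" "cder \<gamma> 0 1 = 0" "\<And>z. z \<in> W \<Longrightarrow> F2 z \<in> ball 0 r \<and> F1 z = \<gamma> (F2 z) + (J z)\<^sup>2 * q z"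
    "\<And>z. z \<in> W \<Longrightarrow> cdiff q z" "q a \<noteq> 0"
proof -
  have jc: "cdiff (jac J F2) z" if "z \<in> U" for z by (rule cdiff_jac[OF U(1) that J F2])
  define U0 where "U0 = U \<inter> jac J F2 -` (- {0})"
  have U0: "open U0"
    unfolding U0_def by (rule continuous_open_preimage[OF cdiff_continuous_on[OF jc] U(1)]) auto
  have aU0: "a \<in> U0" using U(2) j2 by (simp add: U0_def)
  have sub: "U0 \<subseteq> U" by (auto simp: U0_def)
  have JU0: "cdiff J z" and F2U0: "cdiff F2 z" if "z \<in> U0" for z using that sub J F2 by blast+
  obtain U' V \<psi> where inv: "open U'" "U' \<subseteq> U0" "a \<in> U'" "open V" "(J a, F2 a) \<in> V"
    "homeomorphism U' V (\<lambda>z. (J z, F2 z)) \<psi>" "\<And>y. y \<in> V \<Longrightarrow> cdiff \<psi> y"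
    by (rule inverse_function_c2[OF U0 aU0 JU0 F2U0 j2]) blast+
  have \<psi>U: "\<psi> y \<in> U'" if "y \<in> V" for y
    using homeomorphism_image2[OF inv(6)] that by blast
  have \<psi>J: "J (\<psi> y) = fst y" and \<psi>F: "F2 (\<psi> y) = snd y" if "y \<in> V" for y
    using homeomorphism_apply2[OF inv(6) that] by (metis fst_conv, metis snd_conv)
  have \<phi>V: "(J z, F2 z) \<in> V" and \<psi>\<phi>: "\<psi> (J z, F2 z) = z" if "z \<in> U'" for z
    using homeomorphism_image1[OF inv(6)] homeomorphism_apply1[OF inv(6) that] that by blast+
  have U'U: "z \<in> U" if "z \<in> U'" for z using that inv(2) sub by blast
  define P where "P = (\<lambda>y. F1 (\<psi> y))"
  have Pc: "cdiff P y" if "y \<in> V" for y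
    unfolding P_def by (rule cdiff_compose(1)[OF inv(7)[OF that] F1[OF U'U[OF \<psi>U[OF that]]]])
  have F1d: "cder F1 z v = pdx P (J z, F2 z) * cder J z v + pdy P (J z, F2 z) * cder F2 z v" if "z \<in> U'" for z v
  proof -
    note ch = jac_chain_partials[OF Pc[OF \<phi>V[OF that]] J[OF U'U[OF that]] F2[OF U'U[OF that]]]
    have "cder F1 z = cder (\<lambda>z. P (J z, F2 z)) z"
      by (rule cdiff_transform(2)[OF ch(1) inv(1) that]) (simp add: P_def \<psi>\<phi>)
    then show ?thesis using ch(2)[of v] by simp
  qed
  \<comment> \<open>Substituting dF1 = P_s dJ + P_t dF2 in either Jacobian makes one of the two
    terms cancel.\<close>
  have PJ: "jac F1 F2 z = pdx P (J z, F2 z) * jac J F2 z" and PJ1: "jac J F1 z = pdy P (J z, F2 z) * jac J F2 z"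
    if "z \<in> U'" for z
    using that by (simp_all add: jac_cder J F1 F2 U'U F1d algebra_simps)
  define w where "w = (\<lambda>y. \<kappa> / jac J F2 (\<psi> y))"
  have jn: "jac J F2 (\<psi> y) \<noteq> 0" if "y \<in> V" for y using \<psi>U[OF that] inv(2) by (auto simp: U0_def)
  have wc: "cdiff w y" if "y \<in> V" for y
    unfolding w_def
    by (rule cdiff_divide[OF cdiff_const cdiff_compose(1)[OF inv(7)[OF that] jc[OF U'U[OF \<psi>U[OF that]]]] jn[OF that]])
  have Ps: "pdx P y = fst y * w y" if "y \<in> V" for y
    using PJ[OF \<psi>U[OF that]] jF[OF U'U[OF \<psi>U[OF that]]] jn[OF that] \<psi>J[OF that] \<psi>F[OF that]
    by (simp add: w_def field_simps)
  have "0 \<in> V" using inv(5) z by (simp add: zero_prod_def)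
  then obtain r where r: "r > 0" "ball 0 r \<subseteq> V" using inv(4) open_contains_ball by blast
  define \<gamma> where "\<gamma> = (\<lambda>t. P (0, t))"
  have inl: "cdiff (\<lambda>t. (0::complex, t)) t" "cder (\<lambda>t. (0::complex, t)) t v = (0, v)" for t v :: complex
    using cdiff_Pair[OF cdiff_const cdiff_ident, of 0 t] by (simp_all add: cder_const cder_ident)
  have 0: "(0::complex, t) \<in> ball 0 r" if "t \<in> ball 0 r" for t :: complex
    using that by (simp only: mem_ball dist_0_norm norm_Pair) simp
  have \<gamma>c: "cdiff \<gamma> t" if "t \<in> ball 0 r" for t
    unfolding \<gamma>_def using 0[OF that] r(2) by (intro cdiff_compose(1)[OF inl(1)] Pc) blast
  have P0: "P (0, 0) = 0" using \<psi>\<phi>[OF inv(3)] z by (simp add: P_def)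
  have "pdy P (0, 0) = 0" using PJ1[OF inv(3)] j1 j2 z by simp
  moreover have "cder \<gamma> 0 1 = pdy P (0, 0)"
    unfolding \<gamma>_def using cdiff_compose(2)[OF inl(1), of P 0 1] Pc[OF \<open>0 \<in> V\<close>]
    by (simp add: inl(2) cder_c2(3) zero_prod_def)
  ultimately have \<gamma>': "cder \<gamma> 0 1 = 0" by simp
  \<comment> \<open>The operator \<open>\<tau> *\<^sub>R E1 + E2\<close> sends (s, t) to (\<tau> s,
    t); in this form the integral defining \<open>q0\<close> falls under
    \<open>cdiff_integral_affine\<close>.\<close>
  define E1 :: "c2 \<Rightarrow>\<^sub>L c2" where "E1 = Blinfun (\<lambda>y. (fst y, 0))"
  define E2 :: "c2 \<Rightarrow>\<^sub>L c2" where "E2 = Blinfun (\<lambda>y. (0, snd y))"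
  have E: "blinfun_apply E1 y = (fst y, 0)" "blinfun_apply E2 y = (0, snd y)" for y
    unfolding E1_def E2_def
    by (subst bounded_linear_Blinfun_apply; simp add: bounded_linear_Pair bounded_linear_fst bounded_linear_snd bounded_linear_zero)+
  have Bap: "blinfun_apply (\<tau> *\<^sub>R E1 + E2) y = (\<tau> *\<^sub>R fst y, snd y)" for \<tau> y
    by (simp add: blinfun.add_left blinfun.scaleR_left E)
  have inb: "(\<tau> *\<^sub>R fst y, snd y) \<in> ball 0 r" if "y \<in> ball 0 r" "\<tau> \<in> {0..1}" for y :: c2 and \<tau> :: real
  proof -
    have "(\<bar>\<tau>\<bar> * cmod (fst y))\<^sup>2 \<le> (cmod (fst y))\<^sup>2"
      using that(2) by (intro power_mono) (auto intro: mult_left_le_one_le)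
    then have "norm (\<tau> *\<^sub>R fst y, snd y) \<le> norm y"
      by (simp add: norm_prod_def)
    then show ?thesis using that(1) by simp
  qed
  \<comment> \<open>The derivative of P(\<tau> s, t) in \<tau> is s P_s(\<tau> s, t) = s^2 \<tau>
    w(\<tau> s, t), whence the weight \<tau>. At the origin the integral equals w/2, so
    \<open>q0\<close> is a unit.\<close>
  define q0 where "q0 = (\<lambda>y. integral {0..1} (\<lambda>\<tau>. of_real \<tau> * w (\<tau> *\<^sub>R fst y, snd y)))"
  have q0c: "cdiff q0 y" if "y \<in> ball 0 r" for y
  proof -
    have "cdiff (\<lambda>y. integral {0..1} (\<lambda>\<tau>. of_real \<tau> * w (0 + blinfun_apply (\<tau> *\<^sub>R E1 + E2) y))) y"
    proof (rule cdiff_integral_affine[OF inv(4) wc open_ball[of 0 r] convex_ball[of 0 r]])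
      show "0 + blinfun_apply (\<tau> *\<^sub>R E1 + E2) x \<in> V" if "x \<in> ball 0 r" "\<tau> \<in> {0..1}" for x \<tau>
        using inb[OF that] r(2) by (simp only: Bap add_0) blast
      show "blinfun_apply (\<tau> *\<^sub>R E1 + E2) (c *\<^sub>C x) = c *\<^sub>C blinfun_apply (\<tau> *\<^sub>R E1 + E2) x" for \<tau> c x
        by (simp add: Bap scaleR_conv_of_real)
      show "y \<in> ball 0 r" by (rule that)
    qed (auto intro!: continuous_intros)
    then show ?thesis by (simp only: Bap add_0 q0_def)
  qed
  have expand: "P (s, t) = \<gamma> t + s\<^sup>2 * q0 (s, t)" if "(s, t) \<in> ball 0 r" for s t
  proof -
    have d: "((\<lambda>\<tau>. P (\<tau> *\<^sub>R s, t)) has_vector_derivative s\<^sup>2 * (of_real \<tau> * w (\<tau> *\<^sub>R s, t))) (at \<tau> within {0..1})"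
      if "\<tau> \<in> {0..1}" for \<tau>
    proof -
      have y: "(\<tau> *\<^sub>R s, t) \<in> V" using inb[OF \<open>(s, t) \<in> ball 0 r\<close> that] r(2) by auto
      have "((\<lambda>\<tau>. (\<tau> *\<^sub>R s, t)) has_derivative (\<lambda>x. (x *\<^sub>R s, 0))) (at \<tau>)"
        by (auto intro!: derivative_eq_intros)
      from has_derivative_compose[OF this cdiffD(1)[OF Pc[OF y]]]
      have "((\<lambda>\<tau>. P (\<tau> *\<^sub>R s, t)) has_derivative (\<lambda>x. cder P (\<tau> *\<^sub>R s, t) (x *\<^sub>R s, 0))) (at \<tau>)" .
      moreover have "cder P (\<tau> *\<^sub>R s, t) (x *\<^sub>R s, 0) = x *\<^sub>R (s\<^sup>2 * (of_real \<tau> * w (\<tau> *\<^sub>R s, t)))" for x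
        unfolding cder_c2(1)[OF Pc[OF y]] Ps[OF y] by (simp add: scaleR_conv_of_real power2_eq_square)
      ultimately show ?thesis
        unfolding has_vector_derivative_def by (simp add: has_derivative_at_withinI)
    qed
    have "((\<lambda>\<tau>. s\<^sup>2 * (of_real \<tau> * w (\<tau> *\<^sub>R s, t))) has_integral P (1 *\<^sub>R s, t) - P (0 *\<^sub>R s, t)) {0..1}"
      by (rule fundamental_theorem_of_calculus[OF _ d]) auto
    from integral_unique[OF this] have "P (s, t) - P (0, t) = s\<^sup>2 * q0 (s, t)" by (simp add: q0_def)
    then show ?thesis by (simp add: \<gamma>_def algebra_simps)
  qed
  have q00: "q0 (0, 0) \<noteq> 0"
  proof -
    have "q0 (0, 0) = integral {0..1} (\<lambda>\<tau>. of_real \<tau>) * w (0, 0)" by (simp add: q0_def)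
    moreover have "integral {0..1} (\<lambda>\<tau>. complex_of_real \<tau>) = of_real (1 / 2)"
    proof -
      have "((\<lambda>\<tau>::real. \<tau>) has_integral (1\<^sup>2 / 2 - 0\<^sup>2 / 2)) {0..1}"
        by (rule fundamental_theorem_of_calculus)
           (auto intro!: derivative_eq_intros simp: has_real_derivative_iff_has_vector_derivative[symmetric])
      then have "((\<lambda>\<tau>::real. complex_of_real \<tau>) has_integral of_real (1\<^sup>2 / 2 - 0\<^sup>2 / 2)) {0..1}"
        by (rule has_integral_of_real)
      then show ?thesis by (simp add: integral_unique)
    qed
    moreover have "w (0, 0) \<noteq> 0" using \<kappa> jn[OF \<open>0 \<in> V\<close>] by (simp add: w_def zero_prod_def)
    ultimately show ?thesis by auto
  qed
  define W where "W = U' \<inter> (\<lambda>z. (J z, F2 z)) -` ball 0 r"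
  have W: "open W"
    unfolding W_def
    by (rule continuous_open_preimage[OF _ inv(1) open_ball])
       (intro continuous_on_Pair cdiff_continuous_on J F2 U'U)
  show ?thesis
  proof (rule that[of W r \<gamma> "\<lambda>z. q0 (J z, F2 z)"])
    show "a \<in> W" using inv(3) z r(1) by (simp add: W_def zero_prod_def[symmetric])
    show "W \<subseteq> U" using U'U by (auto simp: W_def)
    show "\<gamma> 0 = 0" using P0 by (simp add: \<gamma>_def)
    show "q0 (J a, F2 a) \<noteq> 0" using q00 z by simp
    fix x assume x: "x \<in> W"
    then have xU': "x \<in> U'" and xb: "(J x, F2 x) \<in> ball 0 r" by (auto simp: W_def)
    have "cmod (F2 x) \<le> norm (J x, F2 x)" using norm_snd_le[of "F2 x" "J x"] by simp
    then have "F2 x \<in> ball 0 r" using xb by simp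
    moreover have "F1 x = P (J x, F2 x)" by (simp add: P_def \<psi>\<phi>[OF xU'])
    ultimately show "F2 x \<in> ball 0 r \<and> F1 x = \<gamma> (F2 x) + (J x)\<^sup>2 * q0 (J x, F2 x)"
      using expand[OF xb] by simp
    show "cdiff (\<lambda>z. q0 (J z, F2 z)) x"
      by (rule cdiff_compose(1)[OF cdiff_Pair(1)[OF J[OF U'U[OF xU']] F2[OF U'U[OF xU']]] q0c[OF xb]])
  qed (use W r \<gamma>c \<gamma>' in auto)
qed

text \<open>Division by q(a) moves the value at a to 1. Near a the quotient stays in the right half
  plane, away from the cut of \<open>csqrt\<close>, and the constant \<open>csqrt (q a)\<close>
  restores q.\<close>

lemma cdiff_sqrt:
  fixes q :: "'a::cspace \<Rightarrow> complex"
  assumes W: "open W" "a \<in> W" and q: "\<And>z. z \<in> W \<Longrightarrow> cdiff q z" and q0: "q a \<noteq> 0"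
  obtains W' s where "open W'" "a \<in> W'" "W' \<subseteq> W" "\<And>z. z \<in> W' \<Longrightarrow> cdiff s z"
    "\<And>z. z \<in> W' \<Longrightarrow> (s z)\<^sup>2 = q z" "s a \<noteq> 0"
proof -
  define h where "h = (\<lambda>z. q z / q a)"
  have h: "cdiff h z" if "z \<in> W" for z
    unfolding h_def by (rule cdiff_divide[OF q[OF that] cdiff_const q0])
  define W' where "W' = W \<inter> h -` {x. 0 < Re x}"
  define s where "s = (\<lambda>z. csqrt (q a) * csqrt (h z))"
  show ?thesis
  proof (rule that[of W' s])
    show "open W'" unfolding W'_def
      by (rule continuous_open_preimage[OF cdiff_continuous_on[OF h] W(1)]) (auto intro: open_halfspace_Re_gt)
    show "a \<in> W'" "s a \<noteq> 0" using W(2) q0 by (simp_all add: W'_def h_def s_def)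
    fix z assume z: "z \<in> W'"
    then have "Re (h z) > 0" and hz: "cdiff h z" using h by (simp_all add: W'_def)
    then have "h z \<notin> \<real>\<^sub>\<le>\<^sub>0" by (simp add: complex_nonpos_Reals_iff)
    then have "cdiff csqrt (h z)" by (rule cdiff_field_derivative(1)[OF has_field_derivative_csqrt])
    then have "cdiff (\<lambda>z. csqrt (h z)) z" by (rule cdiff_compose(1)[OF hz])
    then show "cdiff s z" unfolding s_def by (rule cdiff_mult(1)[OF cdiff_const])
    show "(s z)\<^sup>2 = q z" using q0 by (simp add: s_def power_mult_distrib h_def)
  qed (auto simp: W'_def)
qed

text \<open>With s^2 = q, the term J^2 q is the square of the coordinate J s. The correction
  \<delta>(F1), which will be the curve belonging to the other point of the pair, has zero
  differential at a, so the Jacobian there is s(a) times that of (J, F2). Both orders of the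
  coordinates are given, one for \<open>fold1\<close> and one for \<open>fold2\<close>.\<close>

lemma fold_chart:
  fixes F1 F2 J q :: "c2 \<Rightarrow> complex"
  assumes W: "open W" "a \<in> W" and F1: "\<And>z. z \<in> W \<Longrightarrow> cdiff F1 z" and F2: "\<And>z. z \<in> W \<Longrightarrow> cdiff F2 z"
    and J: "\<And>z. z \<in> W \<Longrightarrow> cdiff J z" and q: "\<And>z. z \<in> W \<Longrightarrow> cdiff q z" and q0: "q a \<noteq> 0"
    and z: "F1 a = 0" "F2 a = 0" "J a = 0" and j: "jac J F2 a \<noteq> 0"
    and \<delta>: "r > 0" "\<And>t. t \<in> ball 0 r \<Longrightarrow> cdiff \<delta> t" "\<delta> 0 = 0" "cder \<delta> 0 1 = 0"
  obtains s where "\<forall>\<^sub>F z in nhds a. (s z)\<^sup>2 = q z"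
    "biholo_germ (\<lambda>z. (J z * s z, F2 z - \<delta> (F1 z))) a 0"
    "biholo_germ (\<lambda>z. (F2 z - \<delta> (F1 z), J z * s z)) a 0"
proof -
  obtain W' s where W': "open W'" "a \<in> W'" "W' \<subseteq> W" "\<And>z. z \<in> W' \<Longrightarrow> cdiff s z"
    "\<And>z. z \<in> W' \<Longrightarrow> (s z)\<^sup>2 = q z" "s a \<noteq> 0"
    by (rule cdiff_sqrt[OF W q q0]) blast+
  define N where "N = W' \<inter> F1 -` ball 0 r"
  have F1': "cdiff F1 z" if "z \<in> W'" for z using F1 W'(3) that by blast
  have N: "open N" unfolding N_def
    by (rule continuous_open_preimage[OF cdiff_continuous_on[OF F1'] W'(1) open_ball])
  have aN: "a \<in> N" using W'(2) z \<delta>(1) by (simp add: N_def)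
  define h where "h = (\<lambda>z. J z * s z)"
  define k where "k = (\<lambda>z. F2 z - \<delta> (F1 z))"
  have NW: "z \<in> W" "z \<in> W'" if "z \<in> N" for z using that W'(3) by (auto simp: N_def)
  have h: "cdiff h z" if "z \<in> N" for z
    unfolding h_def by (rule cdiff_mult(1)[OF J[OF NW(1)[OF that]] W'(4)[OF NW(2)[OF that]]])
  have dF: "cdiff (\<lambda>z. \<delta> (F1 z)) z" if "z \<in> N" for z
  proof -
    have "F1 z \<in> ball 0 r" using that by (simp add: N_def)
    from cdiff_compose(1)[OF F1[OF NW(1)[OF that]] \<delta>(2)[OF this]] show ?thesis .
  qed
  have k: "cdiff k z" if "z \<in> N" for z
    unfolding k_def by (rule cdiff_diff(1)[OF F2[OF NW(1)[OF that]] dF[OF that]])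
  have dh: "cder h a v = cder J a v * s a" for v
    unfolding h_def using cdiff_mult(2)[OF J[OF W(2)] W'(4)[OF W'(2)], of v] z by simp
  have d0: "cdiff \<delta> (F1 a)" using \<delta> z by simp
  have d0v: "cder \<delta> 0 v = 0" for v
    using cdiffD(2)[of \<delta> 0 v 1] \<delta> by simp
  have dk: "cder k a v = cder F2 a v" for v
    unfolding k_def using cdiff_diff(2)[OF F2[OF W(2)] dF[OF aN], of v]
      cdiff_compose(2)[OF F1[OF W(2)] d0, of v] z d0v by simp
  have "jac h k a = s a * jac J F2 a"
    by (simp add: jac_cder h k aN J F2 W(2) dh dk algebra_simps)
  then have jn: "jac h k a \<noteq> 0" using j W'(6) by simp
  have jn': "jac k h a \<noteq> 0" using jn jac_swap[of k h a] by simp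
  have ha: "h a = 0" "k a = 0" using z \<delta>(3) by (simp_all add: h_def k_def)
  show ?thesis
  proof (rule that[of s])
    show "\<forall>\<^sub>F z in nhds a. (s z)\<^sup>2 = q z"
      unfolding eventually_nhds using W' by blast
    show "biholo_germ (\<lambda>z. (J z * s z, F2 z - \<delta> (F1 z))) a 0"
      using biholo_germI[OF N aN h k jn] unfolding ha by (simp only: h_def k_def zero_prod_def)
    show "biholo_germ (\<lambda>z. (F2 z - \<delta> (F1 z), J z * s z)) a 0"
      using biholo_germI[OF N aN k h jn'] unfolding ha by (simp only: h_def k_def zero_prod_def)
  qed
qed

text \<open>The columns of the determinant are dF(a) and dF(b) applied to (- J_y, J_x).\<close>

definition fold_det :: "(c2 \<Rightarrow> complex) \<Rightarrow> (c2 \<Rightarrow> complex) \<Rightarrow> c2 \<Rightarrow> c2 \<Rightarrow> complex" where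
  "fold_det f g a b = jac (jac f g) f a * jac (jac f g) g b - jac (jac f g) g a * jac (jac f g) f b"

lemma fold_det_swap: "fold_det f g b a = - fold_det f g a b"
  by (simp add: fold_det_def)

section \<open>The determinant criterion for two transversal folds\<close>

lemma jac_lin:
  assumes "cdiff h z" "cdiff f z" "cdiff g z"
  shows "jac h (\<lambda>z. A * (g z - c) - B * (f z - d)) z = A * jac h g z - B * jac h f z"
    "jac (\<lambda>z. A * (g z - c) - B * (f z - d)) h z = A * jac g h z - B * jac f h z"
    "cdiff (\<lambda>z. A * (g z - c) - B * (f z - d)) z"
proof -
  have "cder (\<lambda>z. A * (g z - c)) z v = A * cder g z v" "cdiff (\<lambda>z. A * (g z - c)) z" for v
    using cdiff_mult[OF cdiff_const[of A z] cdiff_diff(1)[OF assms(3) cdiff_const[of c z]]]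
    by (simp_all add: cder_const cdiff_diff(2)[OF assms(3) cdiff_const])
  moreover have "cder (\<lambda>z. B * (f z - d)) z v = B * cder f z v" "cdiff (\<lambda>z. B * (f z - d)) z" for v
    using cdiff_mult[OF cdiff_const[of B z] cdiff_diff(1)[OF assms(2) cdiff_const[of d z]]]
    by (simp_all add: cder_const cdiff_diff(2)[OF assms(2) cdiff_const])
  ultimately have d: "cder (\<lambda>z. A * (g z - c) - B * (f z - d)) z v = A * cder g z v - B * cder f z v"
    and c: "cdiff (\<lambda>z. A * (g z - c) - B * (f z - d)) z" for v
    using cdiff_diff[of "\<lambda>z. A * (g z - c)" z "\<lambda>z. B * (f z - d)"] by simp_all
  show "cdiff (\<lambda>z. A * (g z - c) - B * (f z - d)) z" by (rule c)
  show "jac h (\<lambda>z. A * (g z - c) - B * (f z - d)) z = A * jac h g z - B * jac h f z"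
    unfolding jac_cder[OF assms(1) c] jac_cder[OF assms(1,3)] jac_cder[OF assms(1,2)] d by (simp add: algebra_simps)
  show "jac (\<lambda>z. A * (g z - c) - B * (f z - d)) h z = A * jac g h z - B * jac f h z"
    unfolding jac_cder[OF c assms(1)] jac_cder[OF assms(3,1)] jac_cder[OF assms(2,1)] d by (simp add: algebra_simps)
qed

text \<open>F1 and F2 are linear forms in F - c that kill e_a and e_b respectively. The normal form
  gives F1 = \<gamma>a(F2) + J^2 qa near a and, with the roles exchanged, F2 = \<gamma>b(F1) + J^2
  qb near b. The single target chart (F1 - \<gamma>a(F2), F2 - \<gamma>b(F1)) then squares its first
  coordinate at a and its second at b.\<close>

lemma fold_det_imp_bigerm_folds:
  assumes f: "\<And>z. cdiff f z" and g: "\<And>z. cdiff g z"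
    and J: "jac f g a = 0" "jac f g b = 0" and F: "pmap f g a = pmap f g b"
    and \<Delta>: "fold_det f g a b \<noteq> 0"
  shows "bigerm_folds (pmap f g) a b"
proof -
  define J where "J = jac f g"
  have Jc: "cdiff J z" for z unfolding J_def by (rule cdiff_jac[of UNIV]) (auto simp: f g)
  define A1 A2 B1 B2 where "A1 = jac J f a" and "A2 = jac J g a" and "B1 = jac J f b" and "B2 = jac J g b"
  have D: "A1 * B2 - A2 * B1 \<noteq> 0" using \<Delta> by (simp add: fold_det_def A1_def A2_def B1_def B2_def J_def)
  define c1 c2 where "c1 = f a" and "c2 = g a"
  have cb: "f b = c1" "g b = c2" using F by (simp_all add: pmap_def c1_def c2_def)
  define F1 where "F1 = (\<lambda>z. A1 * (g z - c2) - A2 * (f z - c1))"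
  define F2 where "F2 = (\<lambda>z. B1 * (g z - c2) - B2 * (f z - c1))"
  have F1c: "cdiff F1 z" and F2c: "cdiff F2 z" for z
    unfolding F1_def F2_def by (rule jac_lin(3)[OF Jc f g])+
  have jJ1: "jac J F1 z = A1 * jac J g z - A2 * jac J f z" and jJ2: "jac J F2 z = B1 * jac J g z - B2 * jac J f z" for z
    unfolding F1_def F2_def by (rule jac_lin(1)[OF Jc f g])+
  have j12: "jac F1 F2 z = (A1 * B2 - A2 * B1) * J z" for z
  proof -
    have "jac F1 F2 z = A1 * jac g F2 z - A2 * jac f F2 z" unfolding F1_def by (rule jac_lin(2)[OF F2c f g])
    moreover have "jac g F2 z = B1 * jac g g z - B2 * jac g f z" unfolding F2_def by (rule jac_lin(1)[OF g f g])
    moreover have "jac f F2 z = B1 * jac f g z - B2 * jac f f z" unfolding F2_def by (rule jac_lin(1)[OF f f g])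
    moreover have "jac g g z = 0" "jac f f z = 0" "jac g f z = - J z" "jac f g z = J z"
      by (simp_all add: jac_def J_def)
    ultimately show ?thesis by (simp add: algebra_simps)
  qed
  have za: "F1 a = 0" "F2 a = 0" "J a = 0" and zb: "F1 b = 0" "F2 b = 0" "J b = 0"
    using J cb by (simp_all add: F1_def F2_def c1_def c2_def J_def)
  \<comment> \<open>By the choice of coefficients, jac J F1 at a is A1 A2 - A2 A1 = 0, and likewise
    for F2 at b. The two other values are the determinant up to sign.\<close>
  have ja: "jac J F2 a \<noteq> 0" "jac J F1 a = 0" and jb: "jac J F1 b \<noteq> 0" "jac J F2 b = 0"
    using D by (auto simp: jJ1 jJ2 A1_def[symmetric] A2_def[symmetric] B1_def[symmetric] B2_def[symmetric] algebra_simps)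
  obtain Wa ra \<gamma>a qa where na: "open Wa" "a \<in> Wa" "ra > 0" "\<And>t. t \<in> ball 0 ra \<Longrightarrow> cdiff \<gamma>a t"
    "\<gamma>a 0 = 0" "cder \<gamma>a 0 1 = 0" "\<And>z. z \<in> Wa \<Longrightarrow> F2 z \<in> ball 0 ra \<and> F1 z = \<gamma>a (F2 z) + (J z)\<^sup>2 * qa z"
    "\<And>z. z \<in> Wa \<Longrightarrow> cdiff qa z" "qa a \<noteq> 0"
    by (rule fold_normal_form[OF open_UNIV UNIV_I F1c F2c Jc za j12 D ja]) blast+
  have j21: "jac F2 F1 z = - (A1 * B2 - A2 * B1) * J z" for z using j12[of z] jac_swap[of F2 F1 z] by (simp add: algebra_simps)
  have D': "- (A1 * B2 - A2 * B1) \<noteq> 0" using D by simp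
  obtain Wb rb \<gamma>b qb where nb: "open Wb" "b \<in> Wb" "rb > 0" "\<And>t. t \<in> ball 0 rb \<Longrightarrow> cdiff \<gamma>b t"
    "\<gamma>b 0 = 0" "cder \<gamma>b 0 1 = 0" "\<And>z. z \<in> Wb \<Longrightarrow> F1 z \<in> ball 0 rb \<and> F2 z = \<gamma>b (F1 z) + (J z)\<^sup>2 * qb z"
    "\<And>z. z \<in> Wb \<Longrightarrow> cdiff qb z" "qb b \<noteq> 0"
    by (rule fold_normal_form[OF open_UNIV UNIV_I F2c F1c Jc zb(2,1,3) j21 D' jb]) blast+
  obtain sa where sa: "\<forall>\<^sub>F z in nhds a. (sa z)\<^sup>2 = qa z"
    "biholo_germ (\<lambda>z. (J z * sa z, F2 z - \<gamma>b (F1 z))) a 0"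
    by (rule fold_chart[OF na(1,2) F1c F2c Jc na(8,9) za ja(1) nb(3-6)]) blast+
  obtain sb where sb: "\<forall>\<^sub>F z in nhds b. (sb z)\<^sup>2 = qb z"
    "biholo_germ (\<lambda>z. (F1 z - \<gamma>a (F2 z), J z * sb z)) b 0"
    by (rule fold_chart[OF nb(1,2) F2c F1c Jc nb(8,9) zb(2,1,3) jb(1) na(3-6)]) blast+
  define \<alpha> where "\<alpha> = (\<lambda>w::c2. A1 * (snd w - c2) - A2 * (fst w - c1))"
  define \<beta> where "\<beta> = (\<lambda>w::c2. B1 * (snd w - c2) - B2 * (fst w - c1))"
  define p1 where "p1 = (\<lambda>w. \<alpha> w - \<gamma>a (\<beta> w))"
  define p2 where "p2 = (\<lambda>w. \<beta> w - \<gamma>b (\<alpha> w))"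
  define N where "N = \<beta> -` ball 0 ra \<inter> \<alpha> -` ball 0 rb"
  have fs: "cdiff (fst :: c2 \<Rightarrow> complex) z" "cdiff (snd :: c2 \<Rightarrow> complex) z" for z
    using cdiff_fst(1)[OF cdiff_ident, of z] cdiff_snd(1)[OF cdiff_ident, of z] by simp_all
  have \<alpha>c: "cdiff \<alpha> z" and \<beta>c: "cdiff \<beta> z" for z
    unfolding \<alpha>_def \<beta>_def by (rule jac_lin(3)[OF fs(1) fs(1) fs(2)])+
  have N: "open N"
    unfolding N_def using cdiff_continuous_on[of UNIV, OF \<alpha>c] cdiff_continuous_on[of UNIV, OF \<beta>c]
    by (intro open_Int open_vimage open_ball)
  have F0: "\<alpha> (c1, c2) = 0" "\<beta> (c1, c2) = 0" by (simp_all add: \<alpha>_def \<beta>_def)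
  have cN: "(c1, c2) \<in> N" using F0 na(3) nb(3) by (simp add: N_def)
  have gad: "cdiff (\<lambda>w. \<gamma>a (\<beta> w)) w" and gbd: "cdiff (\<lambda>w. \<gamma>b (\<alpha> w)) w" if "w \<in> N" for w
  proof -
    have "\<beta> w \<in> ball 0 ra" "\<alpha> w \<in> ball 0 rb" using that by (simp_all add: N_def)
    then show "cdiff (\<lambda>w. \<gamma>a (\<beta> w)) w" "cdiff (\<lambda>w. \<gamma>b (\<alpha> w)) w"
      using cdiff_compose(1)[OF \<beta>c na(4)] cdiff_compose(1)[OF \<alpha>c nb(4)] by blast+
  qed
  have p1c: "cdiff p1 w" and p2c: "cdiff p2 w" if "w \<in> N" for w
    unfolding p1_def p2_def by (intro cdiff_diff(1) \<alpha>c \<beta>c gad gbd that)+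
  have ga0: "cdiff \<gamma>a 0" "cder \<gamma>a 0 v = 0" and gb0: "cdiff \<gamma>b 0" "cder \<gamma>b 0 v = 0" for v
    using na(3-6) nb(3-6) cdiffD(2)[of \<gamma>a 0 v 1] cdiffD(2)[of \<gamma>b 0 v 1] by simp_all
  have dp: "cder p1 (c1, c2) v = cder \<alpha> (c1, c2) v" "cder p2 (c1, c2) v = cder \<beta> (c1, c2) v" for v
    unfolding p1_def p2_def
    using cdiff_diff(2)[OF \<alpha>c gad[OF cN], of v] cdiff_diff(2)[OF \<beta>c gbd[OF cN], of v]
      cdiff_compose(2)[OF \<beta>c, of \<gamma>a "(c1, c2)" v] cdiff_compose(2)[OF \<alpha>c, of \<gamma>b "(c1, c2)" v] F0 ga0 gb0
    by simp_all
  \<comment> \<open>As \<gamma>a and \<gamma>b have derivative 0 at 0, the chart has the same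
    differential at c as the affine map (\<alpha>, \<beta>), whose determinant is nonzero.\<close>
  have "jac p1 p2 (c1, c2) = jac \<alpha> \<beta> (c1, c2)" by (simp add: jac_cder p1c p2c cN \<alpha>c \<beta>c dp)
  also have "\<dots> = A1 * B2 - A2 * B1"
  proof -
    have "jac \<alpha> \<beta> w = A1 * jac snd \<beta> w - A2 * jac fst \<beta> w" for w
      unfolding \<alpha>_def by (rule jac_lin(2)[OF \<beta>c fs])
    moreover have "jac snd \<beta> w = B1 * jac snd snd w - B2 * jac snd fst w" "jac fst \<beta> w = B1 * jac fst snd w - B2 * jac fst fst w" for w
      unfolding \<beta>_def by (rule jac_lin(1)[OF _ fs]; rule fs)+
    moreover have "jac snd snd w = 0" "jac fst fst w = 0" "jac fst snd w = 1" "jac snd fst w = - 1" for w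
      by (simp_all add: jac_def pdx_def pdy_def)
    ultimately show ?thesis by (simp add: algebra_simps)
  qed
  finally have jp: "jac p1 p2 (c1, c2) \<noteq> 0" using D by simp
  have p0: "p1 (c1, c2) = 0" "p2 (c1, c2) = 0" using F0 na(5) nb(5) by (simp_all add: p1_def p2_def)
  have bp: "biholo_germ (\<lambda>w. (p1 w, p2 w)) (pmap f g a) 0"
    using biholo_germI[OF N cN p1c p2c jp] p0 by (simp add: pmap_def c1_def c2_def zero_prod_def)
  have pF: "p1 (pmap f g z) = F1 z - \<gamma>a (F2 z)" "p2 (pmap f g z) = F2 z - \<gamma>b (F1 z)" for z
    by (simp_all add: p1_def p2_def pmap_def \<alpha>_def \<beta>_def F1_def F2_def)
  have ea: "\<forall>\<^sub>F x in nhds a. (p1 (pmap f g x), p2 (pmap f g x)) = fold1 (J x * sa x, F2 x - \<gamma>b (F1 x))"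
  proof -
    have "\<forall>\<^sub>F x in nhds a. x \<in> Wa" using na(1,2) eventually_nhds by blast
    then show ?thesis using sa(1)
      by eventually_elim (use na(7) in \<open>simp add: pF fold1_def power_mult_distrib\<close>)
  qed
  have eb: "\<forall>\<^sub>F x in nhds b. (p1 (pmap f g x), p2 (pmap f g x)) = fold2 (F1 x - \<gamma>a (F2 x), J x * sb x)"
  proof -
    have "\<forall>\<^sub>F x in nhds b. x \<in> Wb" using nb(1,2) eventually_nhds by blast
    then show ?thesis using sb(1)
      by eventually_elim (use nb(7) in \<open>simp add: pF fold2_def power_mult_distrib\<close>)
  qed
  show ?thesis
    unfolding bigerm_folds_def using sa(2) sb(2) bp ea eb by blast
qed

text \<open>In fold coordinates J is X times a unit, so at a the differential of J is proportional
  to that of X, and e_a is a nonzero multiple of dF(a) (- X_y, X_x). The differential of P1 kills it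
  because P1(F) = X^2 is critical at a; that of P2 takes dF(a) (- X_y, X_x) to jac X Y, which is
  nonzero.\<close>

lemma fold_image_tangent:
  assumes f: "\<And>z. cdiff f z" and g: "\<And>z. cdiff g z"
    and U: "open U" "a \<in> U" and X: "\<And>z. z \<in> U \<Longrightarrow> cdiff X z" and Y: "\<And>z. z \<in> U \<Longrightarrow> cdiff Y z"
    and X0: "X a = 0" and jXY: "jac X Y a \<noteq> 0"
    and V: "open V" "(f a, g a) \<in> V" and P1: "\<And>w. w \<in> V \<Longrightarrow> cdiff P1 w" and P2: "\<And>w. w \<in> V \<Longrightarrow> cdiff P2 w"
    and jP: "jac P1 P2 (f a, g a) \<noteq> 0"
    and ev: "\<forall>\<^sub>F x in nhds a. P1 (f x, g x) = (X x)\<^sup>2 \<and> P2 (f x, g x) = Y x"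
  shows "pdx P1 (f a, g a) * jac (jac f g) f a + pdy P1 (f a, g a) * jac (jac f g) g a = 0"
    "pdx P2 (f a, g a) * jac (jac f g) f a + pdy P2 (f a, g a) * jac (jac f g) g a \<noteq> 0"
proof -
  define J where "J = jac f g"
  define \<phi> where "\<phi> = (\<lambda>z. (f z, g z))"
  have \<phi>c: "cdiff \<phi> z" for z unfolding \<phi>_def by (intro cdiff_Pair(1) f g)
  obtain S where S: "open S" "a \<in> S" "\<And>x. x \<in> S \<Longrightarrow> P1 (f x, g x) = (X x)\<^sup>2 \<and> P2 (f x, g x) = Y x"
    using ev unfolding eventually_nhds by blast
  have jPc: "cdiff (jac P1 P2) w" if "w \<in> V" for w by (rule cdiff_jac[OF V(1) that P1 P2])
  define N0 where "N0 = (S \<inter> U) \<inter> \<phi> -` V"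
  have N0: "open N0" unfolding N0_def
    using cdiff_continuous_on[of UNIV, OF \<phi>c] by (intro open_Int S U open_vimage V) 
  have jPp: "cdiff (\<lambda>z. jac P1 P2 (\<phi> z)) z" if "z \<in> N0" for z
  proof -
    have "\<phi> z \<in> V" using that by (simp add: N0_def)
    from cdiff_compose(1)[OF \<phi>c jPc[OF this]] show ?thesis .
  qed
  define N where "N = N0 \<inter> (\<lambda>z. jac P1 P2 (\<phi> z)) -` (- {0})"
  have N: "open N" unfolding N_def
    by (rule continuous_open_preimage[OF cdiff_continuous_on[OF jPp] N0]) auto
  have aN: "a \<in> N" using S U V jP by (simp add: N_def N0_def \<phi>_def)
  have ND: "z \<in> S" "z \<in> U" "(f z, g z) \<in> V" "jac P1 P2 (f z, g z) \<noteq> 0" "z \<in> N0" if "z \<in> N" for z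
    using that by (auto simp: N_def N0_def \<phi>_def)
  have d1: "pdx P1 (f z, g z) * cder f z v + pdy P1 (f z, g z) * cder g z v = 2 * X z * cder X z v"
    and d2: "pdx P2 (f z, g z) * cder f z v + pdy P2 (f z, g z) * cder g z v = cder Y z v" if z: "z \<in> N" for z v
  proof -
    note ch1 = jac_chain_partials[OF P1[OF ND(3)[OF z]] f g] and ch2 = jac_chain_partials[OF P2[OF ND(3)[OF z]] f g]
    have "cder (\<lambda>z. X z * X z) z = cder (\<lambda>z. P1 (f z, g z)) z"
      by (rule cdiff_transform(2)[OF ch1(1) N z]) (use S(3) ND(1) in \<open>auto simp: power2_eq_square\<close>)
    moreover have "cder (\<lambda>z. X z * X z) z v = 2 * X z * cder X z v"
      using cdiff_mult(2)[OF X X, of z v] ND(2)[OF z] by simp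
    ultimately show "pdx P1 (f z, g z) * cder f z v + pdy P1 (f z, g z) * cder g z v = 2 * X z * cder X z v"
      using ch1(2)[of v] by simp
    have "cder Y z = cder (\<lambda>z. P2 (f z, g z)) z"
      by (rule cdiff_transform(2)[OF ch2(1) N z]) (use S(3) ND(1) in auto)
    then show "pdx P2 (f z, g z) * cder f z v + pdy P2 (f z, g z) * cder g z v = cder Y z v"
      using ch2(2)[of v] by simp
  qed
  \<comment> \<open>Multiplicativity of Jacobians: jac P1 P2 times J is the Jacobian of (X^2, Y),
    that is, 2 X jac X Y.\<close>
  have JX: "J z = X z * (2 * jac X Y z / jac P1 P2 (\<phi> z))" if z: "z \<in> N" for z
  proof -
    have "jac P1 P2 (f z, g z) * J z = 2 * X z * jac X Y z"
    proof -
      have "jac P1 P2 (f z, g z) * J z =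
        (pdx P1 (f z, g z) * cder f z (1, 0) + pdy P1 (f z, g z) * cder g z (1, 0)) *
        (pdx P2 (f z, g z) * cder f z (0, 1) + pdy P2 (f z, g z) * cder g z (0, 1)) -
        (pdx P1 (f z, g z) * cder f z (0, 1) + pdy P1 (f z, g z) * cder g z (0, 1)) *
        (pdx P2 (f z, g z) * cder f z (1, 0) + pdy P2 (f z, g z) * cder g z (1, 0))"
        by (simp add: J_def jac_cder[OF f g] jac_def[of P1 P2] algebra_simps)
      also have "\<dots> = 2 * X z * jac X Y z"
        unfolding d1[OF z] d2[OF z] using X[OF ND(2)[OF z]] Y[OF ND(2)[OF z]]
        by (simp add: jac_cder algebra_simps)
      finally show ?thesis .
    qed
    then show ?thesis using ND(4)[OF z] by (simp add: \<phi>_def field_simps)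
  qed
  define \<kappa> where "\<kappa> = (\<lambda>z. 2 * jac X Y z / jac P1 P2 (\<phi> z))"
  have \<kappa>c: "cdiff \<kappa> a" unfolding \<kappa>_def
    using cdiff_divide[OF cdiff_mult(1)[OF cdiff_const[of 2 a] cdiff_jac[OF U X Y]] jPp[OF ND(5)[OF aN]]] jP
    by (simp add: \<phi>_def)
  have \<kappa>0: "\<kappa> a \<noteq> 0" using jXY jP by (simp add: \<kappa>_def \<phi>_def)
  have Xa: "cdiff X a" and Ya: "cdiff Y a" using X Y U by blast+
  have Jc: "cdiff J a" and Jd: "cder J a v = \<kappa> a * cder X a v" for v
  proof -
    note m = cdiff_mult[OF Xa \<kappa>c]
    note t = cdiff_transform[OF m(1) N aN, of J]
    show "cdiff J a" by (rule t(1)) (simp add: JX \<kappa>_def)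
    have "cder J a = cder (\<lambda>z. X z * \<kappa> z) a" by (rule t(2)) (simp add: JX \<kappa>_def)
    then show "cder J a v = \<kappa> a * cder X a v" using m(2)[of v] X0 by simp
  qed
  have jj: "jac J h a = \<kappa> a * jac X h a" if "cdiff h a" for h
    by (simp add: jac_cder Jc Xa that Jd algebra_simps)
  have comb: "p * jac X f a + q * jac X g a =
      cder X a (1, 0) * (p * cder f a (0, 1) + q * cder g a (0, 1)) - cder X a (0, 1) * (p * cder f a (1, 0) + q * cder g a (1, 0))" for p q
    by (simp add: jac_cder Xa f g algebra_simps)
  have "pdx P1 (f a, g a) * jac X f a + pdy P1 (f a, g a) * jac X g a = 0"
    unfolding comb d1[OF aN] X0 by simp
  then show "pdx P1 (f a, g a) * jac (jac f g) f a + pdy P1 (f a, g a) * jac (jac f g) g a = 0"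
    using jj[OF f] jj[OF g] unfolding J_def[symmetric] by (simp add: mult.left_commute[of _ "\<kappa> a"] distrib_left[symmetric])
  have "pdx P2 (f a, g a) * jac X f a + pdy P2 (f a, g a) * jac X g a = jac X Y a"
    unfolding comb d2[OF aN] by (simp add: jac_cder Xa Ya)
  then have "\<kappa> a * (pdx P2 (f a, g a) * jac X f a + pdy P2 (f a, g a) * jac X g a) \<noteq> 0" using jXY \<kappa>0 by simp
  then show "pdx P2 (f a, g a) * jac (jac f g) f a + pdy P2 (f a, g a) * jac (jac f g) g a \<noteq> 0"
    using jj[OF f] jj[OF g] unfolding J_def[symmetric] by (simp add: algebra_simps)
qed

text \<open>The differential of \<psi> takes e_a to a nonzero vector of the second axis and e_b to a
  nonzero vector of the first. The images are independent, hence so are e_a and e_b.\<close>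

lemma bigerm_folds_imp_fold_det:
  assumes f: "\<And>z. cdiff f z" and g: "\<And>z. cdiff g z" and F: "pmap f g a = pmap f g b"
    and bf: "bigerm_folds (pmap f g) a b"
  shows "fold_det f g a b \<noteq> 0"
proof -
  obtain \<phi>a \<phi>b \<psi> where b: "biholo_germ \<phi>a a 0" "biholo_germ \<phi>b b 0" "biholo_germ \<psi> (pmap f g a) 0"
    "\<forall>\<^sub>F x in nhds a. \<psi> (pmap f g x) = fold1 (\<phi>a x)" "\<forall>\<^sub>F x in nhds b. \<psi> (pmap f g x) = fold2 (\<phi>b x)"
    using bf unfolding bigerm_folds_def by blast
  define X where "X = (\<lambda>z. fst (\<phi>a z))" define Y where "Y = (\<lambda>z. snd (\<phi>a z))"
  define X' where "X' = (\<lambda>z. fst (\<phi>b z))" define Y' where "Y' = (\<lambda>z. snd (\<phi>b z))"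
  define P1 where "P1 = (\<lambda>z. fst (\<psi> z))" define P2 where "P2 = (\<lambda>z. snd (\<psi> z))"
  obtain Ua where Ua: "open Ua" "a \<in> Ua" "\<And>z. z \<in> Ua \<Longrightarrow> cdiff X z" "\<And>z. z \<in> Ua \<Longrightarrow> cdiff Y z"
    "jac X Y a \<noteq> 0" "\<phi>a a = 0" unfolding X_def Y_def by (rule biholo_germD[OF b(1)]) blast+
  obtain Ub where Ub: "open Ub" "b \<in> Ub" "\<And>z. z \<in> Ub \<Longrightarrow> cdiff X' z" "\<And>z. z \<in> Ub \<Longrightarrow> cdiff Y' z"
    "jac X' Y' b \<noteq> 0" "\<phi>b b = 0" unfolding X'_def Y'_def by (rule biholo_germD[OF b(2)]) blast+
  obtain V where V: "open V" "pmap f g a \<in> V" "\<And>z. z \<in> V \<Longrightarrow> cdiff P1 z" "\<And>z. z \<in> V \<Longrightarrow> cdiff P2 z"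
    "jac P1 P2 (pmap f g a) \<noteq> 0" unfolding P1_def P2_def by (rule biholo_germD[OF b(3)]) blast+
  define c where "c = pmap f g a"
  have ca: "(f a, g a) = c" and cb: "(f b, g b) = c" using F by (simp_all add: c_def pmap_def)
  have ev1: "\<forall>\<^sub>F x in nhds a. P1 (f x, g x) = (X x)\<^sup>2 \<and> P2 (f x, g x) = Y x"
    using b(4) by eventually_elim (simp add: P1_def P2_def X_def Y_def fold1_def pmap_def)
  have ev2: "\<forall>\<^sub>F x in nhds b. P2 (f x, g x) = (Y' x)\<^sup>2 \<and> P1 (f x, g x) = X' x"
    using b(5) by eventually_elim (simp add: P1_def P2_def X'_def Y'_def fold2_def pmap_def)
  have z: "X a = 0" "Y' b = 0" using Ua(6) Ub(6) by (simp_all add: X_def Y'_def)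
  have jY: "jac Y' X' b \<noteq> 0" using Ub(5) jac_swap[of Y' X' b] by simp
  have jP: "jac P1 P2 c \<noteq> 0" "jac P2 P1 c \<noteq> 0" using V(5) jac_swap[of P2 P1 c] by (simp_all add: c_def)
  have Vc: "c \<in> V" using V(2) by (simp add: c_def)
  have t1: "pdx P1 c * jac (jac f g) f a + pdy P1 c * jac (jac f g) g a = 0"
    "pdx P2 c * jac (jac f g) f a + pdy P2 c * jac (jac f g) g a \<noteq> 0"
    by (rule fold_image_tangent[of f g Ua a X Y V P1 P2, unfolded ca]; use f g Ua V z Vc jP ev1 in simp)+
  have t2: "pdx P2 c * jac (jac f g) f b + pdy P2 c * jac (jac f g) g b = 0"
    "pdx P1 c * jac (jac f g) f b + pdy P1 c * jac (jac f g) g b \<noteq> 0"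
    by (rule fold_image_tangent[of f g Ub b Y' X' V P2 P1, unfolded cb]; use f g Ub V z jY Vc jP ev2 in simp)+
  define A1 A2 B1 B2 where "A1 = jac (jac f g) f a" and "A2 = jac (jac f g) g a"
    and "B1 = jac (jac f g) f b" and "B2 = jac (jac f g) g b"
  note defs = A1_def[symmetric] A2_def[symmetric] B1_def[symmetric] B2_def[symmetric]
  have "jac P1 P2 c * (A1 * B2 - A2 * B1) =
      (pdx P1 c * A1 + pdy P1 c * A2) * (pdx P2 c * B1 + pdy P2 c * B2) - (pdx P1 c * B1 + pdy P1 c * B2) * (pdx P2 c * A1 + pdy P2 c * A2)"
    by (simp add: jac_def algebra_simps)
  then have "jac P1 P2 c * (A1 * B2 - A2 * B1) \<noteq> 0" using t1 t2 unfolding defs by simp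
  then show ?thesis by (simp add: fold_det_def defs)
qed

section \<open>Local algebras in dimension four\<close>


lemma c4_expand:
  "(z :: c4) = fst (fst z) *\<^sub>C ((1, 0), 0) + (snd (fst z) *\<^sub>C ((0, 1), 0) +
     (fst (snd z) *\<^sub>C (0, (1, 0)) + snd (snd z) *\<^sub>C (0, (0, 1))))"
  by (simp add: prod_eq_iff zero_prod_def)

lemma cder_c4:
  fixes h :: "c4 \<Rightarrow> complex"
  assumes c: "cdiff h z"
  shows "cder h z v = cder h z ((1, 0), 0) * fst (fst v) + cder h z ((0, 1), 0) * snd (fst v)
     + cder h z (0, (1, 0)) * fst (snd v) + cder h z (0, (0, 1)) * snd (snd v)"
proof -
  have "cder h z v = cder h z (fst (fst v) *\<^sub>C ((1, 0), 0) + (snd (fst v) *\<^sub>C ((0, 1), 0) +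
     (fst (snd v) *\<^sub>C (0, (1, 0)) + snd (snd v) *\<^sub>C (0, (0, 1)))))"
    using c4_expand[of v] by simp
  also have "\<dots> = fst (fst v) * cder h z ((1, 0), 0) + (snd (fst v) * cder h z ((0, 1), 0)
     + (fst (snd v) * cder h z (0, (1, 0)) + snd (snd v) * cder h z (0, (0, 1))))"
    by (simp only: linear_add[OF cdiff_linear[OF c]] cdiffD(2)[OF c] scaleC_complex_def)
  finally show ?thesis by (simp add: mult.commute add.assoc)
qed

lemma hol4_iff_cdiff: "hol4 U h \<longleftrightarrow> open U \<and> (\<forall>z\<in>U. cdiff h z)"
proof -
  have "(\<exists>A1 A2 B1 B2. (h has_derivative (\<lambda>((u1, u2), (v1, v2)). A1 * u1 + A2 * u2 + B1 * v1 + B2 * v2)) (at z))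
      \<longleftrightarrow> cdiff h z" for z
  proof
    assume "\<exists>A1 A2 B1 B2. (h has_derivative (\<lambda>((u1, u2), (v1, v2)). A1 * u1 + A2 * u2 + B1 * v1 + B2 * v2)) (at z)"
    then obtain A1 A2 B1 B2
      where d: "(h has_derivative (\<lambda>((u1, u2), (v1, v2)). A1 * u1 + A2 * u2 + B1 * v1 + B2 * v2)) (at z)" by blast
    show "cdiff h z" by (rule cdiffI[OF d]) (auto simp: case_prod_unfold algebra_simps)
  next
    assume c: "cdiff h z"
    have eq: "cder h z = (\<lambda>((u1, u2), (v1, v2)). cder h z ((1, 0), 0) * u1 + cder h z ((0, 1), 0) * u2
        + cder h z (0, (1, 0)) * v1 + cder h z (0, (0, 1)) * v2)"
      by (rule ext) (unfold case_prod_unfold, rule cder_c4[OF c])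
    show "\<exists>A1 A2 B1 B2. (h has_derivative (\<lambda>((u1, u2), (v1, v2)). A1 * u1 + A2 * u2 + B1 * v1 + B2 * v2)) (at z)"
      using cdiffD(1)[OF c] by (subst (asm) eq) blast
  qed
  then show ?thesis unfolding hol4_def by blast
qed

lemma hol4_at_iff: "hol4_at p h \<longleftrightarrow> (\<exists>U. p \<in> U \<and> open U \<and> (\<forall>z\<in>U. cdiff h z))"
  unfolding hol4_at_def hol4_iff_cdiff by blast

lemma hol4_atI: "(\<And>z. cdiff h z) \<Longrightarrow> hol4_at p h"
  unfolding hol4_at_iff by (intro exI[of _ UNIV]) simp

lemma hol4_at_mult: "hol4_at p h \<Longrightarrow> hol4_at p k \<Longrightarrow> hol4_at p (\<lambda>w. h w * k w)"
  unfolding hol4_at_iff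
proof (elim exE conjE)
  fix U V assume *: "p \<in> U" "open U" "\<forall>z\<in>U. cdiff h z" "p \<in> V" "open V" "\<forall>z\<in>V. cdiff k z"
  then show "\<exists>U. p \<in> U \<and> open U \<and> (\<forall>z\<in>U. cdiff (\<lambda>w. h w * k w) z)"
    by (intro exI[of _ "U \<inter> V"]) (simp add: open_Int cdiff_mult(1))
qed

definition spans_mod :: "c4 \<Rightarrow> (c4 \<Rightarrow> complex) list \<Rightarrow> (c4 \<Rightarrow> complex) list \<Rightarrow> bool" where
  "spans_mod p gs \<phi>s \<longleftrightarrow> (\<forall>k<length \<phi>s. hol4_at p (\<phi>s ! k)) \<and>
     (\<forall>h. hol4_at p h \<longrightarrow> (\<exists>cs. in_ideal p gs (\<lambda>w. h w - (\<Sum>k<length \<phi>s. cs k * (\<phi>s ! k) w))))"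

lemma in_ideal_at_zero:
  assumes "in_ideal p gs h" "\<And>g. g \<in> set gs \<Longrightarrow> g p = 0"
  shows "h p = 0"
  using assms unfolding in_ideal_def by (auto intro!: sum.neutral)

text \<open>The empty family never spans, because 1 is not in an ideal whose generators vanish at p;
  so the least size is 1 as soon as a single germ spans. Conversely, \<open>fin\<close> makes the
  \<open>LEAST\<close> a value that is attained.\<close>

lemma local_dim_eq_1_iff:
  assumes z: "\<And>g. g \<in> set gs \<Longrightarrow> g p = 0" and fin: "\<exists>\<phi>s. spans_mod p gs \<phi>s"
  shows "local_dim p gs = 1 \<longleftrightarrow> (\<exists>\<phi>. spans_mod p gs [\<phi>])"
proof -
  define P where "P = (\<lambda>n. \<exists>\<phi>s. length \<phi>s = n \<and> spans_mod p gs \<phi>s)"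
  have dim: "local_dim p gs = (LEAST n. P n)"
    unfolding local_dim_def P_def spans_mod_def
    by (rule arg_cong[where f = Least], rule ext, rule arg_cong[where f = Ex], rule ext) auto
  have P0: "\<not> P 0"
  proof
    assume "P 0"
    then have "spans_mod p gs []" by (simp add: P_def)
    then have "in_ideal p gs (\<lambda>w. 1)" unfolding spans_mod_def using hol4_atI[of "\<lambda>_. 1" p] by fastforce
    then show False using in_ideal_at_zero[OF _ z] by fastforce
  qed
  have "\<exists>n. P n" using fin by (auto simp: P_def)
  then have "P (LEAST n. P n)" by (rule LeastI_ex)
  moreover have "(LEAST n. P n) \<le> 1" if "P 1" using that by (rule Least_le)
  ultimately have "(LEAST n. P n) = 1 \<longleftrightarrow> P 1" using P0 by (metis One_nat_def Suc_leI gr0I le_antisym)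
  moreover have "P 1 \<longleftrightarrow> (\<exists>\<phi>. spans_mod p gs [\<phi>])"
    unfolding P_def by (metis One_nat_def length_0_conv length_Cons length_Suc_conv)
  ultimately show ?thesis using dim by simp
qed

lemma cder_sum:
  fixes f :: "'i \<Rightarrow> 'a::cspace \<Rightarrow> complex"
  assumes "\<And>i. i \<in> A \<Longrightarrow> cdiff (f i) z"
  shows "cder (\<lambda>x. \<Sum>i\<in>A. f i x) z v = (\<Sum>i\<in>A. cder (f i) z v)"
  using assms
proof (induction A rule: infinite_finite_induct)
  case (insert i A)
  have "cdiff (\<lambda>x. \<Sum>i\<in>A. f i x) z" by (rule cdiff_sum) (simp add: insert.prems)
  then show ?case using cdiff_add(2)[of "f i" z "\<lambda>x. \<Sum>i\<in>A. f i x" v] insert by simp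
qed (simp_all add: cder_const)

text \<open>Both terms of the product rule vanish at p: one contains the generator, the other its
  derivative along v.\<close>

lemma in_ideal_kernel:
  assumes I: "in_ideal p gs h" and gs: "\<And>g. g \<in> set gs \<Longrightarrow> g p = 0 \<and> cdiff g p \<and> cder g p v = 0"
  shows "cder h p v = 0"
proof -
  obtain U hs where U: "p \<in> U" "open U" "\<And>k. k < length gs \<Longrightarrow> cdiff (hs ! k) p"
    "\<And>w. w \<in> U \<Longrightarrow> h w = (\<Sum>k<length gs. (hs ! k) w * (gs ! k) w)"
    using I unfolding in_ideal_def hol4_iff_cdiff by blast
  have k: "cdiff (\<lambda>w. (hs ! k) w * (gs ! k) w) p" "cder (\<lambda>w. (hs ! k) w * (gs ! k) w) p v = 0"
    if "k < length gs" for k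
    using cdiff_mult[OF U(3)[OF that], of "gs ! k"] gs[of "gs ! k"] that by simp_all
  have "cdiff (\<lambda>w. \<Sum>k<length gs. (hs ! k) w * (gs ! k) w) p" by (rule cdiff_sum) (simp add: k)
  from cdiff_transform(2)[OF this U(2,1), of h]
  have "cder h p = cder (\<lambda>w. \<Sum>k<length gs. (hs ! k) w * (gs ! k) w) p" using U(4) by simp
  then show ?thesis using cder_sum[of "{..<length gs}" "\<lambda>k w. (hs ! k) w * (gs ! k) w" p v] k by simp
qed

text \<open>A vector v killed by the differentials of all generators makes h -> (h(p), dh(p) v) well
  defined on the quotient. For nonzero v its image contains (1, 0), from the constant 1, and (0,
  t(v)), from a coordinate t with t(v) nonzero, so one germ cannot span.\<close>

lemma spans_mod_singleton_kernel:
  assumes sp: "spans_mod p gs [\<phi>]" and gs: "\<And>g. g \<in> set gs \<Longrightarrow> g p = 0 \<and> cdiff g p \<and> cder g p v = 0"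
  shows "v = 0"
proof (rule ccontr)
  assume "v \<noteq> 0"
  then obtain t where t: "t \<in> coords4" "t v \<noteq> t 0" using coords4_separate[of v 0] by blast
  have tl: "bounded_linear t" using t(1)
    by (auto simp: coords4_def intro!: bounded_linear_fst_comp bounded_linear_snd_comp bounded_linear_fst bounded_linear_snd)
  have tC: "t (c *\<^sub>C x) = c * t x" for c x using t(1) by (auto simp: coords4_def)
  have tc: "cdiff t z" "cder t z = t" for z
    using cdiffI[OF bounded_linear_imp_has_derivative[OF tl]] tC cder_eq[OF bounded_linear_imp_has_derivative[OF tl]]
    by auto
  have tv: "t v \<noteq> 0" using t(2) linear_0[OF bounded_linear.linear[OF tl]] by simp
  obtain U where "p \<in> U" "\<forall>z\<in>U. cdiff \<phi> z" using sp unfolding spans_mod_def hol4_at_iff by auto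
  then have \<phi>: "cdiff \<phi> p" by blast
  have ex: "\<exists>c. h p = c * \<phi> p \<and> cder h p v = c * cder \<phi> p v" if h: "\<And>z. cdiff h z" for h
  proof -
    obtain cs where "in_ideal p gs (\<lambda>w. h w - (\<Sum>k<length [\<phi>]. cs k * ([\<phi>] ! k) w))"
      using sp hol4_atI[OF h] unfolding spans_mod_def by blast
    then have I: "in_ideal p gs (\<lambda>w. h w - cs 0 * \<phi> w)" by simp
    have "h p - cs 0 * \<phi> p = 0" using in_ideal_at_zero[OF I] gs by blast
    moreover have "cder (\<lambda>w. h w - cs 0 * \<phi> w) p v = 0" by (rule in_ideal_kernel[OF I gs])
    moreover have "cder (\<lambda>w. h w - cs 0 * \<phi> w) p v = cder h p v - cs 0 * cder \<phi> p v"
      using cdiff_diff(2)[OF h cdiff_mult(1)[OF cdiff_const \<phi>], of "cs 0" v]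
        cdiff_mult(2)[OF cdiff_const[of "cs 0" p] \<phi>, of v] by (simp add: cder_const)
    ultimately show ?thesis by (intro exI[of _ "cs 0"]) simp
  qed
  obtain c where c: "1 = c * \<phi> p" "0 = c * cder \<phi> p v" using ex[of "\<lambda>_. 1"] by (auto simp: cder_const)
  have "cdiff (\<lambda>w. t w - t p) z" for z by (rule cdiff_diff(1)[OF tc(1) cdiff_const])
  from ex[OF this] obtain d where d: "0 = d * \<phi> p" "t v = d * cder \<phi> p v"
    by (auto simp: cdiff_diff(2)[OF tc(1) cdiff_const] cder_const tc(2))
  show False using c d tv by auto
qed

lemma hadamard_c4:
  fixes h :: "c4 \<Rightarrow> complex"
  assumes h: "\<And>z. z \<in> ball p r \<Longrightarrow> cdiff h z"
  obtains k1 k2 k3 k4 where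
    "\<And>z. z \<in> ball p r \<Longrightarrow> cdiff k1 z \<and> cdiff k2 z \<and> cdiff k3 z \<and> cdiff k4 z"
    "\<And>z. z \<in> ball p r \<Longrightarrow> h z = h p + (fst (fst z) - fst (fst p)) * k1 z + (snd (fst z) - snd (fst p)) * k2 z
       + (fst (snd z) - fst (snd p)) * k3 z + (snd (snd z) - snd (snd p)) * k4 z"
proof -
  define k where "k = (\<lambda>v z. integral {0..1} (\<lambda>\<tau>. cder h (p + \<tau> *\<^sub>R (z - p)) v))"
  have H1: "cdiff (k v) z" and H2: "h z - h p = k (z - p) z"
    and H3: "k (c *\<^sub>C v) z = c * k v z" and H4: "k (v + w) z = k v z + k w z"
    if z: "z \<in> ball p r" for v w z c
    unfolding k_def by (rule hadamard[of p r h, OF _ z]; fact h)+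
  show ?thesis
  proof (rule that[of "k ((1, 0), 0)" "k ((0, 1), 0)" "k (0, (1, 0))" "k (0, (0, 1))"])
    fix z assume z: "z \<in> ball p r"
    show "cdiff (k ((1, 0), 0)) z \<and> cdiff (k ((0, 1), 0)) z \<and> cdiff (k (0, (1, 0))) z \<and> cdiff (k (0, (0, 1))) z"
      using H1[OF z] by blast
    have "k (z - p) z = fst (fst (z - p)) * k ((1, 0), 0) z + (snd (fst (z - p)) * k ((0, 1), 0) z
        + (fst (snd (z - p)) * k (0, (1, 0)) z + snd (snd (z - p)) * k (0, (0, 1)) z))"
      by (subst c4_expand) (simp only: H3[OF z] H4[OF z])
    then show "h z = h p + (fst (fst z) - fst (fst p)) * k ((1, 0), 0) z + (snd (fst z) - snd (fst p)) * k ((0, 1), 0) z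
       + (fst (snd z) - fst (snd p)) * k (0, (1, 0)) z + (snd (snd z) - snd (snd p)) * k (0, (0, 1)) z"
      using H2[OF z] by (simp add: algebra_simps)
  qed
qed

text \<open>A trivial common kernel makes the four generators local coordinates. In these,
  Hadamard's formula writes h - h(p) as a combination of the coordinates, that is, of the
  generators.\<close>

lemma spans_mod_one:
  assumes c: "\<And>z. cdiff g0 z" "\<And>z. cdiff g1 z" "\<And>z. cdiff g2 z" "\<And>z. cdiff g3 z"
    and z: "g0 p = 0" "g1 p = 0" "g2 p = 0" "g3 p = 0"
    and ker: "\<And>v. cder g0 p v = 0 \<Longrightarrow> cder g1 p v = 0 \<Longrightarrow> cder g2 p v = 0 \<Longrightarrow> cder g3 p v = 0 \<Longrightarrow> v = 0"
  shows "spans_mod p [g0, g1, g2, g3] [\<lambda>_. 1]"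
proof -
  define G :: "c4 \<Rightarrow> c4" where "G = (\<lambda>w. ((g0 w, g1 w), (g2 w, g3 w)))"
  have Gc: "cdiff G w" for w unfolding G_def by (intro cdiff_Pair(1) c)
  have Gd: "cder G w v = ((cder g0 w v, cder g1 w v), (cder g2 w v, cder g3 w v))" for w v
    unfolding G_def by (simp add: cdiff_Pair c)
  have Gp: "G p = 0" by (simp add: G_def z zero_prod_def)
  obtain U V \<psi> where inv: "open U" "U \<subseteq> UNIV" "p \<in> U" "open V" "G p \<in> V" "homeomorphism U V G \<psi>"
    "\<And>y. y \<in> V \<Longrightarrow> cdiff \<psi> y"
  proof (rule inverse_function_cdiff[of UNIV p G])
    show "continuous_on UNIV (\<lambda>z. cder G z v)" for v
      unfolding Gd by (intro continuous_on_Pair continuous_on_cder open_UNIV c)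
    show "v = 0" if "cder G p v = 0" for v
      using that ker[of v] by (simp add: Gd zero_prod_def)
    show "open (UNIV :: c4 set)" "p \<in> UNIV" "cdiff G z" for z by (simp_all add: Gc)
  qed (rule that; assumption)
  have "\<exists>cs. in_ideal p [g0, g1, g2, g3] (\<lambda>w. h w - (\<Sum>k<length [\<lambda>_. 1]. cs k * ([\<lambda>_. 1] ! k) w))"
    if hh: "hol4_at p h" for h
  proof -
    obtain Uh where Uh: "p \<in> Uh" "open Uh" "\<And>z. z \<in> Uh \<Longrightarrow> cdiff h z" using hh unfolding hol4_at_iff by blast
    have \<psi>0: "\<psi> 0 = p" using homeomorphism_apply1[OF inv(6,3)] Gp by simp
    define V' where "V' = V \<inter> \<psi> -` Uh"
    have "open V'" unfolding V'_def
      by (rule continuous_open_preimage[OF homeomorphism_cont2[OF inv(6)] inv(4) Uh(2)])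
    moreover have "0 \<in> V'" using inv(5) \<psi>0 Uh(1) Gp by (simp add: V'_def)
    ultimately obtain r where r: "r > 0" "ball 0 r \<subseteq> V'" using open_contains_ball by blast
    define H where "H = (\<lambda>y. h (\<psi> y))"
    have Hc: "cdiff H y" if "y \<in> ball 0 r" for y
    proof -
      have "y \<in> V" "\<psi> y \<in> Uh" using that r(2) by (auto simp: V'_def)
      then show ?thesis unfolding H_def using cdiff_compose(1)[OF inv(7) Uh(3)] by blast
    qed
    obtain k1 k2 k3 k4 where k: "\<And>z. z \<in> ball 0 r \<Longrightarrow> cdiff k1 z \<and> cdiff k2 z \<and> cdiff k3 z \<and> cdiff k4 z"
      "\<And>z. z \<in> ball 0 r \<Longrightarrow> H z = H 0 + (fst (fst z) - fst (fst (0::c4))) * k1 z + (snd (fst z) - snd (fst (0::c4))) * k2 z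
       + (fst (snd z) - fst (snd (0::c4))) * k3 z + (snd (snd z) - snd (snd (0::c4))) * k4 z"
    proof (rule hadamard_c4[of 0 r H])
      show "cdiff H z" if "z \<in> ball 0 r" for z by (rule Hc[OF that])
    qed (rule that; assumption)
    define N where "N = U \<inter> G -` ball 0 r"
    have N: "open N" unfolding N_def
      by (rule continuous_open_preimage[OF cdiff_continuous_on[OF Gc] inv(1) open_ball])
    have pN: "p \<in> N" using inv(3) Gp r(1) by (simp add: N_def)
    define hs where "hs = [\<lambda>w. k1 (G w), \<lambda>w. k2 (G w), \<lambda>w. k3 (G w), \<lambda>w. k4 (G w)]"
    have comp: "cdiff (\<lambda>w. k1 (G w)) w" "cdiff (\<lambda>w. k2 (G w)) w" "cdiff (\<lambda>w. k3 (G w)) w" "cdiff (\<lambda>w. k4 (G w)) w"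
      if "w \<in> N" for w
    proof -
      have "G w \<in> ball 0 r" using that by (simp add: N_def)
      then show "cdiff (\<lambda>w. k1 (G w)) w" "cdiff (\<lambda>w. k2 (G w)) w" "cdiff (\<lambda>w. k3 (G w)) w" "cdiff (\<lambda>w. k4 (G w)) w"
        using k(1)[of "G w"] cdiff_compose(1)[OF Gc] by blast+
    qed
    have "in_ideal p [g0, g1, g2, g3] (\<lambda>w. h w - h p)"
      unfolding in_ideal_def
    proof (intro exI[of _ N] exI[of _ hs] conjI ballI allI impI)
      fix i assume "i < length [g0, g1, g2, g3]"
      then have "i = 0 \<or> i = 1 \<or> i = 2 \<or> i = 3" by auto
      then show "hol4 N (hs ! i)" using N comp by (auto simp: hol4_iff_cdiff hs_def)
    next
      fix w assume w: "w \<in> N"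
      have "\<psi> (G w) = w" using homeomorphism_apply1[OF inv(6)] w by (simp add: N_def)
      then have "h w - h p = H (G w) - H 0" using \<psi>0 by (simp add: H_def)
      also have "\<dots> = g0 w * k1 (G w) + g1 w * k2 (G w) + g2 w * k3 (G w) + g3 w * k4 (G w)"
        using k(2)[of "G w"] w by (simp add: N_def) (simp add: G_def)
      also have "\<dots> = (\<Sum>k<length [g0, g1, g2, g3]. (hs ! k) w * ([g0, g1, g2, g3] ! k) w)"
        by (simp add: hs_def lessThan_Suc numeral_eq_Suc algebra_simps)
      finally show "h w - h p = (\<Sum>k<length [g0, g1, g2, g3]. (hs ! k) w * ([g0, g1, g2, g3] ! k) w)" .
    qed (use N pN in \<open>auto simp: hs_def\<close>)
    then show ?thesis by (intro exI[of _ "\<lambda>_. h p"]) simp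
  qed
  then show ?thesis unfolding spans_mod_def using hol4_atI[of "\<lambda>_. 1" p] by simp
qed

section \<open>Finite dimension from nilpotent coordinates\<close>

lemma in_ideal_add:
  assumes "in_ideal p gs h" "in_ideal p gs k"
  shows "in_ideal p gs (\<lambda>w. h w + k w)"
proof -
  obtain U hs where U: "p \<in> U" "open U" "\<forall>i<length gs. hol4 U (hs ! i)"
    "\<forall>w\<in>U. h w = (\<Sum>k<length gs. (hs ! k) w * (gs ! k) w)" using assms(1) unfolding in_ideal_def by blast
  obtain V ks where V: "p \<in> V" "open V" "\<forall>i<length gs. hol4 V (ks ! i)"
    "\<forall>w\<in>V. k w = (\<Sum>k<length gs. (ks ! k) w * (gs ! k) w)" using assms(2) unfolding in_ideal_def by blast
  define ls where "ls = map (\<lambda>i w. (hs ! i) w + (ks ! i) w) [0..<length gs]"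
  have l: "ls ! i = (\<lambda>w. (hs ! i) w + (ks ! i) w)" if "i < length gs" for i using that by (simp add: ls_def)
  show ?thesis
    unfolding in_ideal_def
  proof (intro exI[of _ "U \<inter> V"] exI[of _ ls] conjI allI impI ballI)
    show "hol4 (U \<inter> V) (ls ! i)" if "i < length gs" for i
      using U V that by (auto simp: l hol4_iff_cdiff intro!: cdiff_add(1))
    show "h w + k w = (\<Sum>k<length gs. (ls ! k) w * (gs ! k) w)" if "w \<in> U \<inter> V" for w
      using U V that by (simp add: l sum.distrib[symmetric] distrib_right)
  qed (use U V in \<open>auto simp: ls_def\<close>)
qed

lemma in_ideal_mult:
  assumes "in_ideal p gs h" "hol4_at p k"
  shows "in_ideal p gs (\<lambda>w. k w * h w)"
proof -
  obtain U hs where U: "p \<in> U" "open U" "\<forall>i<length gs. hol4 U (hs ! i)"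
    "\<forall>w\<in>U. h w = (\<Sum>k<length gs. (hs ! k) w * (gs ! k) w)" using assms(1) unfolding in_ideal_def by blast
  obtain V where V: "p \<in> V" "open V" "\<forall>z\<in>V. cdiff k z" using assms(2) unfolding hol4_at_iff by blast
  define ls where "ls = map (\<lambda>i w. k w * (hs ! i) w) [0..<length gs]"
  have l: "ls ! i = (\<lambda>w. k w * (hs ! i) w)" if "i < length gs" for i using that by (simp add: ls_def)
  show ?thesis
    unfolding in_ideal_def
  proof (intro exI[of _ "U \<inter> V"] exI[of _ ls] conjI allI impI ballI)
    show "hol4 (U \<inter> V) (ls ! i)" if "i < length gs" for i
      using U V that by (auto simp: l hol4_iff_cdiff intro!: cdiff_mult(1))
    show "k w * h w = (\<Sum>k<length gs. (ls ! k) w * (gs ! k) w)" if "w \<in> U \<inter> V" for w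
      using U V that by (simp add: l sum_distrib_left mult.assoc)
  qed (use U V in \<open>auto simp: ls_def\<close>)
qed

lemma in_ideal_cong:
  assumes "in_ideal p gs h" "open S" "p \<in> S" "\<And>w. w \<in> S \<Longrightarrow> k w = h w"
  shows "in_ideal p gs k"
proof -
  obtain U hs where U: "p \<in> U" "open U" "length hs = length gs" "\<forall>i<length gs. hol4 U (hs ! i)"
    "\<forall>w\<in>U. h w = (\<Sum>k<length gs. (hs ! k) w * (gs ! k) w)" using assms(1) unfolding in_ideal_def by blast
  show ?thesis
    unfolding in_ideal_def
    by (intro exI[of _ "U \<inter> S"] exI[of _ hs]) (use U assms(2-4) in \<open>auto simp: hol4_iff_cdiff\<close>)
qed

lemma in_ideal_zero: "in_ideal p gs (\<lambda>_. 0)"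
  unfolding in_ideal_def
  by (intro exI[of _ UNIV] exI[of _ "replicate (length gs) (\<lambda>_. 0)"]) (auto simp: hol4_iff_cdiff)

lemma poly_ring_coords4_cdiff:
  assumes "h \<in> poly_ring coords4"
  shows "cdiff h z"
  using assms
proof (induction rule: poly_ring.induct)
  case (const c)
  then show ?case by (simp add: Cst_def)
next
  case (coord t)
  have "cdiff (\<lambda>w::c4. fst (fst w)) z" "cdiff (\<lambda>w::c4. snd (fst w)) z"
    "cdiff (\<lambda>w::c4. fst (snd w)) z" "cdiff (\<lambda>w::c4. snd (snd w)) z"
    by (rule cdiff_fst(1) cdiff_snd(1) cdiff_ident)+
  then show ?case using coord by (auto simp: coords4_def)
next
  case (add g h)
  have "cdiff (\<lambda>w. g w + h w) z" by (rule cdiff_add(1)[OF add.IH])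
  then show ?case by (simp only: plus_fun_def)
next
  case (mult g h)
  have "cdiff (\<lambda>w. g w * h w) z" by (rule cdiff_mult(1)[OF mult.IH])
  then show ?case by (simp only: times_fun_def)
qed

lemma gen_ideal_imp_in_ideal:
  assumes R: "R = poly_ring coords4" and h: "h \<in> gen_ideal R gs"
  shows "in_ideal p gs h"
proof -
  obtain hs where hs: "h = (\<Sum>k<length gs. hs k * gs ! k)" "\<forall>k. hs k \<in> R"
    using h unfolding gen_ideal_def by blast
  show ?thesis
    unfolding in_ideal_def
    by (intro exI[of _ UNIV] exI[of _ "map hs [0..<length gs]"])
       (use hs in \<open>auto simp: hol4_iff_cdiff sum_fun_apply R intro: poly_ring_coords4_cdiff\<close>)
qed

text \<open>Once H is inverted as a germ, a power of each centred coordinate lies in the local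
  ideal, and the monomials with all exponents below a common bound M span. To see this, Hadamard's
  formula is applied again and again to the cofactor of a monomial; every application raises an
  exponent, until a power in the ideal appears.\<close>

lemma nilpotent_coords_imp_spans_mod:
  assumes R: "R = poly_ring coords4"
    and nil: "\<And>t. t \<in> coords4 \<Longrightarrow> \<exists>N H. H \<in> R \<and> H p \<noteq> 0 \<and> (t - Cst (t p)) ^ N * H \<in> gen_ideal R gs"
  shows "\<exists>\<phi>s. spans_mod p gs \<phi>s"
proof -
  define T where "T = (\<lambda>t::c4 \<Rightarrow> complex. \<lambda>w. t w - t p)"
  have tc: "cdiff t z" if "t \<in> coords4" for t z
    by (rule poly_ring_coords4_cdiff[OF poly_ring.coord[OF that]])
  have Tc: "cdiff (T t) z" if "t \<in> coords4" for t z
    unfolding T_def by (rule cdiff_diff(1)[OF tc[OF that] cdiff_const])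
  have "\<exists>N. \<forall>k. hol4_at p k \<longrightarrow> in_ideal p gs (\<lambda>w. T t w ^ N * k w)" if t: "t \<in> coords4" for t
  proof -
    obtain N H where H: "H \<in> R" "H p \<noteq> 0" "(t - Cst (t p)) ^ N * H \<in> gen_ideal R gs" using nil[OF t] by blast
    have Hc: "cdiff H z" for z using H(1) unfolding R by (rule poly_ring_coords4_cdiff)
    define S where "S = H -` (- {0})"
    have S: "open S" unfolding S_def using cdiff_continuous_on[of UNIV, OF Hc] by (intro open_vimage) auto
    have pS: "p \<in> S" using H(2) by (simp add: S_def)
    have I: "in_ideal p gs ((t - Cst (t p)) ^ N * H)" by (rule gen_ideal_imp_in_ideal[OF R H(3)])
    have "in_ideal p gs (\<lambda>w. T t w ^ N * k w)" if k: "hol4_at p k" for k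
    proof -
      have "cdiff (\<lambda>w. inverse (H w)) z" if "z \<in> S" for z
        by (rule cdiff_inverse[OF Hc]) (use that in \<open>simp add: S_def\<close>)
      then have "hol4_at p (\<lambda>w. inverse (H w))" unfolding hol4_at_iff using S pS by blast
      then have "hol4_at p (\<lambda>w. k w * inverse (H w))" by (rule hol4_at_mult[OF k])
      from in_ideal_mult[OF I this] show ?thesis
        by (rule in_ideal_cong[OF _ S pS]) (simp add: S_def T_def power_fun_apply)
    qed
    then show ?thesis by blast
  qed
  then obtain N where N: "\<And>t k. t \<in> coords4 \<Longrightarrow> hol4_at p k \<Longrightarrow> in_ideal p gs (\<lambda>w. T t w ^ N t * k w)" by metis
  \<comment> \<open>One exponent that works for all four coordinates.\<close>
  define M where "M = Max (N ` coords4)"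
  have NM: "N t \<le> M" if "t \<in> coords4" for t unfolding M_def using that finite_coords4 by (intro Max_ge) auto
  define x1 x2 y1 y2 where "x1 = T (\<lambda>w. fst (fst w))" and "x2 = T (\<lambda>w. snd (fst w))"
    and "y1 = T (\<lambda>w. fst (snd w))" and "y2 = T (\<lambda>w. snd (snd w))"
  have xc: "cdiff x1 z" "cdiff x2 z" "cdiff y1 z" "cdiff y2 z" for z
    unfolding x1_def x2_def y1_def y2_def by (rule Tc, simp add: coords4_def)+
  have high: "in_ideal p gs (\<lambda>w. x w ^ i * k w)"
    if Mi: "M \<le> i" and k: "hol4_at p k" and x: "x \<in> {x1, x2, y1, y2}" for x i k
  proof -
    obtain t where t: "t \<in> coords4" "x = T t" using x by (auto simp: x1_def x2_def y1_def y2_def coords4_def)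
    have "hol4_at p (\<lambda>w. x w ^ (i - N t))" unfolding t(2) by (rule hol4_atI, rule cdiff_power, rule Tc[OF t(1)])
    from N[OF t(1) hol4_at_mult[OF this k]]
    have "in_ideal p gs (\<lambda>w. x w ^ N t * (x w ^ (i - N t) * k w))" by (simp only: t(2))
    moreover have "x w ^ N t * (x w ^ (i - N t) * k w) = x w ^ i * k w" for w
      using NM[OF t(1)] Mi by (simp add: mult.assoc[symmetric] power_add[symmetric])
    ultimately show ?thesis by (simp only:)
  qed
  define mono where "mono = (\<lambda>(i, j, k, l). \<lambda>w. x1 w ^ i * x2 w ^ j * y1 w ^ k * y2 w ^ l)"
  have monoc: "cdiff (mono \<alpha>) z" for \<alpha> z
    unfolding mono_def case_prod_unfold by (intro cdiff_mult(1) cdiff_power xc)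
  obtain \<alpha>s where \<alpha>s: "set \<alpha>s = {..<M} \<times> {..<M} \<times> {..<M} \<times> {..<M}"
    using finite_list[of "{..<M} \<times> {..<M} \<times> {..<M} \<times> {..<M}"] by auto
  define \<phi>s where "\<phi>s = map mono \<alpha>s"
  define good where "good = (\<lambda>h. \<exists>cs. in_ideal p gs (\<lambda>w. h w - (\<Sum>k<length \<phi>s. cs k * (\<phi>s ! k) w)))"
  have good_add: "good (\<lambda>w. h w + k w)" if "good h" "good k" for h k
  proof -
    obtain cs ds where "in_ideal p gs (\<lambda>w. h w - (\<Sum>k<length \<phi>s. cs k * (\<phi>s ! k) w))"
      "in_ideal p gs (\<lambda>w. k w - (\<Sum>k<length \<phi>s. ds k * (\<phi>s ! k) w))" using \<open>good h\<close> \<open>good k\<close> unfolding good_def by blast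
    from in_ideal_add[OF this] show ?thesis
      unfolding good_def
      by (intro exI[of _ "\<lambda>i. cs i + ds i"], elim in_ideal_cong[OF _ open_UNIV UNIV_I])
         (simp add: distrib_right sum.distrib)
  qed
  have good_ideal: "good h" if "in_ideal p gs h" for h
    unfolding good_def using that by (intro exI[of _ "\<lambda>_. 0"]) simp
  have good_cong: "good k" if g: "good h" and S: "open S" "p \<in> S" and eq: "\<And>w. w \<in> S \<Longrightarrow> k w = h w" for h k S
  proof -
    obtain cs where "in_ideal p gs (\<lambda>w. h w - (\<Sum>k<length \<phi>s. cs k * (\<phi>s ! k) w))" using g unfolding good_def by blast
    then show ?thesis unfolding good_def
      by (intro exI[of _ cs], elim in_ideal_cong[OF _ S]) (simp add: eq)
  qed
  have good_mono: "good (\<lambda>w. c * mono \<alpha> w)" if \<alpha>: "\<alpha> \<in> set \<alpha>s" for c \<alpha>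
  proof -
    obtain m where m: "m < length \<phi>s" "\<phi>s ! m = mono \<alpha>" using \<alpha> unfolding \<phi>s_def by (metis in_set_conv_nth length_map nth_map)
    have "(\<Sum>k<length \<phi>s. (if k = m then c else 0) * (\<phi>s ! k) w) = c * mono \<alpha> w" for w
    proof -
      have "(\<Sum>k<length \<phi>s. (if k = m then c else 0) * (\<phi>s ! k) w) = (\<Sum>k<length \<phi>s. if k = m then c * (\<phi>s ! k) w else 0)"
        by (intro sum.cong) auto
      then show ?thesis using m by simp
    qed
    then show ?thesis unfolding good_def
      by (intro exI[of _ "\<lambda>k. if k = m then c else 0"]) (simp add: in_ideal_zero)
  qed
  have main: "good (\<lambda>w. mono (i, j, k, l) w * h w)" if "hol4_at p h" for i j k l h
    using that
  \<comment> \<open>While all exponents are below M their sum is below 4 M, so raising one of them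
    strictly lowers this measure in spite of truncated subtraction.\<close>
  proof (induction "4 * M - (i + j + k + l)" arbitrary: i j k l h rule: less_induct)
    case less
    note h = less.prems
    have hx: "hol4_at p (\<lambda>w. x w ^ n)" if "x \<in> {x1, x2, y1, y2}" for x n
      using that xc by (intro hol4_atI cdiff_power) auto
    consider "M \<le> i" | "M \<le> j" | "M \<le> k" | "M \<le> l" | "i < M" "j < M" "k < M" "l < M" by linarith
    then show ?case
    proof cases
      case 1
      have "hol4_at p (\<lambda>w. x2 w ^ j * (y1 w ^ k * (y2 w ^ l * h w)))"
        by (intro hol4_at_mult hx h) auto
      from high[OF 1 this, of x1] show ?thesis by (intro good_ideal) (simp add: mono_def mult.assoc)
    next
      case 2
      have "hol4_at p (\<lambda>w. x1 w ^ i * (y1 w ^ k * (y2 w ^ l * h w)))"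
        by (intro hol4_at_mult hx h) auto
      from high[OF 2 this, of x2] show ?thesis
        by (intro good_ideal) (simp add: mono_def mult.assoc mult.left_commute[of "x1 _ ^ i" "x2 _ ^ j"])
    next
      case 3
      have "hol4_at p (\<lambda>w. x1 w ^ i * (x2 w ^ j * (y2 w ^ l * h w)))"
        by (intro hol4_at_mult hx h) auto
      from high[OF 3 this, of y1] show ?thesis
        by (intro good_ideal) (simp add: mono_def mult.assoc mult.left_commute[of "x1 _ ^ i" "y1 _ ^ k"] mult.left_commute[of "x2 _ ^ j" "y1 _ ^ k"])
    next
      case 4
      have "hol4_at p (\<lambda>w. x1 w ^ i * (x2 w ^ j * (y1 w ^ k * h w)))"
        by (intro hol4_at_mult hx h) auto
      from high[OF 4 this, of y2] show ?thesis
        by (intro good_ideal) (simp add: mono_def mult.assoc mult.left_commute[of _ "y2 _ ^ l"])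
    next
      case 5
      obtain U where U: "p \<in> U" "open U" "\<forall>z\<in>U. cdiff h z" using h unfolding hol4_at_iff by blast
      then obtain r where r: "r > 0" "ball p r \<subseteq> U" using open_contains_ball by blast
      have hb: "cdiff h z" if "z \<in> ball p r" for z using that r U by blast
      obtain k1 k2 k3 k4 where kk: "\<And>z. z \<in> ball p r \<Longrightarrow> cdiff k1 z \<and> cdiff k2 z \<and> cdiff k3 z \<and> cdiff k4 z"
        "\<And>z. z \<in> ball p r \<Longrightarrow> h z = h p + (fst (fst z) - fst (fst p)) * k1 z + (snd (fst z) - snd (fst p)) * k2 z
           + (fst (snd z) - fst (snd p)) * k3 z + (snd (snd z) - snd (snd p)) * k4 z"
        by (rule hadamard_c4[OF hb]) blast+
      have hk: "hol4_at p k1" "hol4_at p k2" "hol4_at p k3" "hol4_at p k4"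
        unfolding hol4_at_iff by (rule exI[of _ "ball p r"]; use kk(1) r(1) in simp)+
      have "(i, j, k, l) \<in> set \<alpha>s" using 5 by (simp add: \<alpha>s)
      \<comment> \<open>The constant term of the cofactor contributes a spanning monomial; each of
        the other four terms has one more coordinate factor and falls under the induction
        hypothesis.\<close>
      have "good (\<lambda>w. h p * mono (i, j, k, l) w + (mono (Suc i, j, k, l) w * k1 w + (mono (i, Suc j, k, l) w * k2 w
          + (mono (i, j, Suc k, l) w * k3 w + mono (i, j, k, Suc l) w * k4 w))))"
        using 5 by (intro good_add good_mono \<open>(i, j, k, l) \<in> set \<alpha>s\<close> less.hyps hk) auto
      then show ?thesis
      proof (rule good_cong[OF _ open_ball[of p r]])
        fix w assume "w \<in> ball p r"
        then have "h w = h p + x1 w * k1 w + x2 w * k2 w + y1 w * k3 w + y2 w * k4 w"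
          using kk(2)[of w] by (simp add: x1_def x2_def y1_def y2_def T_def)
        then show "mono (i, j, k, l) w * h w = h p * mono (i, j, k, l) w + (mono (Suc i, j, k, l) w * k1 w
            + (mono (i, Suc j, k, l) w * k2 w + (mono (i, j, Suc k, l) w * k3 w + mono (i, j, k, Suc l) w * k4 w)))"
          by (simp add: mono_def algebra_simps)
      qed (use r in simp)
    qed
  qed
  have "good h" if "hol4_at p h" for h
    using main[OF that, of 0 0 0 0] by (simp add: mono_def)
  then have "spans_mod p gs \<phi>s"
    unfolding spans_mod_def good_def using hol4_atI[OF monoc] by (auto simp: \<phi>s_def)
  then show ?thesis by blast
qed

section \<open>Nonvanishing of the Jacobian\<close>


definition coords2 :: "(c2 \<Rightarrow> complex) set" where
  "coords2 = {fst, snd}"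

text \<open>After a shear, f - c1 is monic over X up to a constant, so the algebra of the fibre is
  finite over C[X]. Properness bounds X on the fibre; a missed value yields a nonzero polynomial in
  X vanishing there. This leaves finitely many values of X, and for each of them finitely many of
  the second coordinate.\<close>

lemma proper_fibre_finite:
  assumes f: "polyfun2 f" and g: "polyfun2 g" and nonconst: "\<exists>z. f z \<noteq> c1"
    and proper: "proper_map (pmap f g)"
  shows "finite {z. f z = c1 \<and> g z = c2}"
proof -
  define R where "R = poly_ring coords2"
  have Rs: "subring_set R" unfolding R_def by (rule subring_poly_ring)
  note closed = subring_setD[OF Rs]
  have cR: "Cst c \<in> R" for c unfolding R_def by (rule poly_ring.const)
  have xR: "fst \<in> R" "snd \<in> R" unfolding R_def coords2_def by (auto intro: poly_ring.coord)
  obtain \<Phi>f \<Phi>g where \<Phi>: "\<And>z. f z = ev2 \<Phi>f (fst z) (snd z)" "\<And>z. g z = ev2 \<Phi>g (fst z) (snd z)"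
    using f g unfolding polyfun2_def by blast
  define gs where "gs = [\<lambda>z. f z - c1, \<lambda>z. g z - c2]"
  have "(\<lambda>z. f z - c1) = peval2 (\<Phi>f - [:[:c1:]:]) fst snd" "(\<lambda>z. g z - c2) = peval2 (\<Phi>g - [:[:c2:]:]) fst snd"
    by (simp_all add: peval2_def \<Phi>)
  then have gsR: "set gs \<subseteq> R"
    using peval2_in_poly_ring[of fst coords2 snd] xR by (simp add: gs_def R_def)
  define I where "I = gen_ideal R gs"
  note I = gen_ideal[OF Rs gsR, folded I_def]
  have V: "(\<forall>h\<in>I. h z = 0) \<longleftrightarrow> f z = c1 \<and> g z = c2" for z
    unfolding I_def gen_ideal_zero_iff[OF Rs gsR] by (simp add: gs_def)
  have "\<Phi>f - [:[:c1:]:] \<noteq> 0"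
  proof
    assume "\<Phi>f - [:[:c1:]:] = 0"
    then have "ev2 (\<Phi>f - [:[:c1:]:]) (fst z) (snd z) = 0" for z :: c2 by (simp only: ev2_simps)
    then show False using nonconst by (simp add: \<Phi>)
  qed
  then obtain \<tau> \<kappa> \<Psi> where sh: "\<kappa> \<noteq> 0" "lead_coeff \<Psi> = 1"
    "\<And>s t. ev2 (\<Phi>f - [:[:c1:]:]) (s + \<tau> * t) t = \<kappa> * ev2 \<Psi> s t" using shear_monic by blast
  have fPsi: "f z - c1 = \<kappa> * ev2 \<Psi> (fst z - \<tau> * snd z) (snd z)" for z
    using sh(3)[of "fst z - \<tau> * snd z" "snd z"] \<Phi>(1)[of z] by simp
  define X :: "c2 \<Rightarrow> complex" where "X = fst - Cst \<tau> * snd"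
  have XR: "X \<in> R" unfolding X_def by (intro closed(3,4) xR cR)
  have rel: "peval2 \<Psi> X snd \<in> I"
  proof -
    have "peval2 \<Psi> X snd = Cst (1 / \<kappa>) * (\<lambda>z. f z - c1)"
      using sh(1) by (simp add: fun_eq_iff peval2_def fPsi[simplified] X_def)
    moreover have "(\<lambda>z. f z - c1) \<in> I" using I(3) by (auto simp: gs_def)
    ultimately show ?thesis using ideal_ofD(3)[OF I(1) cR] by (simp only:)
  qed
  \<comment> \<open>The second parameter is the constant 0: the two-parameter form of Nakayama's
    lemma serves here with the single parameter X.\<close>
  have fg: "fin_gen R I (\<lambda>\<Phi>. peval2 \<Phi> X (Cst 0))"
  proof -
    define ev where "ev = (\<lambda>\<Phi>. peval2 \<Phi> X (Cst 0))"
    have hom: "comm_ring_hom ev" unfolding ev_def by (rule comm_ring_hom_peval2)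
    have evR: "ev \<Phi> \<in> R" for \<Phi> unfolding ev_def using XR cR unfolding R_def by (intro peval2_in_poly_ring)
    have evX: "peval q X = ev [:q:]" and evC: "Cst c = ev [:[:c:]:]" for q c
      by (simp_all add: ev_def peval_def peval2_def fun_eq_iff)
    have evRs: "range ev \<subseteq> R" using evR by blast
    note st0 = stabilizer_coeffs[OF hom I(1) evR]
    have st0X: "peval q X \<in> stabilizer R (mod_span (range ev) G I)" for q G
      unfolding evX by (rule st0)
    have G0: "{1} \<subseteq> R" using closed(1) by simp
    define G where "G = {g * snd ^ i | g i. g \<in> {1 :: c2 \<Rightarrow> complex} \<and> i < degree \<Psi>}"
    note s1 = mod_span_adjoin_integral[OF Rs I(1) evRs G0 xR(2) mod_span_one[OF hom I(1)] monic_relation[OF sh(2) rel] st0X,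
        folded G_def]
    have finG: "finite G" unfolding G_def by (intro finite_mult_powers) simp
    define M where "M = stabilizer R (mod_span (range ev) G I)"
    note Mcl = stabilizer_closed[OF Rs I(1), of _ "range ev" G, folded M_def]
    have sM: "snd \<in> M" and cM: "Cst c \<in> M" for c using s1(3) st0[of "[:[:c:]:]" G] unfolding M_def evC by auto
    have "X = peval [:0, 1:] X" by (simp add: peval_def)
    then have XM: "X \<in> M" using st0X[of "[:0, 1:]" G] unfolding M_def by (simp only:)
    have "fst = X + Cst \<tau> * snd" by (simp add: X_def)
    then have "fst \<in> M" using Mcl(1)[OF XM Mcl(2)[OF cM[of \<tau>] sM]] by (simp only:)
    then have "coords2 \<subseteq> M" using sM by (simp add: coords2_def)
    then show ?thesis
      using fin_gen_of_mod_span[OF R_def I(1) finG s1(1) hom refl s1(2)] cM unfolding M_def ev_def by blast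
  qed
  have cont: "continuous_on UNIV X" unfolding X_def fun_diff_def times_fun_def Cst_def by (intro continuous_intros)
  obtain \<beta> where \<beta>: "\<And>z. pmap f g z \<in> {(c1, c2)} \<Longrightarrow> X z \<noteq> \<beta>"
    using proper_preimage_bounded[OF proper, of "{(c1, c2)}", OF _ cont] by auto
  have "\<exists>\<Phi>. ev2 \<Phi> \<beta> 0 \<noteq> 0 \<and> peval2 \<Phi> X (Cst 0) \<in> I"
  proof (rule nakayama_empty_fibre[OF R_def _ _ I(1,2) XR cR fg])
    show "finite coords2" by (simp add: coords2_def)
    show "\<exists>w. \<forall>t\<in>coords2. t w = r t" for r
      by (intro exI[of _ "(r fst, r snd)"]) (simp add: coords2_def)
    show False if "\<And>h. h \<in> I \<Longrightarrow> h w = 0" "X w = \<beta>" for w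
      using V[of w] \<beta>[of w] that by (auto simp: pmap_def)
  qed
  then obtain \<Phi> where \<Phi>: "ev2 \<Phi> \<beta> 0 \<noteq> 0" "peval2 \<Phi> X (Cst 0) \<in> I" by blast
  define q where "q = poly \<Phi> [:0:]"
  have q: "ev2 \<Phi> s 0 = poly q s" for s by (simp add: ev2_def q_def)
  have "q \<noteq> 0" using \<Phi>(1) q by auto
  then have "finite {x. poly q x = 0}" by (rule poly_roots_finite)
  moreover have "finite {t. poly (map_poly (\<lambda>q. poly q x) \<Psi>) t = 0}" for x
    by (intro poly_roots_finite map_poly_at_nonzero_if_monic sh)
  ultimately have "finite (\<Union>x\<in>{x. poly q x = 0}. (\<lambda>t. (x + \<tau> * t, t)) ` {t. poly (map_poly (\<lambda>q. poly q x) \<Psi>) t = 0})"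
    by blast
  moreover have "{z. f z = c1 \<and> g z = c2} \<subseteq> (\<Union>x\<in>{x. poly q x = 0}. (\<lambda>t. (x + \<tau> * t, t)) ` {t. poly (map_poly (\<lambda>q. poly q x) \<Psi>) t = 0})"
  proof
    fix z assume "z \<in> {z. f z = c1 \<and> g z = c2}"
    then have fz: "f z = c1" "g z = c2" by auto
    have "poly q (X z) = 0" using V[of z] fz \<Phi>(2) q[of "X z"] by (auto simp: peval2_def)
    moreover have "poly (map_poly (\<lambda>q. poly q (X z)) \<Psi>) (snd z) = 0"
      using fPsi[of z] fz sh(1) by (simp add: ev2_at X_def)
    moreover have "z = (X z + \<tau> * snd z, snd z)" by (simp add: X_def prod_eq_iff)
    ultimately show "z \<in> (\<Union>x\<in>{x. poly q x = 0}. (\<lambda>t. (x + \<tau> * t, t)) ` {t. poly (map_poly (\<lambda>q. poly q x) \<Psi>) t = 0})"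
      by blast
  qed
  ultimately show ?thesis by (rule finite_subset[rotated])
qed

text \<open>If the Jacobian vanishes identically, then in the local coordinates (l, f) the function
  g depends on f alone. A piece of the level curve of f through q therefore lies in one fibre of the
  map.\<close>

lemma degenerate_fibre_infinite:
  assumes f: "\<And>z. cdiff f z" and g: "\<And>z. cdiff g z" and l: "\<And>z. cdiff l z"
    and J: "\<And>z. jac f g z = 0" and j: "jac l f q \<noteq> 0"
  shows "infinite {z. f z = f q \<and> g z = g q}"
proof -
  have jc: "cdiff (jac l f) z" for z by (rule cdiff_jac[of UNIV]) (auto simp: f l)
  define U where "U = jac l f -` (- {0})"
  have U: "open U" unfolding U_def using cdiff_continuous_on[of UNIV, OF jc] by (intro open_vimage) auto
  have qU: "q \<in> U" using j by (simp add: U_def)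
  obtain U' V \<psi> where inv: "open U'" "U' \<subseteq> U" "q \<in> U'" "open V" "(l q, f q) \<in> V"
    "homeomorphism U' V (\<lambda>z. (l z, f z)) \<psi>" "\<And>y. y \<in> V \<Longrightarrow> cdiff \<psi> y"
    by (rule inverse_function_c2[OF U qU l f j]) blast+
  have \<psi>U: "\<psi> y \<in> U'" if "y \<in> V" for y
    using homeomorphism_image2[OF inv(6)] that by blast
  have \<psi>l: "l (\<psi> y) = fst y" and \<psi>f: "f (\<psi> y) = snd y" if "y \<in> V" for y
    using homeomorphism_apply2[OF inv(6) that] by (metis fst_conv, metis snd_conv)
  have \<psi>\<phi>: "\<psi> (l z, f z) = z" and \<phi>V: "(l z, f z) \<in> V" if "z \<in> U'" for z
    using homeomorphism_image1[OF inv(6)] homeomorphism_apply1[OF inv(6) that] that by blast+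
  define P where "P = (\<lambda>y. g (\<psi> y))"
  have Pc: "cdiff P y" if "y \<in> V" for y
    unfolding P_def by (rule cdiff_compose(1)[OF inv(7)[OF that] g])
  have Ps: "pdx P y = 0" if y: "y \<in> V" for y
  proof -
    define z where "z = \<psi> y"
    have zU: "z \<in> U'" and yz: "y = (l z, f z)" using \<psi>U[OF y] \<psi>l[OF y] \<psi>f[OF y] by (simp_all add: z_def)
    note ch = jac_chain_partials[OF Pc[OF \<phi>V[OF zU]] l f]
    have "cder g z = cder (\<lambda>z. P (l z, f z)) z"
      by (rule cdiff_transform(2)[OF ch(1) inv(1) zU]) (simp add: P_def \<psi>\<phi>)
    then have d: "cder g z v = pdx P y * cder l z v + pdy P y * cder f z v" for v using ch(2)[of v] by (simp add: yz)
    have "jac g f z = pdx P y * jac l f z"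
      unfolding jac_cder[OF g f] jac_cder[OF l f] d by (simp add: algebra_simps)
    moreover have "jac g f z = 0" using jac_swap[of g f z] J by simp
    moreover have "jac l f z \<noteq> 0" using zU inv(2) by (auto simp: U_def)
    ultimately show ?thesis by simp
  qed
  obtain r where r: "r > 0" "ball (l q, f q) r \<subseteq> V" using inv(4,5) open_contains_ball by blast
  have inV: "(s, f q) \<in> V" if "s \<in> ball (l q) r" for s
    using that r(2) by (auto simp: dist_Pair_Pair)
  have "P (s, f q) = P (l q, f q)" if "s \<in> ball (l q) r" for s
  proof (rule has_field_derivative_zero_constant[THEN exE, of "ball (l q) r" "\<lambda>s. P (s, f q)"])
    show "((\<lambda>s. P (s, f q)) has_field_derivative 0) (at x within ball (l q) r)" if x: "x \<in> ball (l q) r" for x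
    proof -
      have i: "cdiff (\<lambda>t. (t, f q)) x" by (intro cdiff_Pair(1) cdiff_ident cdiff_const)
      have id: "cder (\<lambda>t. (t, f q)) x 1 = (1, 0)"
        using cdiff_Pair(2)[OF cdiff_ident[of x] cdiff_const[of "f q" x], of 1] by (simp add: cder_ident cder_const)
      note c = cdiff_compose[OF i Pc[OF inV[OF x]]]
      have "cder (\<lambda>t. P (t, f q)) x 1 = pdx P (x, f q)"
        using c(2)[of 1] id cder_c2(2)[OF Pc[OF inV[OF x]]] by simp
      then have "cder (\<lambda>t. P (t, f q)) x 1 = 0" using Ps[OF inV[OF x]] by simp
      then show ?thesis using cdiff_imp_field_derivative[OF c(1)] by (simp add: has_field_derivative_at_within)
    qed
    fix c assume "\<forall>x\<in>ball (l q) r. P (x, f q) = c"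
    then show "P (s, f q) = P (l q, f q)" using that r(1) by simp
  qed simp
  then have "(\<lambda>s. \<psi> (s, f q)) ` ball (l q) r \<subseteq> {z. f z = f q \<and> g z = g q}"
    using \<psi>f inV \<psi>\<phi>[OF inv(3)] by (auto simp: P_def)
  moreover have "inj_on (\<lambda>s. \<psi> (s, f q)) (ball (l q) r)"
    by (rule inj_on_inverseI[of _ l]) (simp add: \<psi>l inV del: mem_ball)
  moreover have "infinite (ball (l q) r)" using r(1) by (simp add: uncountable_infinite uncountable_ball)
  ultimately show ?thesis using finite_imageD finite_subset by blast
qed

text \<open>A nonconstant f has a nonzero partial derivative somewhere, so one of the two coordinate
  functions can serve as the transversal l. The infinite fibre obtained from a vanishing Jacobian
  contradicts finiteness of the fibres.\<close>

lemma jac_nonzero_if_nonconst: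
  assumes f: "polyfun2 f" and g: "polyfun2 g" and nonconst: "\<exists>z w. f z \<noteq> f w"
    and proper: "proper_map (pmap f g)"
  shows "\<exists>z. jac f g z \<noteq> 0"
proof (rule ccontr)
  assume "\<not> ?thesis"
  then have J: "jac f g z = 0" for z by blast
  note fc = polyfun2_cdiff[OF f] and gc = polyfun2_cdiff[OF g]
  have "\<exists>q. pdx f q \<noteq> 0 \<or> pdy f q \<noteq> 0"
  proof (rule ccontr)
    assume "\<not> ?thesis"
    then have "pdx f z = 0" "pdy f z = 0" for z by blast+
    then have "cder f z = (\<lambda>_. 0)" for z by (intro ext) (simp only: cder_c2(1)[OF fc] mult_zero_left add_0)
    then have "(f has_derivative (\<lambda>_. 0)) (at z within UNIV)" for z using cdiffD(1)[OF fc, of z] by simp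
    then have "\<exists>c. \<forall>z\<in>UNIV. f z = c" by (intro has_derivative_zero_constant) auto
    then show False using nonconst by auto
  qed
  then obtain q where q: "pdx f q \<noteq> 0 \<or> pdy f q \<noteq> 0" by blast
  have "jac fst f q = pdy f q" "jac snd f q = - pdx f q"
    by (simp_all add: jac_def pdx_def[of fst] pdy_def[of fst] pdx_def[of snd] pdy_def[of snd])
  then have "jac fst f q \<noteq> 0 \<or> jac snd f q \<noteq> 0" using q by auto
  moreover have "cdiff (fst :: c2 \<Rightarrow> complex) z" "cdiff (snd :: c2 \<Rightarrow> complex) z" for z
    using polyfun2_cdiff polyfun2_closed(2,3) by blast+
  ultimately have "infinite {z. f z = f q \<and> g z = g q}"
    using degenerate_fibre_infinite[OF fc gc _ J] by blast
  moreover have "\<exists>z. f z \<noteq> f q" using nonconst by metis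
  ultimately show False using proper_fibre_finite[OF f g _ proper] by blast
qed

text \<open>Swapping the target coordinates preserves properness, so either component may be the
  nonconstant one. If both are constant, the preimage of one point is the whole plane, which is not
  compact.\<close>

lemma proper_imp_jac_nonzero:
  assumes f: "polyfun2 f" and g: "polyfun2 g" and proper: "proper_map (pmap f g)"
  shows "\<exists>z. jac f g z \<noteq> 0"
proof -
  consider "\<exists>z w. f z \<noteq> f w" | "\<exists>z w. g z \<noteq> g w" | "\<And>z w. f z = f w" "\<And>z w. g z = g w" by metis
  then show ?thesis
  proof cases
    case 1
    then show ?thesis by (rule jac_nonzero_if_nonconst[OF f g _ proper])
  next
    case 2
    have "proper_map (pmap g f)"
      unfolding proper_map_def
    proof (intro allI impI)
      fix K :: "c2 set" assume "compact K"
      then have "compact (prod.swap ` K)" by (intro compact_continuous_image continuous_on_swap)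
      moreover have "pmap g f -` K = pmap f g -` (prod.swap ` K)" by (force simp: pmap_def)
      ultimately show "compact (pmap g f -` K)" using proper by (simp add: proper_map_def)
    qed
    from jac_nonzero_if_nonconst[OF g f 2 this] show ?thesis using jac_swap[of f g] by (metis neg_equal_0_iff_equal)
  next
    case 3
    have "pmap f g z = pmap f g 0" for z using 3(1)[of z 0] 3(2)[of z 0] by (simp add: pmap_def)
    then have "pmap f g -` {pmap f g 0} = UNIV" by blast
    then have "compact (UNIV :: c2 set)" using proper unfolding proper_map_def by (metis compact_sing)
    then show ?thesis using compact_imp_bounded not_bounded_UNIV by blast
  qed
qed

section \<open>Nodes and multiplicity one\<close>

text \<open>The letters are partial derivatives: of J, f, g at a, and K, p, q for the same functions
  at b. The first two equations make the vectors v and w multiples, by s and t, of (- Jy, Jx) and (-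
  Ky, Kx). The last two then read s e_a = t e_b, and \<open>D\<close> says that e_a and e_b are
  independent.\<close>

lemma pair_kernel_trivial:
  fixes Jx Jy fx fy gx gy Kx Ky px py qx qy v1 v2 w1 w2 :: complex
  assumes D: "(Jx * fy - Jy * fx) * (Kx * qy - Ky * qx) - (Jx * gy - Jy * gx) * (Kx * py - Ky * px) \<noteq> 0"
    and e: "Jx * v1 + Jy * v2 = 0" "Kx * w1 + Ky * w2 = 0"
      "fx * v1 + fy * v2 = px * w1 + py * w2" "gx * v1 + gy * v2 = qx * w1 + qy * w2"
  shows "v1 = 0 \<and> v2 = 0 \<and> w1 = 0 \<and> w2 = 0"
proof -
  have par: "\<exists>s. x = - s * b \<and> y = s * a" if "a * x + b * y = 0" "a \<noteq> 0 \<or> b \<noteq> 0" for a b x y :: complex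
  proof (cases "a = 0")
    case True
    then show ?thesis using that by (intro exI[of _ "- x / b"]) auto
  next
    case False
    have "x = - (y / a) * b" using that(1) False by (simp add: field_simps add_eq_0_iff)
    then show ?thesis using False by (intro exI[of _ "y / a"]) auto
  qed
  have "Jx \<noteq> 0 \<or> Jy \<noteq> 0" "Kx \<noteq> 0 \<or> Ky \<noteq> 0" using D by auto
  then obtain s t where s: "v1 = - s * Jy" "v2 = s * Jx" and t: "w1 = - t * Ky" "w2 = t * Kx"
    using par[OF e(1)] par[OF e(2)] by blast
  define A1 A2 B1 B2 where "A1 = Jx * fy - Jy * fx" and "A2 = Jx * gy - Jy * gx"
    and "B1 = Kx * py - Ky * px" and "B2 = Kx * qy - Ky * qx"
  have 1: "s * A1 = t * B1" using e(3) unfolding s t A1_def B1_def by (simp add: algebra_simps)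
  have 2: "s * A2 = t * B2" using e(4) unfolding s t A2_def B2_def by (simp add: algebra_simps)
  have D': "A1 * B2 - A2 * B1 \<noteq> 0" using D by (simp add: A1_def A2_def B1_def B2_def)
  have "s * (A1 * B2 - A2 * B1) = (s * A1) * B2 - (s * A2) * B1" by (simp add: algebra_simps)
  also have "\<dots> = 0" unfolding 1 2 by simp
  finally have "s = 0" using D' by simp
  have "t * (A1 * B2 - A2 * B1) = A1 * (t * B2) - A2 * (t * B1)" by (simp add: algebra_simps)
  also have "\<dots> = 0" unfolding 1[symmetric] 2[symmetric] by simp
  finally have "t = 0" using D' by simp
  then show ?thesis using \<open>s = 0\<close> s t by simp
qed

text \<open>If the gradient of J vanishes at one of the points, a kernel vector of the singular
  differential of F there, paired with 0, is a solution. Otherwise a dependency s e_a = t e_b lifts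
  to the vectors s (- Jy, Jx) and t (- Ky, Kx), not both zero.\<close>

lemma pair_kernel_nontrivial:
  fixes Jx Jy fx fy gx gy Kx Ky px py qx qy :: complex
  assumes D: "(Jx * fy - Jy * fx) * (Kx * qy - Ky * qx) - (Jx * gy - Jy * gx) * (Kx * py - Ky * px) = 0"
    and J: "fx * gy - fy * gx = 0" "px * qy - py * qx = 0"
  shows "\<exists>v1 v2 w1 w2. (v1 \<noteq> 0 \<or> v2 \<noteq> 0 \<or> w1 \<noteq> 0 \<or> w2 \<noteq> 0) \<and> Jx * v1 + Jy * v2 = 0 \<and> Kx * w1 + Ky * w2 = 0 \<and>
      fx * v1 + fy * v2 = px * w1 + py * w2 \<and> gx * v1 + gy * v2 = qx * w1 + qy * w2"
proof -
  have sing: "\<exists>x y. (x \<noteq> 0 \<or> y \<noteq> 0) \<and> a * x + b * y = 0 \<and> c * x + d * y = 0" if "a * d - b * c = 0" for a b c d :: complex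
  proof (cases "a \<noteq> 0 \<or> b \<noteq> 0")
    case True
    then show ?thesis using that by (intro exI[of _ "- b"] exI[of _ a]) (auto simp: algebra_simps)
  next
    case False
    then show ?thesis
      by (cases "c \<noteq> 0 \<or> d \<noteq> 0")
         (rule exI[of _ "- d"] exI[of _ 1], rule exI[of _ c] exI[of _ 0], auto simp: algebra_simps)+
  qed
  consider "Jx = 0" "Jy = 0" | "Kx = 0" "Ky = 0" | "Jx \<noteq> 0 \<or> Jy \<noteq> 0" "Kx \<noteq> 0 \<or> Ky \<noteq> 0" by blast
  then show ?thesis
  proof cases
    case 1
    obtain x y where "x \<noteq> 0 \<or> y \<noteq> 0" "fx * x + fy * y = 0" "gx * x + gy * y = 0" using sing[OF J(1)] by blast
    then show ?thesis using 1 by (intro exI[of _ x] exI[of _ y] exI[of _ 0]) auto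
  next
    case 2
    obtain x y where "x \<noteq> 0 \<or> y \<noteq> 0" "px * x + py * y = 0" "qx * x + qy * y = 0" using sing[OF J(2)] by blast
    then show ?thesis using 2 by (intro exI[of _ 0] exI[of _ x] exI[of _ y]) auto
  next
    case 3
    define A1 A2 B1 B2 where "A1 = Jx * fy - Jy * fx" and "A2 = Jx * gy - Jy * gx"
      and "B1 = Kx * py - Ky * px" and "B2 = Kx * qy - Ky * qx"
    have D': "A1 * B2 = A2 * B1" using D by (simp add: A1_def A2_def B1_def B2_def)
    have "\<exists>s t. (s \<noteq> 0 \<or> t \<noteq> 0) \<and> s * A1 = t * B1 \<and> s * A2 = t * B2"
    proof (cases "A1 = 0")
      case True
      show ?thesis
      proof (cases "A2 = 0")
        case True
        then show ?thesis using \<open>A1 = 0\<close> by (intro exI[of _ 1] exI[of _ 0]) simp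
      next
        case False
        then show ?thesis using \<open>A1 = 0\<close> D' by (intro exI[of _ B2] exI[of _ A2]) auto
      qed
    next
      case False
      then show ?thesis using D' by (intro exI[of _ B1] exI[of _ A1]) (auto simp: mult.commute)
    qed
    then obtain s t where st: "s \<noteq> 0 \<or> t \<noteq> 0" "s * A1 = t * B1" "s * A2 = t * B2" by blast
    have "fx * (- s * Jy) + fy * (s * Jx) = px * (- t * Ky) + py * (t * Kx)"
      "gx * (- s * Jy) + gy * (s * Jx) = qx * (- t * Ky) + qy * (t * Kx)"
      using st(2,3) by (simp_all add: A1_def A2_def B1_def B2_def algebra_simps)
    then show ?thesis
      using st(1) 3
      by (intro exI[of _ "- s * Jy"] exI[of _ "s * Jx"] exI[of _ "- t * Ky"] exI[of _ "t * Kx"]) auto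
  qed
qed

text \<open>The differentials of the four generators at (a, b) form the linear system treated just
  before, so their common kernel is trivial exactly when the determinant is nonzero.\<close>

lemma spans_mod_singleton_iff_fold_det:
  assumes f: "polyfun2 f" and g: "polyfun2 g" and J: "jac f g a = 0" "jac f g b = 0"
    and F: "f a = f b" "g a = g b"
  shows "(\<exists>\<phi>. spans_mod (a, b) (pair_gens (jac f g) f g) [\<phi>]) \<longleftrightarrow> fold_det f g a b \<noteq> 0"
proof -
  note fc = polyfun2_cdiff[OF f] and gc = polyfun2_cdiff[OF g] and Jc = polyfun2_cdiff[OF polyfun2_jac[OF f g]]
  define K where "K = jac f g"
  define g0 g1 g2 g3 :: "c4 \<Rightarrow> complex" where "g0 = (\<lambda>w. K (fst w))" and "g1 = (\<lambda>w. K (snd w))"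
    and "g2 = (\<lambda>w. f (fst w) - f (snd w))" and "g3 = (\<lambda>w. g (fst w) - g (snd w))"
  have gens: "pair_gens (jac f g) f g = [g0, g1, g2, g3]"
    by (simp add: pair_gens_def K_def g0_def g1_def g2_def g3_def case_prod_unfold)
  have x: "cdiff (\<lambda>w. h (fst w)) w" "cder (\<lambda>w. h (fst w)) w v = cder h (fst w) (fst v)"
    and y: "cdiff (\<lambda>w. h (snd w)) w" "cder (\<lambda>w. h (snd w)) w v = cder h (snd w) (snd v)"
    if h: "\<And>z. cdiff h z" for h :: "c2 \<Rightarrow> complex" and w v :: c4
    using cdiff_compose[OF cdiff_fst(1)[OF cdiff_ident] h] cdiff_compose[OF cdiff_snd(1)[OF cdiff_ident] h]
    by (simp_all add: cdiff_fst(2) cdiff_snd(2) cder_ident)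
  have c: "cdiff g0 w" "cdiff g1 w" "cdiff g2 w" "cdiff g3 w" for w
    unfolding g0_def g1_def g2_def g3_def K_def by (intro x(1) y(1) cdiff_diff(1) fc gc Jc)+
  have d: "cder g0 (a, b) v = cder K a (fst v)" "cder g1 (a, b) v = cder K b (snd v)"
    "cder g2 (a, b) v = cder f a (fst v) - cder f b (snd v)" "cder g3 (a, b) v = cder g a (fst v) - cder g b (snd v)" for v
    unfolding g0_def g1_def g2_def g3_def
    by (simp_all add: cdiff_diff(2) x[OF fc] y[OF fc] x[OF gc] y[OF gc] x[OF Jc[folded K_def]] y[OF Jc[folded K_def]])
  have z: "g0 (a, b) = 0" "g1 (a, b) = 0" "g2 (a, b) = 0" "g3 (a, b) = 0"
    using J F by (simp_all add: g0_def g1_def g2_def g3_def K_def)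
  note ex = cder_c2(1)[OF fc] cder_c2(1)[OF gc] cder_c2(1)[OF Jc[folded K_def]]
  have det: "fold_det f g a b = (pdx K a * pdy f a - pdy K a * pdx f a) * (pdx K b * pdy g b - pdy K b * pdx g b)
      - (pdx K a * pdy g a - pdy K a * pdx g a) * (pdx K b * pdy f b - pdy K b * pdx f b)"
    by (simp add: fold_det_def K_def[symmetric] jac_def[of K])
  show ?thesis
  proof
    assume "\<exists>\<phi>. spans_mod (a, b) (pair_gens (jac f g) f g) [\<phi>]"
    then obtain \<phi> where sp: "spans_mod (a, b) [g0, g1, g2, g3] [\<phi>]" unfolding gens by blast
    show "fold_det f g a b \<noteq> 0"
    proof
      assume "fold_det f g a b = 0"
      from pair_kernel_nontrivial[OF this[unfolded det] J[unfolded jac_def]]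
      obtain v1 v2 w1 w2 where v: "v1 \<noteq> 0 \<or> v2 \<noteq> 0 \<or> w1 \<noteq> 0 \<or> w2 \<noteq> 0"
        "pdx K a * v1 + pdy K a * v2 = 0" "pdx K b * w1 + pdy K b * w2 = 0"
        "pdx f a * v1 + pdy f a * v2 = pdx f b * w1 + pdy f b * w2"
        "pdx g a * v1 + pdy g a * v2 = pdx g b * w1 + pdy g b * w2" by blast
      have "((v1, v2), (w1, w2)) = 0"
      proof (rule spans_mod_singleton_kernel[OF sp])
        fix h assume "h \<in> set [g0, g1, g2, g3]"
        then show "h (a, b) = 0 \<and> cdiff h (a, b) \<and> cder h (a, b) ((v1, v2), (w1, w2)) = 0"
          using v(2-5) c[of "(a, b)"] z by (auto simp: d ex)
      qed
      then show False using v(1) by (simp add: zero_prod_def)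
    qed
  next
    assume nz: "fold_det f g a b \<noteq> 0"
    have "spans_mod (a, b) [g0, g1, g2, g3] [\<lambda>_. 1]"
    proof (rule spans_mod_one[OF c z])
      fix v :: c4
      assume "cder g0 (a, b) v = 0" "cder g1 (a, b) v = 0" "cder g2 (a, b) v = 0" "cder g3 (a, b) v = 0"
      then show "v = 0"
        using pair_kernel_trivial[OF nz[unfolded det], of "fst (fst v)" "snd (fst v)" "fst (snd v)" "snd (snd v)"]
        by (simp add: d ex prod_eq_iff)
    qed
    then show "\<exists>\<phi>. spans_mod (a, b) (pair_gens (jac f g) f g) [\<phi>]" unfolding gens by blast
  qed
qed

text \<open>The determinant is alternating in the two points. Its nonvanishing therefore forces a
  and b to be distinct, and it does not matter which of them carries \<open>fold1\<close>.\<close>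

lemma is_node_iff_fold_det:
  assumes f: "polyfun2 f" and g: "polyfun2 g" and J: "jac f g a = 0" "jac f g b = 0"
    and F: "pmap f g a = pmap f g b"
  shows "is_node f g a b \<longleftrightarrow> fold_det f g a b \<noteq> 0"
proof
  note fc = polyfun2_cdiff[OF f] and gc = polyfun2_cdiff[OF g]
  assume "is_node f g a b"
  then show "fold_det f g a b \<noteq> 0"
    unfolding is_node_def
    using bigerm_folds_imp_fold_det[OF fc gc F] bigerm_folds_imp_fold_det[OF fc gc F[symmetric]] fold_det_swap[of f g b a]
    by auto
next
  note fc = polyfun2_cdiff[OF f] and gc = polyfun2_cdiff[OF g]
  assume nz: "fold_det f g a b \<noteq> 0"
  have "a \<noteq> b"
  proof
    assume "a = b"
    then have "fold_det f g a b = 0" by (simp add: fold_det_def)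
    then show False using nz by simp
  qed
  then show "is_node f g a b"
    unfolding is_node_def using F fold_det_imp_bigerm_folds[OF fc gc J F nz] by blast
qed

theorem theorem2p17:
  fixes d1 d2 :: nat and f g :: "c2 \<Rightarrow> complex" and a b c :: c2
  assumes "d1 \<ge> 1" and "d2 \<ge> 1"
    and "(f, g) \<in> Omega2 d1 d2"
    and "proper_map (pmap f g)"
    and "gen_node f g a b"
    and "pmap f g a = c" and "pmap f g b = c"
  shows "is_node f g a b \<longleftrightarrow> nu f g a b = 1"
proof -
  have f: "polyfun2 f" and g: "polyfun2 g"
    using assms(3) poly2_imp_polyfun2 by (auto simp: Omega2_def)
  have J: "jac f g a = 0" "jac f g b = 0" and F: "pmap f g a = pmap f g b"
    using assms(5) by (auto simp: gen_node_def crit_def)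
  have F': "f a = f b" "g a = g b" using F by (simp_all add: pmap_def)
  obtain \<epsilon> where \<epsilon>: "\<epsilon> > 0" "\<And>x y. x \<in> crit f g \<Longrightarrow> y \<in> crit f g \<Longrightarrow> pmap f g x = pmap f g y \<Longrightarrow>
      dist (x, y) (a, b) < \<epsilon> \<Longrightarrow> x = a \<and> y = b"
    using assms(5) unfolding gen_node_def by blast
  define R where "R = poly_ring coords4"
  define gs where "gs = pair_gens (jac f g) f g"
  have Rs: "subring_set R" unfolding R_def by (rule subring_poly_ring)
  have gsR: "set gs \<subseteq> R"
    unfolding R_def gs_def by (rule pair_gens_in_poly_ring[OF polyfun2_jac[OF f g] f g])
  have V: "(\<forall>h\<in>gen_ideal R gs. h w = 0) \<longleftrightarrow> jac f g (fst w) = 0 \<and> jac f g (snd w) = 0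
      \<and> f (fst w) = f (snd w) \<and> g (fst w) = g (snd w)" for w
    unfolding gen_ideal_zero_iff[OF Rs gsR] unfolding gs_def by (rule pair_gens_zero_iff)
  obtain u where u: "u \<in> R" "fin_gen R (gen_ideal R gs) (\<lambda>q. peval q u)"
    using pair_ideal_fin_gen[OF R_def polyfun2_jac[OF f g] f g proper_imp_jac_nonzero[OF f g assms(4)] assms(4)]
    unfolding gs_def by blast
  \<comment> \<open>The common zeros of the ideal are exactly the pairs of critical points with
    equal image, so the isolation in \<open>gen_node\<close> is isolation in the zero set.\<close>
  have nil: "\<exists>N H. H \<in> R \<and> H (a, b) \<noteq> 0 \<and> (t - Cst (t (a, b))) ^ N * H \<in> gen_ideal R gs" if t: "t \<in> coords4" for t
  proof (rule isolated_zero_nilpotent_coords[OF R_def gen_ideal(1,2)[OF Rs gsR] u _ \<epsilon>(1) _ t])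
    show "h (a, b) = 0" if "h \<in> gen_ideal R gs" for h
      using V[of "(a, b)"] J F' that by simp
    show "w = (a, b)" if "\<And>h. h \<in> gen_ideal R gs \<Longrightarrow> h w = 0" "dist w (a, b) < \<epsilon>" for w
      using \<epsilon>(2)[of "fst w" "snd w"] V[of w] that by (simp add: crit_def pmap_def prod_eq_iff)
  qed
  have "\<exists>\<phi>s. spans_mod (a, b) gs \<phi>s" by (rule nilpotent_coords_imp_spans_mod[OF R_def nil])
  moreover have "h (a, b) = 0" if "h \<in> set gs" for h
    using that J F' pair_gens_zero_iff[of "jac f g" f g "(a, b)"] by (simp add: gs_def)
  ultimately have "local_dim (a, b) gs = 1 \<longleftrightarrow> (\<exists>\<phi>. spans_mod (a, b) gs [\<phi>])"
    by (intro local_dim_eq_1_iff)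
  moreover have "nu f g a b = local_dim (a, b) gs" by (simp add: nu_def gs_def pair_gens_def)
  ultimately show ?thesis
    using spans_mod_singleton_iff_fold_det[OF f g J F'] is_node_iff_fold_det[OF f g J F] by (simp add: gs_def)
qed

end
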